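(* Let $N=2n$ and specialise the inhomogeneity parameters to $w_{2i-1}=x_i$, $w_{2i}=x_i^{-1}$, $i=1,\dots,n$, with $x_1,\dots,x_n$ and $b$ generic. Let $\Xi_{\rm D}(x_1,\dots,x_n;b)=\langle\chi(x_1,\dots,x_n)|\psi_{\rm D}\rangle$, where $|\psi_{\rm D}\rangle$ is the special eigenvector for the diagonal twist. Then $$\Xi_{\rm D}(x_1,\dots,x_n;b)=\Big([q]^n\prod_{i=1}^n[bx_i]\prod_{1\le i<j\le2n}[qw_i/w_j]\Big)Z_{\rm U}(\{x_i\}_{i=1}^n;\{x_i\}_{i=1}^n;b),$$ where $Z_{\rm U}$ is the partition function of the six-vertex model on a $2n\times n$ rectangle with U-turn boundary conditions.
   Context: Notation: $[z]=z-z^{-1}$; $q\in\mathbb C^\times$. Tsuchiya's formula for the six-vertex partition function with U-turn boundary conditions, which may be taken as its definition (for coinciding arguments by continuity), is $$Z_{\rm U}(\{x_i\}_{i=1}^n;\{y_i\}_{i=1}^n;b)=\frac{[q^2]^n\prod_{i=1}^n[b/y_i][q^2x_i^2]\prod_{i,j=1}^n[qx_i/y_j][qy_j/x_i][qx_iy_j][q/(x_iy_j)]}{\prod_{1\le i<j\le n}[x_j/x_i][y_i/y_j]\prod_{1\le i\le j\le n}[1/(x_ix_j)][y_iy_j]}\det_{1\le i,j\le n}\left(\frac1{[qx_i/y_j][qy_j/x_i]}-\frac1{[qx_iy_j][q/(x_iy_j)]}\right).$$ $\mathbb C^2$ has basis $|{\uparrow}\rangle,|{\downarrow}\rangle$ and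 $\mathbb C^3$ has basis $|{\Uparrow}\rangle,|0\rangle,|{\Downarrow}\rangle$. On two sites put $|\chi(z)\rangle=[bz][bqz]\,|{\Uparrow\Downarrow}\rangle+[b^{-1}qz][bqz]\,|00\rangle+[b^{-1}z][b^{-1}qz]\,|{\Downarrow\Uparrow}\rangle$, and $|\chi(x_1,\dots,x_n)\rangle=\bigotimes_{j=1}^n|\chi(x_j)\rangle\in(\mathbb C^3)^{\otimes2n}$; $\langle\chi|=|\chi\rangle^t$ (transpose). $R(z)$ is the operator on $\mathbb C^2\otimes\mathbb C^3$ with diagonal entries $[q^2z],[qz],[z],[z],[qz],[q^2z]$ on $|{\uparrow\Uparrow}\rangle,|{\uparrow}0\rangle,|{\uparrow\Downarrow}\rangle,|{\downarrow\Uparrow}\rangle,|{\downarrow}0\rangle,|{\downarrow\Downarrow}\rangle$, and whose only non-zero off-diagonal entries are those between $|{\uparrow}0\rangle$ and $|{\downarrow\Uparrow}\rangle$ and between $|{\uparrow\Downarrow}\rangle$ and $|{\downarrow}0\rangle$ (both directions), all equal to $\sqrt{[q][q^2]}$ (a fixed root). For $w_1,\dots,w_N\in\mathbb C^\times$ and auxiliary space $a\simeq\mathbb C^2$, $$R_{a,N}(q^{-1}z/w_N)\cdots R_{a,1}(q^{-1}z/w_1)=\begin{pmatrix}\mathcal A(z)&\mathcal B(z)\\ \mathcal C(z)&\mathcal D(z)\end{pmatrix}_a ,$$ and $|\psi_{\rm D}\rangle=\prod_{j=1}^N\mathcal B(w_j)|{\Uparrow\cdots\Uparrow}\rangle$ (the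 $\mathcal B$'s commute). *)

theory Defs
  imports "HOL-Analysis.Function_Topology" "Jordan_Normal_Form.Determinant"
begin

text \<open>All indices are 0-based: \<open>x i\<close> with \<open>i < n\<close> stands for $x_{i+1}$, \<open>w k\<close> with \<open>k < N\<close>
  for $w_{k+1}$, and the list position \<open>k\<close> of a configuration is the site $k+1$.
  The bracket \<open>br z\<close> is $[z] = z - z^{-1}$.\<close>

definition br :: "complex \<Rightarrow> complex" where
  "br z = z - inverse z"


subsection \<open>Tsuchiya's partition function with U-turn boundary conditions\<close>

definition ZU_formula ::
    "complex \<Rightarrow> nat \<Rightarrow> (nat \<Rightarrow> complex) \<Rightarrow> (nat \<Rightarrow> complex) \<Rightarrow> complex \<Rightarrow> complex" where
  "ZU_formula q n x y b =
     (br (q^2) ^ n * (\<Prod>i<n. br (b / y i) * br (q^2 * (x i)^2)) *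
      (\<Prod>i<n. \<Prod>j<n. br (q * x i / y j) * br (q * y j / x i) *
                      br (q * x i * y j) * br (q / (x i * y j))))
     / ((\<Prod>j<n. \<Prod>i<j. br (x j / x i) * br (y i / y j)) *
        (\<Prod>j<n. \<Prod>i\<le>j. br (1 / (x i * x j)) * br (y i * y j)))
     * Determinant.det (mat n n (\<lambda>(i, j).
          1 / (br (q * x i / y j) * br (q * y j / x i))
        - 1 / (br (q * x i * y j) * br (q / (x i * y j)))))"

text \<open>No denominator in Tsuchiya's formula vanishes. (Zero arguments are excluded as well, since
  \<open>br 0 = 0\<close>.)\<close>

definition ZU_regular :: "complex \<Rightarrow> nat \<Rightarrow> (nat \<Rightarrow> complex) \<Rightarrow> (nat \<Rightarrow> complex) \<Rightarrow> bool" where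
  "ZU_regular q n x y \<longleftrightarrow>
     (\<forall>j<n. \<forall>i<j. br (x j / x i) \<noteq> 0 \<and> br (y i / y j) \<noteq> 0) \<and>
     (\<forall>j<n. \<forall>i\<le>j. br (1 / (x i * x j)) \<noteq> 0 \<and> br (y i * y j) \<noteq> 0) \<and>
     (\<forall>i<n. \<forall>j<n. br (q * x i / y j) \<noteq> 0 \<and> br (q * y j / x i) \<noteq> 0 \<and>
                     br (q * x i * y j) \<noteq> 0 \<and> br (q / (x i * y j)) \<noteq> 0)"

text \<open>At singular arguments the value is given by continuity, as the limit along regular
  arguments. Coordinates with index at least \<open>n\<close> do not matter for this limit in the product
  topology.\<close>

definition ZU ::
    "complex \<Rightarrow> nat \<Rightarrow> (nat \<Rightarrow> complex) \<Rightarrow> (nat \<Rightarrow> complex) \<Rightarrow> complex \<Rightarrow> complex" where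
  "ZU q n x y b =
     (if ZU_regular q n x y then ZU_formula q n x y b
      else Lim (at (x, y) within {(x', y'). ZU_regular q n x' y'})
             (\<lambda>(x', y'). ZU_formula q n x' y' b))"


subsection \<open>Spin configurations and the R-matrix\<close>

datatype spin_half = Up | Dn

datatype spin_one = UUp | Zero | DDn

lemma UNIV_spin_half: "UNIV = {Up, Dn}"
  using spin_half.exhaust by auto

lemma UNIV_spin_one: "UNIV = {UUp, Zero, DDn}"
  using spin_one.exhaust by auto

instance spin_half :: finite
  by standard (simp add: UNIV_spin_half)

instance spin_one :: finite
  by standard (simp add: UNIV_spin_one)

fun R_diag :: "complex \<Rightarrow> complex \<Rightarrow> spin_half \<times> spin_one \<Rightarrow> complex" where
  "R_diag q z (Up, UUp) = br (q^2 * z)"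
| "R_diag q z (Up, Zero) = br (q * z)"
| "R_diag q z (Up, DDn) = br z"
| "R_diag q z (Dn, UUp) = br z"
| "R_diag q z (Dn, Zero) = br (q * z)"
| "R_diag q z (Dn, DDn) = br (q^2 * z)"

text \<open>\<open>R_mat q s z \<alpha> \<beta>\<close> is the entry in row \<open>\<alpha>\<close> and column \<open>\<beta>\<close>; the parameter \<open>s\<close> is the chosen
  square root of $[q][q^2]$.\<close>

definition R_mat ::
    "complex \<Rightarrow> complex \<Rightarrow> complex \<Rightarrow> spin_half \<times> spin_one \<Rightarrow> spin_half \<times> spin_one \<Rightarrow> complex" where
  "R_mat q s z \<alpha> \<beta> =
     (if \<alpha> = \<beta> then R_diag q z \<alpha>
      else if {\<alpha>, \<beta>} = {(Up, Zero), (Dn, UUp)} \<or> {\<alpha>, \<beta>} = {(Up, DDn), (Dn, Zero)} then s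
      else 0)"


subsection \<open>Monodromy matrix and the special eigenvector\<close>

text \<open>A vector of $(\mathbb C^3)^{\otimes N}$ is given by its coordinates in the standard basis,
  which is indexed by the lists of length \<open>N\<close>; values at lists of other lengths are irrelevant.
  A vector of the tensor product with the auxiliary space carries an additional first argument
  for the auxiliary spin.\<close>

type_synonym chain_vec = "spin_one list \<Rightarrow> complex"
type_synonym aux_chain_vec = "spin_half \<Rightarrow> spin_one list \<Rightarrow> complex"

definition R_site ::
    "complex \<Rightarrow> complex \<Rightarrow> nat \<Rightarrow> complex \<Rightarrow> aux_chain_vec \<Rightarrow> aux_chain_vec" where
  "R_site q s k z \<Psi> = (\<lambda>a \<sigma>.
     \<Sum>(c, \<tau>)\<in>UNIV. R_mat q s z (a, \<sigma> ! k) (c, \<tau>) * \<Psi> c (\<sigma>[k := \<tau>]))"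

text \<open>The product $R_{a,N}(q^{-1}z/w_N)\cdots R_{a,1}(q^{-1}z/w_1)$: site 1 acts first.\<close>

primrec monodromy ::
    "complex \<Rightarrow> complex \<Rightarrow> (nat \<Rightarrow> complex) \<Rightarrow> complex \<Rightarrow> nat \<Rightarrow> aux_chain_vec \<Rightarrow> aux_chain_vec" where
  "monodromy q s w z 0 \<Psi> = \<Psi>"
| "monodromy q s w z (Suc k) \<Psi> =
     R_site q s k (inverse q * z / w k) (monodromy q s w z k \<Psi>)"

text \<open>The upper right block of the monodromy matrix, from auxiliary \<open>Dn\<close> to auxiliary \<open>Up\<close>.\<close>

definition B_op ::
    "complex \<Rightarrow> complex \<Rightarrow> nat \<Rightarrow> (nat \<Rightarrow> complex) \<Rightarrow> complex \<Rightarrow> chain_vec \<Rightarrow> chain_vec" where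
  "B_op q s N w z v = monodromy q s w z N (\<lambda>c \<sigma>. if c = Dn then v \<sigma> else 0) Up"

definition all_up :: "nat \<Rightarrow> chain_vec" where
  "all_up N = (\<lambda>\<sigma>. if \<sigma> = replicate N UUp then 1 else 0)"

definition psi_D :: "complex \<Rightarrow> complex \<Rightarrow> nat \<Rightarrow> (nat \<Rightarrow> complex) \<Rightarrow> chain_vec" where
  "psi_D q s N w = foldr (\<lambda>j v. B_op q s N w (w j) v) [0..<N] (all_up N)"


subsection \<open>The overlap\<close>

fun chi_pair :: "complex \<Rightarrow> complex \<Rightarrow> complex \<Rightarrow> spin_one \<Rightarrow> spin_one \<Rightarrow> complex" where
  "chi_pair q b z UUp DDn = br (b * z) * br (b * q * z)"
| "chi_pair q b z Zero Zero = br (inverse b * q * z) * br (b * q * z)"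
| "chi_pair q b z DDn UUp = br (inverse b * z) * br (inverse b * q * z)"
| "chi_pair q b z _ _ = 0"

definition chi :: "complex \<Rightarrow> complex \<Rightarrow> nat \<Rightarrow> (nat \<Rightarrow> complex) \<Rightarrow> chain_vec" where
  "chi q b n x = (\<lambda>\<sigma>. \<Prod>j<n. chi_pair q b (x j) (\<sigma> ! (2 * j)) (\<sigma> ! (2 * j + 1)))"

text \<open>The dual vector is the transpose, so the pairing is bilinear (no complex conjugation).\<close>

definition pairing :: "nat \<Rightarrow> chain_vec \<Rightarrow> chain_vec \<Rightarrow> complex" where
  "pairing N u v = (\<Sum>\<sigma> | length \<sigma> = N. u \<sigma> * v \<sigma>)"

definition inhom :: "(nat \<Rightarrow> complex) \<Rightarrow> nat \<Rightarrow> complex" where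
  "inhom x k = (if even k then x (k div 2) else inverse (x (k div 2)))"

definition Xi_D :: "complex \<Rightarrow> complex \<Rightarrow> nat \<Rightarrow> (nat \<Rightarrow> complex) \<Rightarrow> complex \<Rightarrow> complex" where
  "Xi_D q s n x b = pairing (2 * n) (chi q b n x) (psi_D q s (2 * n) (inhom x))"

end

theory Submission
  imports Defs 
begin

text \<open>The operators \<open>B\<close> and \<open>D\<close> satisfy exchange relations, so splitting off one site at a time
  gives a closed formula for a product of \<open>2n\<close> operators \<open>B\<close> on the reference state as a sum over distributions of the
  rapidities \<open>z\<close> over the sites. Contracting a pair of sites with \<open>\<chi>\<close> makes the overlap a sum over
  ways to assign unordered pairs of rapidities to the \<open>x\<^sub>i\<close>. This sum is the one for spin one half with
  \<open>q\<close> replaced by a square root of \<open>q\<close> and with \<open>2n\<close> boundary columns \<open>q^(\<plusminus>1/2) x\<^sub>i\<close> (fusion), which by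
  Lagrange interpolation in one column parameter after the other is Tsuchiya's determinant of size
  \<open>2n\<close>. When half of the rapidities are the \<open>1/x\<^sub>j\<close>, row operations make that determinant block
  triangular and reduce it to Tsuchiya's determinant of size \<open>n\<close> for \<open>q\<close>, with the other half of the
  rapidities as vertical parameters \<open>y\<^sub>j\<close>. The theorem is the limit \<open>y\<^sub>j \<rightarrow> x\<^sub>j\<close>.\<close>

subsection \<open>Exchange relations\<close>

text \<open>\<open>psi_D\<close> uses the inhomogeneities themselves as rapidities, so both
  \<open>x_i\<close> and \<open>1/x_i\<close> occur among them. The rows and Vandermonde products of
  the determinants see a rapidity only through \<open>eta z = z^2 + z^(-2)\<close>, which is the
  same for both, so the denominators vanish there. Hence the overlap is studied for a free set of
  rapidities: one half sits at \<open>1/x_j\<close>, where the row polynomials have zeros, the other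
  half is moved off. The bare product of \<open>B\<close> operators is continuous in the rapidities
  and carries the equality back.

  The boundary state is tractable because its weights, symmetrised over the two rapidities on a pair
  of sites, factor as \<open>[b/u][b/v]\<close>. So \<open>b\<close> leaves the sum at once: the
  rapidities \<open>1/x_i\<close> give the \<open>[b x_i]\<close> of the prefactor, and the
  \<open>y_i\<close> give the \<open>[b/y_i]\<close> in \<open>Z_U\<close>. The square root of
  \<open>q\<close> in the fusion never has to be chosen, because the columns enter only through
  \<open>q x^2 + 1/(q x^2)\<close> and \<open>x^2/q + q/x^2\<close>. Likewise \<open>s\<close>
  enters the overlap only as \<open>s^2 = [q][q^2]\<close>, once for each pair of sites.\<close>

definition exch_f :: "complex \<Rightarrow> complex \<Rightarrow> complex \<Rightarrow> complex" where
  "exch_f q u v = br (q * u / v) / br (u / v)"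

text \<open>With \<open>exch_f\<close>, the coefficients in
  \<open>D(u) B(v) = exch_f q u v B(v) D(u) + exch_g q u v B(u) D(v)\<close>, which is
  \<open>exchange_relation\<close> for \<open>a = Dn\<close>, \<open>b = Up\<close> divided by
  \<open>br (u / v)\<close>.\<close>

definition exch_g :: "complex \<Rightarrow> complex \<Rightarrow> complex \<Rightarrow> complex" where
  "exch_g q u v = - br q / br (u / v)"

text \<open>The column of the monodromy matrix with incoming auxiliary state \<open>Dn\<close>: the auxiliary component
  \<open>Up\<close> is the operator \<open>B\<close> and \<open>Dn\<close> is \<open>D\<close>. The recursion splits off the last site.\<close>

primrec transfer_col :: "complex \<Rightarrow> complex \<Rightarrow> (nat \<Rightarrow> complex) \<Rightarrow> complex \<Rightarrow> nat \<Rightarrow> spin_half \<Rightarrow>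
    chain_vec \<Rightarrow> chain_vec" where
  "transfer_col q s w z 0 a v = (\<lambda>\<sigma>. if a = Dn then v \<sigma> else 0)"
| "transfer_col q s w z (Suc k) a v = (\<lambda>\<sigma>. \<Sum>(e, \<tau>)\<in>UNIV.
     R_mat q s (inverse q * z / w k) (a, last \<sigma>) (e, \<tau>) *
     transfer_col q s w z k e (\<lambda>\<rho>. v (\<rho> @ [\<tau>])) (butlast \<sigma>))"

lemma sum_aux_spin: "(\<Sum>p\<in>UNIV. f p) = f (Up, UUp) + f (Up, Zero) + f (Up, DDn)
    + f (Dn, UUp) + f (Dn, Zero) + (f (Dn, DDn) :: complex)"
  by (simp add: UNIV_Times_UNIV[symmetric] UNIV_spin_half UNIV_spin_one del: UNIV_Times_UNIV)

text \<open>The suffix \<open>rest\<close> holds the sites that the first \<open>k\<close> factors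
  leave alone. The generalisation over it lets the induction peel off the last site touched.\<close>

lemma monodromy_eq_transfer_col:
  "length \<rho> = k \<Longrightarrow>
   monodromy q s w z k (\<lambda>c \<sigma>. if c = Dn then v \<sigma> else 0) a (\<rho> @ rest) =
   transfer_col q s w z k a (\<lambda>\<rho>'. v (\<rho>' @ rest)) \<rho>"
proof (induction k arbitrary: \<rho> rest a)
  case 0
  then show ?case by simp
next
  case (Suc k)
  then obtain \<rho>' \<tau> where r: "\<rho> = \<rho>' @ [\<tau>]" "length \<rho>' = k"
    by (metis length_Suc_conv_rev)
  show ?case
    using Suc.IH[OF r(2)] by (simp add: r R_site_def nth_append list_update_append)
qed

lemma transfer_col_snoc:
  "transfer_col q s w z (Suc k) Up v (\<sigma> @ [UUp]) =
     br (q\<^sup>2 * (inverse q * z / w k)) * transfer_col q s w z k Up (\<lambda>\<rho>. v (\<rho> @ [UUp])) \<sigma>"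
  "transfer_col q s w z (Suc k) Up v (\<sigma> @ [Zero]) =
     br (q * (inverse q * z / w k)) * transfer_col q s w z k Up (\<lambda>\<rho>. v (\<rho> @ [Zero])) \<sigma>
     + s * transfer_col q s w z k Dn (\<lambda>\<rho>. v (\<rho> @ [UUp])) \<sigma>"
  "transfer_col q s w z (Suc k) Up v (\<sigma> @ [DDn]) =
     br (inverse q * z / w k) * transfer_col q s w z k Up (\<lambda>\<rho>. v (\<rho> @ [DDn])) \<sigma>
     + s * transfer_col q s w z k Dn (\<lambda>\<rho>. v (\<rho> @ [Zero])) \<sigma>"
  "transfer_col q s w z (Suc k) Dn v (\<sigma> @ [UUp]) =
     br (inverse q * z / w k) * transfer_col q s w z k Dn (\<lambda>\<rho>. v (\<rho> @ [UUp])) \<sigma>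
     + s * transfer_col q s w z k Up (\<lambda>\<rho>. v (\<rho> @ [Zero])) \<sigma>"
  "transfer_col q s w z (Suc k) Dn v (\<sigma> @ [Zero]) =
     br (q * (inverse q * z / w k)) * transfer_col q s w z k Dn (\<lambda>\<rho>. v (\<rho> @ [Zero])) \<sigma>
     + s * transfer_col q s w z k Up (\<lambda>\<rho>. v (\<rho> @ [DDn])) \<sigma>"
  "transfer_col q s w z (Suc k) Dn v (\<sigma> @ [DDn]) =
     br (q\<^sup>2 * (inverse q * z / w k)) * transfer_col q s w z k Dn (\<lambda>\<rho>. v (\<rho> @ [DDn])) \<sigma>"
  by (auto simp: sum_aux_spin R_mat_def doubleton_eq_iff)

lemma transfer_col_lin2:
  "transfer_col q s w z k a (\<lambda>\<sigma>. x * f \<sigma> + y * g \<sigma>) \<sigma> = x * transfer_col q s w z k a f \<sigma> + y * transfer_col q s w z k a g \<sigma>"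
proof (induction k arbitrary: a f g \<sigma>)
  case (Suc k)
  show ?case
    by (simp add: Suc.IH sum_distrib_left sum.distrib[symmetric] case_prod_unfold algebra_simps)
qed simp

lemma transfer_col_scale: "transfer_col q s w z k a (\<lambda>\<sigma>. x * f \<sigma>) \<sigma> = x * transfer_col q s w z k a f \<sigma>"
  using transfer_col_lin2[of q s w z k a x f 0 f \<sigma>] by simp

lemma transfer_col_add: "transfer_col q s w z k a (\<lambda>\<sigma>. f \<sigma> + g \<sigma>) \<sigma> = transfer_col q s w z k a f \<sigma> + transfer_col q s w z k a g \<sigma>"
  using transfer_col_lin2[of q s w z k a 1 f 1 g \<sigma>] by simp

lemma transfer_col_zero: "transfer_col q s w z k a (\<lambda>\<sigma>. 0) \<sigma> = 0"
  using transfer_col_scale[of q s w z k a 0 "\<lambda>\<sigma>. 0" \<sigma>] by simp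

lemma transfer_col_sum:
  "transfer_col q s w z k a (\<lambda>\<sigma>. \<Sum>i\<in>I. c i * f i \<sigma>) \<sigma> = (\<Sum>i\<in>I. c i * transfer_col q s w z k a (f i) \<sigma>)"
  by (induction I rule: infinite_finite_induct) (simp_all add: transfer_col_zero transfer_col_add transfer_col_scale)

text \<open>Identities between chain vectors hold only on lists of the right length and are not
  equalities of functions; this carries them under \<open>transfer_col\<close>.\<close>

lemma transfer_col_cong:
  assumes "\<And>\<rho>. length \<rho> = length \<sigma> \<Longrightarrow> f \<rho> = g \<rho>" "length \<sigma> = k"
  shows "transfer_col q s w z k a f \<sigma> = transfer_col q s w z k a g \<sigma>"
  using assms
proof (induction k arbitrary: a f g \<sigma>)
  case (Suc k)
  then obtain \<sigma>' \<tau> where r: "\<sigma> = \<sigma>' @ [\<tau>]" "length \<sigma>' = k"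
    by (metis length_Suc_conv_rev)
  have "transfer_col q s w z k e (\<lambda>\<rho>. f (\<rho> @ [t])) \<sigma>' = transfer_col q s w z k e (\<lambda>\<rho>. g (\<rho> @ [t])) \<sigma>'" for e t
    using r Suc.prems by (intro Suc.IH) auto
  then show ?case by (simp add: r)
qed simp

text \<open>The part of the RTT relation with both incoming auxiliary states equal to \<open>Dn\<close>, which is closed
  under adding a site.\<close>

lemma exchange_relation:
  assumes q: "q \<noteq> 0" and s: "s^2 = br q * br (q^2)" and w: "\<And>i. i < k \<Longrightarrow> w i \<noteq> 0"
    and u: "u \<noteq> 0" and v: "v \<noteq> 0" and len: "length \<sigma> = k"
  shows "(if a = b then br (q * (u / v)) * transfer_col q s w u k a (transfer_col q s w v k a f) \<sigma>
          else br (u / v) * transfer_col q s w u k a (transfer_col q s w v k b f) \<sigma>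
               + br q * transfer_col q s w u k b (transfer_col q s w v k a f) \<sigma>)
         = br (q * (u / v)) * transfer_col q s w v k b (transfer_col q s w u k a f) \<sigma>"
  using w len
proof (induction k arbitrary: a b f \<sigma>)
  case 0
  then show ?case by (cases a; cases b) auto
next
  case (Suc k)
  then obtain \<sigma>' \<tau> where r: "\<sigma> = \<sigma>' @ [\<tau>]" "length \<sigma>' = k"
    by (metis length_Suc_conv_rev)
  have wk: "w k \<noteq> 0" using Suc.prems by auto
  \<comment> \<open>The ratio of the rapidities survives division by the inhomogeneity, so the
    coefficients of the relation are the same at every site.\<close>
  define U where "U = inverse q * u / w k"
  define V where "V = inverse q * v / w k"
  have UV: "U \<noteq> 0" "V \<noteq> 0" "u / v = U / V"
    using q u v wk by (auto simp: U_def V_def)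
  define X where "X = (\<lambda>a b t. transfer_col q s w u k a (transfer_col q s w v k b (\<lambda>\<rho>. f (\<rho> @ [t]))) \<sigma>')"
  define Y where "Y = (\<lambda>a b t. transfer_col q s w v k a (transfer_col q s w u k b (\<lambda>\<rho>. f (\<rho> @ [t]))) \<sigma>')"
  have IH: "br (q * (U/V)) * Y b a t = (if a = b then br (q * (U/V)) * X a a t
          else br (U/V) * X a b t + br q * X b a t)" for a b t
    unfolding X_def Y_def UV(3)[symmetric]
    by (subst Suc.IH[symmetric]) (use Suc.prems r in auto)
  have IHs: "br (q * (U/V)) * Y Up Up t = br (q * (U/V)) * X Up Up t"
     "br (q * (U/V)) * Y Dn Dn t = br (q * (U/V)) * X Dn Dn t"
     "br (q * (U/V)) * Y Up Dn t = br (U/V) * X Dn Up t + br q * X Up Dn t"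
     "br (q * (U/V)) * Y Dn Up t = br (U/V) * X Up Dn t + br q * X Dn Up t" for t
    using IH[of Up Up t] IH[of Dn Dn t] IH[of Dn Up t] IH[of Up Dn t]
    by (simp_all only: if_True if_False spin_half.distinct refl simp_thms)
  have Y': "transfer_col q s w v k a (transfer_col q s w u k b (\<lambda>\<rho>. f (\<rho> @ [t]))) \<sigma>' = Y a b t" for a b t
    by (simp add: Y_def)
  have X': "transfer_col q s w u k a (transfer_col q s w v k b (\<lambda>\<rho>. f (\<rho> @ [t]))) \<sigma>' = X a b t" for a b t
    by (simp add: X_def)
  note ex = transfer_col_snoc[of q s w _ k, folded U_def V_def] transfer_col_lin2 transfer_col_scale
     X' Y'
  \<comment> \<open>Kept opaque so that \<open>Qc\<close> can move it onto the \<open>Y\<close>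
    terms, where \<open>IHs'\<close> turns them into \<open>X\<close> terms. What remains are
    bracket identities in \<open>U\<close>, \<open>V\<close> and \<open>q\<close>.\<close>
  define Q where "Q = br (q * (U / V))"
  note IHs' = IHs[folded Q_def]
  have Qc: "Q * (x * y) = x * (Q * y)" for x y by simp
  have wU: "inverse q * u / w k = U" "inverse q * v / w k = V" by (simp_all add: U_def V_def)
  have ss: "s * s = br q * br (q^2)" "s * (s * x) = br q * br (q^2) * x" for x
    using s by (simp_all add: power2_eq_square mult.assoc[symmetric])
  show ?case
    by (cases a; cases b; cases \<tau>)
      (simp_all only: r(1) ex UV(3) if_True if_False spin_half.distinct wU simp_thms refl
         distrib_left Q_def[symmetric] Qc IHs' ss,
       simp_all only: Q_def, simp_all add: br_def UV q field_simps power2_eq_square)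
qed


subsection \<open>Bethe vectors\<close>

lemma br_divide: "u \<noteq> 0 \<Longrightarrow> v \<noteq> 0 \<Longrightarrow> br (u / v) = (u^2 - v^2) / (u * v)"
  by (simp add: br_def field_simps power2_eq_square)

lemma br_q_divide: "q \<noteq> 0 \<Longrightarrow> u \<noteq> 0 \<Longrightarrow> v \<noteq> 0 \<Longrightarrow> br (q * u / v) = (q^2 * u^2 - v^2) / (q * u * v)"
  using br_divide[of "q * u" v] by (simp add: power_mult_distrib)

lemma br_swap: "u \<noteq> 0 \<Longrightarrow> v \<noteq> 0 \<Longrightarrow> br (v / u) = - br (u / v)"
  by (simp add: br_def)

lemma exch_f_eq:
  assumes "q \<noteq> 0" "u \<noteq> 0" "v \<noteq> 0"
  shows "exch_f q u v = (q^2 * u^2 - v^2) / (q * (u^2 - v^2))"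
  using assms by (simp add: exch_f_def br_divide br_q_divide power_mult_distrib)

lemma exch_g_eq:
  assumes "q \<noteq> 0" "u \<noteq> 0" "v \<noteq> 0"
  shows "exch_g q u v = - (q^2 - 1) * u * v / (q * (u^2 - v^2))"
proof -
  have "- br q = - (q^2 - 1) / q" using assms by (simp add: br_def field_simps power2_eq_square)
  then show ?thesis unfolding exch_g_def by (simp add: br_divide assms)
qed

text \<open>When \<open>D(u)\<close> meets \<open>B(v)\<close> and then \<open>B(a)\<close>, it can
  trade \<open>u\<close> for \<open>a\<close> directly or by way of \<open>v\<close>; the two
  contributions combine into one product.\<close>

lemma exch_f_exch_g:
  assumes "q \<noteq> 0" "u \<noteq> 0" "v \<noteq> 0" "a \<noteq> 0" "br (u / v) \<noteq> 0" "br (u / a) \<noteq> 0" "br (v / a) \<noteq> 0"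
  shows "exch_f q u v * exch_g q u a + exch_g q u v * exch_g q v a = exch_g q u a * exch_f q a v"
proof -
  have "u^2 - v^2 \<noteq> 0" "u^2 - a^2 \<noteq> 0" "v^2 - a^2 \<noteq> 0" and sw: "a^2 - v^2 = - (v^2 - a^2)"
    using assms by (simp_all add: br_divide)
  then show ?thesis
    using assms(1-4) by (simp add: exch_f_eq exch_g_eq sw divide_simps del: right_minus_eq minus_diff_eq)
      (simp add: algebra_simps power2_eq_square)
qed

text \<open>Two ways to end with \<open>a\<close> on a last site of spin \<open>Zero\<close> and
  \<open>u\<close> further left: \<open>B(u)\<close> passes a site that already holds
  \<open>a\<close>, or \<open>D(u)\<close> trades \<open>u\<close> for \<open>a\<close>, which goes
  to the last site.\<close>

lemma weight_exch_f:
  assumes "q \<noteq> 0" "u \<noteq> 0" "w \<noteq> 0" "a \<noteq> 0" "br (u / a) \<noteq> 0"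
  shows "br (u / w) + br (q * a / w) * exch_g q u a = br (q * u / w) * exch_f q a u"
proof -
  have "u^2 - a^2 \<noteq> 0" and sw: "a^2 - u^2 = - (u^2 - a^2)"
    using assms by (simp_all add: br_divide)
  then show ?thesis
    using assms(1-4) by (simp add: exch_f_eq exch_g_eq br_divide br_q_divide sw divide_simps
        del: right_minus_eq minus_diff_eq) (simp add: algebra_simps power2_eq_square)
qed

text \<open>The counterpart for spin \<open>DDn\<close>: either \<open>a\<close> and
  \<open>b\<close> are both on the last site when \<open>B(u)\<close> passes, or one of them is and
  \<open>D(u)\<close> brings the other.\<close>

lemma weight_exch_f_exch_f:
  assumes "q \<noteq> 0" "u \<noteq> 0" "w \<noteq> 0" "a \<noteq> 0" "b \<noteq> 0"
    "br (u / a) \<noteq> 0" "br (u / b) \<noteq> 0" "br (a / b) \<noteq> 0"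
  shows "br (u / (q * w)) + br (q * b / w) * exch_f q a b * exch_g q u b + br (q * a / w) * exch_f q b a * exch_g q u a
       = br (q * u / w) * exch_f q a u * exch_f q b u"
proof -
  have ne: "u^2 - a^2 \<noteq> 0" "u^2 - b^2 \<noteq> 0" "a^2 - b^2 \<noteq> 0"
    and sw: "a^2 - u^2 = - (u^2 - a^2)" "b^2 - u^2 = - (u^2 - b^2)" "b^2 - a^2 = - (a^2 - b^2)"
    using assms by (simp_all add: br_divide)
  have A: "br (u / (q * w)) = (u^2 - q^2 * w^2) / (q * u * w)"
    using assms by (simp add: br_divide power_mult_distrib mult_ac)
  show ?thesis
    unfolding A using assms(1-5) ne
    by (simp add: exch_f_eq exch_g_eq br_q_divide sw divide_simps del: right_minus_eq minus_diff_eq)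
      (simp add: algebra_simps power2_eq_square)
qed

lemma sum_offdiag_swap:
  assumes "finite J"
  shows "(\<Sum>a\<in>J. \<Sum>b\<in>J - {a}. f a b) = (\<Sum>a\<in>J. \<Sum>b\<in>J - {a}. f b a)"
proof -
  have "(\<Sum>a\<in>J. \<Sum>b\<in>J - {a}. f a b) = (\<Sum>a\<in>J. \<Sum>b\<in>{b \<in> J. b \<noteq> a}. f a b)" for f :: "'a \<Rightarrow> 'a \<Rightarrow> 'b"
    by (intro sum.cong) auto
  then show ?thesis
    using sum.swap_restrict[OF assms assms, of f "\<lambda>a b. b \<noteq> a"] by (simp add: eq_commute)
qed

text \<open>The identities for pairs of rapidities hold only after adding the term with the two
  exchanged, so the summands are replaced by their averages before they are compared.\<close>

lemma sum_offdiag_sym: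
  fixes f :: "'a \<Rightarrow> 'a \<Rightarrow> complex"
  assumes "finite J"
  shows "(\<Sum>a\<in>J. \<Sum>b\<in>J - {a}. f a b) = (\<Sum>a\<in>J. \<Sum>b\<in>J - {a}. (f a b + f b a) / 2)"
  using sum_offdiag_swap[OF assms, of f]
  by (simp add: sum.distrib sum_divide_distrib[symmetric])

text \<open>For non-zero \<open>a\<close> and \<open>b\<close> the last condition says that the
  squares differ, which keeps the denominators of \<open>exch_f\<close> and \<open>exch_g\<close>
  away from zero.\<close>

definition generic_set :: "complex set \<Rightarrow> bool" where
  "generic_set J \<longleftrightarrow> finite J \<and> 0 \<notin> J \<and> (\<forall>a\<in>J. \<forall>b\<in>J. a \<noteq> b \<longrightarrow> br (a / b) \<noteq> 0)"

lemma generic_set_subset: "generic_set J \<Longrightarrow> I \<subseteq> J \<Longrightarrow> generic_set I"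
  unfolding generic_set_def using finite_subset by blast

text \<open>The eigenvalue of \<open>D(z)\<close> on the reference state, see
  \<open>transfer_col_Dn_bethe_empty\<close>.\<close>

definition d_eigen :: "complex \<Rightarrow> (nat \<Rightarrow> complex) \<Rightarrow> nat \<Rightarrow> complex \<Rightarrow> complex" where
  "d_eigen q w k z = (\<Prod>i<k. br (z / (q * w i)))"

text \<open>Components of the product of the \<open>B(z)\<close>, \<open>z \<in> J\<close>, applied to the reference state. Splitting off the
  last site distributes \<open>J\<close> over this site and the rest of the chain. The double sum counts every
  unordered pair twice, whence the factor \<open>1/2\<close>.\<close>

primrec bethe :: "complex \<Rightarrow> complex \<Rightarrow> (nat \<Rightarrow> complex) \<Rightarrow> nat \<Rightarrow> complex set \<Rightarrow> chain_vec" where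
  "bethe q s w 0 = (\<lambda>J \<sigma>. if J = {} then 1 else 0)"
| "bethe q s w (Suc k) = (\<lambda>J \<sigma>. case last \<sigma> of
      UUp \<Rightarrow> (\<Prod>c\<in>J. br (q * c / w k)) * bethe q s w k J (butlast \<sigma>)
    | Zero \<Rightarrow> s * (\<Sum>a\<in>J. d_eigen q w k a * (\<Prod>c\<in>J - {a}. br (q * c / w k) * exch_f q a c) *
                bethe q s w k (J - {a}) (butlast \<sigma>))
    | DDn \<Rightarrow> s^2 / 2 * (\<Sum>a\<in>J. \<Sum>b\<in>J - {a}. d_eigen q w k a * d_eigen q w k b *
                (\<Prod>c\<in>J - {a} - {b}. br (q * c / w k) * exch_f q a c * exch_f q b c) *
                bethe q s w k (J - {a} - {b}) (butlast \<sigma>)))"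

lemma bethe_empty: "length \<sigma> = k \<Longrightarrow> bethe q s w k {} \<sigma> = all_up k \<sigma>"
proof (induction k arbitrary: \<sigma>)
  case (Suc k)
  then obtain \<rho> \<tau> where r: "\<sigma> = \<rho> @ [\<tau>]" "length \<rho> = k"
    by (metis length_Suc_conv_rev)
  show ?case
    using Suc.IH[OF r(2)] by (cases \<tau>) (auto simp: r all_up_def replicate_append_same[symmetric])
qed (simp add: all_up_def)

lemma transfer_col_sum':
  "transfer_col q s w z k a (\<lambda>\<sigma>. \<Sum>i\<in>I. f i \<sigma>) \<sigma> = (\<Sum>i\<in>I. transfer_col q s w z k a (f i) \<sigma>)"
  using transfer_col_sum[of q s w z k a "\<lambda>_. 1" f I \<sigma>] by simp

lemma transfer_col_divide: "transfer_col q s w z k a (\<lambda>\<sigma>. f \<sigma> / x) \<sigma> = transfer_col q s w z k a f \<sigma> / x"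
  using transfer_col_scale[of q s w z k a "1 / x" f \<sigma>] by simp

section \<open>Action of \<open>B\<close> and \<open>D\<close> on Bethe vectors\<close>

definition B_action where
  "B_action q s w k \<longleftrightarrow> (\<forall>u J \<sigma>. u \<notin> J \<longrightarrow> generic_set (insert u J) \<longrightarrow> length \<sigma> = k \<longrightarrow>
     transfer_col q s w u k Up (bethe q s w k J) \<sigma> = bethe q s w k (insert u J) \<sigma>)"

text \<open>The usual form of the algebraic Bethe ansatz: a diagonal term, and for each
  \<open>a\<close> a term in which \<open>u\<close> takes its place. The two predicates are proved
  in alternation: \<open>D_action\<close> at length \<open>k\<close> follows from
  \<open>B_action\<close> at \<open>k\<close>, and both together give \<open>B_action\<close> at
  \<open>Suc k\<close>.\<close>

definition D_action where
  "D_action q s w k \<longleftrightarrow> (\<forall>u J \<sigma>. u \<notin> J \<longrightarrow> generic_set (insert u J) \<longrightarrow> length \<sigma> = k \<longrightarrow>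
     transfer_col q s w u k Dn (bethe q s w k J) \<sigma> =
       d_eigen q w k u * (\<Prod>c\<in>J. exch_f q u c) * bethe q s w k J \<sigma>
       + (\<Sum>a\<in>J. d_eigen q w k a * exch_g q u a * (\<Prod>c\<in>J - {a}. exch_f q a c) * bethe q s w k (insert u (J - {a})) \<sigma>))"

lemma transfer_col_Dn_bethe_empty:
  assumes "q \<noteq> 0" "length \<sigma> = k"
  shows "transfer_col q s w u k Dn (bethe q s w k {}) \<sigma> = d_eigen q w k u * bethe q s w k {} \<sigma>"
  using assms(2)
proof (induction k arbitrary: \<sigma>)
  case (Suc k)
  then obtain \<rho> \<tau> where r: "\<sigma> = \<rho> @ [\<tau>]" "length \<rho> = k"
    by (metis length_Suc_conv_rev)
  show ?case
    unfolding r
    by (cases \<tau>)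
      (simp_all only: transfer_col_snoc, simp_all add: transfer_col_zero Suc.IH[OF r(2)] d_eigen_def field_simps)
qed (simp add: d_eigen_def)

text \<open>Induction on the rapidities: the vector of \<open>insert v J\<close> is
  \<open>B(v)\<close> applied to that of \<open>J\<close>, and \<open>exchange_relation\<close>
  moves \<open>D(u)\<close> past \<open>B(v)\<close>. \<open>B_action\<close> reads the resulting
  \<open>B\<close> operators back as Bethe vectors, and \<open>exch_f_exch_g\<close> merges the two
  coefficients of each \<open>a\<close>.\<close>

lemma D_action_step:
  assumes q: "q \<noteq> 0" and s: "s^2 = br q * br (q^2)" and w: "\<And>i. i < k \<Longrightarrow> w i \<noteq> 0"
    and B: "B_action q s w k"
  shows "D_action q s w k"
proof -
  have B': "transfer_col q s w u k Up (bethe q s w k J) \<sigma> = bethe q s w k (insert u J) \<sigma>"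
    if "u \<notin> J" "generic_set (insert u J)" "length \<sigma> = k" for u J \<sigma>
    using B that unfolding B_action_def by blast
  have "transfer_col q s w u k Dn (bethe q s w k J) \<sigma> =
       d_eigen q w k u * (\<Prod>c\<in>J. exch_f q u c) * bethe q s w k J \<sigma>
       + (\<Sum>a\<in>J. d_eigen q w k a * exch_g q u a * (\<Prod>c\<in>J - {a}. exch_f q a c) * bethe q s w k (insert u (J - {a})) \<sigma>)"
    if "finite J" "u \<notin> J" "generic_set (insert u J)" "length \<sigma> = k" for u J \<sigma>
    using that
  \<comment> \<open>\<open>u\<close> varies because moving \<open>D(u)\<close> past
    \<open>B(v)\<close> also leaves a term in which \<open>D(v)\<close> acts on the vector of
    \<open>J\<close>.\<close>
  proof (induction J arbitrary: u \<sigma> rule: finite_induct)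
    case empty
    then show ?case by (simp add: transfer_col_Dn_bethe_empty q)
  next
    case (insert v J)
    note len = \<open>length \<sigma> = k\<close>
    have g: "generic_set (insert u J)" "generic_set (insert v J)"
      using insert.prems by (auto elim: generic_set_subset)
    have nz: "u \<noteq> 0" "v \<noteq> 0" and uv: "u \<noteq> v" and buv: "br (u / v) \<noteq> 0" "br (v / u) \<noteq> 0"
      using insert.prems by (auto simp: generic_set_def)
    have uJ: "u \<notin> J" and vJ: "v \<notin> J" using insert by auto
    have nzJ: "a \<noteq> 0" "br (u / a) \<noteq> 0" "br (v / a) \<noteq> 0" if "a \<in> J" for a
      using insert.prems that uJ vJ by (auto simp: generic_set_def)
    let ?t = "transfer_col q s w"
    have IH: "?t u' k Dn (bethe q s w k J) \<rho> =
       d_eigen q w k u' * (\<Prod>c\<in>J. exch_f q u' c) * bethe q s w k J \<rho>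
       + (\<Sum>a\<in>J. d_eigen q w k a * exch_g q u' a * (\<Prod>c\<in>J - {a}. exch_f q a c) * bethe q s w k (insert u' (J - {a})) \<rho>)"
      if "u' = u \<or> u' = v" "length \<rho> = k" for u' \<rho>
      using insert.IH[of u' \<rho>] that g uJ vJ by auto
    have act: "?t v' k Up (?t u' k Dn (bethe q s w k J)) \<sigma> =
       d_eigen q w k u' * (\<Prod>c\<in>J. exch_f q u' c) * bethe q s w k (insert v' J) \<sigma>
       + (\<Sum>a\<in>J. d_eigen q w k a * exch_g q u' a * (\<Prod>c\<in>J - {a}. exch_f q a c) * bethe q s w k (insert v' (insert u' (J - {a}))) \<sigma>)"
      if uv': "u' = u \<and> v' = v \<or> u' = v \<and> v' = u" for u' v'
    proof -
      have "?t v' k Up (?t u' k Dn (bethe q s w k J)) \<sigma> = ?t v' k Up (\<lambda>\<rho>. d_eigen q w k u' * (\<Prod>c\<in>J. exch_f q u' c) * bethe q s w k J \<rho>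
       + (\<Sum>a\<in>J. d_eigen q w k a * exch_g q u' a * (\<Prod>c\<in>J - {a}. exch_f q a c) * bethe q s w k (insert u' (J - {a})) \<rho>)) \<sigma>"
        by (rule transfer_col_cong) (use IH uv' len in auto)
      also have "\<dots> = d_eigen q w k u' * (\<Prod>c\<in>J. exch_f q u' c) * ?t v' k Up (bethe q s w k J) \<sigma>
       + (\<Sum>a\<in>J. d_eigen q w k a * exch_g q u' a * (\<Prod>c\<in>J - {a}. exch_f q a c) * ?t v' k Up (bethe q s w k (insert u' (J - {a}))) \<sigma>)"
        by (simp only: transfer_col_add transfer_col_scale transfer_col_sum)
      also have "?t v' k Up (bethe q s w k J) \<sigma> = bethe q s w k (insert v' J) \<sigma>"
        using uv' g uJ vJ len by (intro B') auto
      also have "(\<Sum>a\<in>J. d_eigen q w k a * exch_g q u' a * (\<Prod>c\<in>J - {a}. exch_f q a c) * ?t v' k Up (bethe q s w k (insert u' (J - {a}))) \<sigma>)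
        = (\<Sum>a\<in>J. d_eigen q w k a * exch_g q u' a * (\<Prod>c\<in>J - {a}. exch_f q a c) * bethe q s w k (insert v' (insert u' (J - {a}))) \<sigma>)"
      proof (intro sum.cong arg_cong2[where f = times] refl B' len)
        fix a assume "a \<in> J"
        show "v' \<notin> insert u' (J - {a})" using uv' uJ vJ uv by auto
        show "generic_set (insert v' (insert u' (J - {a})))"
          by (rule generic_set_subset[OF insert.prems(2)]) (use uv' in auto)
      qed
      finally show ?thesis .
    qed
    have "?t u k Dn (bethe q s w k (insert v J)) \<sigma> = ?t u k Dn (?t v k Up (bethe q s w k J)) \<sigma>"
      by (rule transfer_col_cong) (use B' g vJ len in auto)
    also have "\<dots> = exch_f q u v * ?t v k Up (?t u k Dn (bethe q s w k J)) \<sigma> + exch_g q u v * ?t u k Up (?t v k Dn (bethe q s w k J)) \<sigma>"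
      using exchange_relation[OF q s w nz len, where a = Dn and b = Up and f = "bethe q s w k J"] buv
      unfolding exch_f_def exch_g_def by (simp add: field_simps)
    also have "?t v k Up (?t u k Dn (bethe q s w k J)) \<sigma> = d_eigen q w k u * (\<Prod>c\<in>J. exch_f q u c) * bethe q s w k (insert v J) \<sigma>
       + (\<Sum>a\<in>J. d_eigen q w k a * exch_g q u a * (\<Prod>c\<in>J - {a}. exch_f q a c) * bethe q s w k (insert v (insert u (J - {a}))) \<sigma>)"
      by (rule act) simp
    also have "?t u k Up (?t v k Dn (bethe q s w k J)) \<sigma> = d_eigen q w k v * (\<Prod>c\<in>J. exch_f q v c) * bethe q s w k (insert u J) \<sigma>
       + (\<Sum>a\<in>J. d_eigen q w k a * exch_g q v a * (\<Prod>c\<in>J - {a}. exch_f q a c) * bethe q s w k (insert u (insert v (J - {a}))) \<sigma>)"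
      by (rule act) simp
    finally have 1: "?t u k Dn (bethe q s w k (insert v J)) \<sigma> =
       d_eigen q w k u * (exch_f q u v * (\<Prod>c\<in>J. exch_f q u c)) * bethe q s w k (insert v J) \<sigma>
       + d_eigen q w k v * exch_g q u v * (\<Prod>c\<in>J. exch_f q v c) * bethe q s w k (insert u J) \<sigma>
       + (\<Sum>a\<in>J. d_eigen q w k a * (exch_f q u v * exch_g q u a + exch_g q u v * exch_g q v a) * (\<Prod>c\<in>J - {a}. exch_f q a c) * bethe q s w k (insert u (insert v (J - {a}))) \<sigma>)"
      by (simp add: algebra_simps sum_distrib_left sum.distrib insert_commute)
    have 2: "(\<Sum>a\<in>J. d_eigen q w k a * (exch_f q u v * exch_g q u a + exch_g q u v * exch_g q v a) * (\<Prod>c\<in>J - {a}. exch_f q a c) * bethe q s w k (insert u (insert v (J - {a}))) \<sigma>)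
      = (\<Sum>a\<in>J. d_eigen q w k a * exch_g q u a * (\<Prod>c\<in>insert v J - {a}. exch_f q a c) * bethe q s w k (insert u (insert v J - {a})) \<sigma>)"
    proof (intro sum.cong refl)
      fix a assume a: "a \<in> J"
      have "insert v J - {a} = insert v (J - {a})" using a vJ by auto
      then show "d_eigen q w k a * (exch_f q u v * exch_g q u a + exch_g q u v * exch_g q v a) * (\<Prod>c\<in>J - {a}. exch_f q a c) * bethe q s w k (insert u (insert v (J - {a}))) \<sigma>
        = d_eigen q w k a * exch_g q u a * (\<Prod>c\<in>insert v J - {a}. exch_f q a c) * bethe q s w k (insert u (insert v J - {a})) \<sigma>"
        using vJ insert.hyps(1) exch_f_exch_g[OF q nz(1,2) nzJ(1)[OF a] buv(1) nzJ(2-3)[OF a]] by simp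
    qed
    show ?case
      unfolding 1 2 using vJ insert.hyps(1) by (simp add: algebra_simps)
  qed
  then show ?thesis
    unfolding D_action_def by (auto simp: generic_set_def)
qed

text \<open>Coefficients of the Bethe vectors on the first \<open>k\<close> sites are compared for
  each last spin. Configurations with \<open>u\<close> on the last site come from the diagonal term
  of \<open>D\<close>. Those with \<open>u\<close> further left arise in several ways, whose sum is
  given by \<open>weight_exch_f\<close> and \<open>weight_exch_f_exch_f\<close>.\<close>

lemma B_action_step:
  assumes q: "q \<noteq> 0" and s: "s^2 = br q * br (q^2)" and w: "w k \<noteq> 0"
    and B: "B_action q s w k" and D: "D_action q s w k"
  shows "B_action q s w (Suc k)"
  unfolding B_action_def
proof (intro allI impI)
  fix u J and \<sigma> :: "spin_one list"
  assume u: "u \<notin> J" and g: "generic_set (insert u J)" and len: "length \<sigma> = Suc k"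
  have fin: "finite J" using g by (auto simp: generic_set_def)
  have g': "generic_set (insert u I)" if "I \<subseteq> J" for I
    by (rule generic_set_subset[OF g]) (use that in auto)
  have B': "transfer_col q s w u k Up (bethe q s w k I) \<rho> = bethe q s w k (insert u I) \<rho>"
    if "I \<subseteq> J" "length \<rho> = k" for I \<rho>
    using B u g'[OF that(1)] that unfolding B_action_def by blast
  have D': "transfer_col q s w u k Dn (bethe q s w k I) \<rho> =
       d_eigen q w k u * (\<Prod>c\<in>I. exch_f q u c) * bethe q s w k I \<rho>
       + (\<Sum>a\<in>I. d_eigen q w k a * exch_g q u a * (\<Prod>c\<in>I - {a}. exch_f q a c) * bethe q s w k (insert u (I - {a})) \<rho>)"
    if "I \<subseteq> J" "length \<rho> = k" for I \<rho>
    using D u g'[OF that(1)] that unfolding D_action_def by blast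
  from len obtain \<rho> \<tau> where r: "\<sigma> = \<rho> @ [\<tau>]" "length \<rho> = k"
    by (metis length_Suc_conv_rev)
  have nz: "u \<noteq> 0" and nzJ: "a \<noteq> 0" "br (u / a) \<noteq> 0" if "a \<in> J" for a
    using g that u by (auto simp: generic_set_def)
  have nzJ2: "br (a / b) \<noteq> 0" if "a \<in> J" "b \<in> J" "a \<noteq> b" for a b
    using g that by (auto simp: generic_set_def)
  have args: "q\<^sup>2 * (inverse q * u / w k) = q * u / w k" "q * (inverse q * u / w k) = u / w k"
    "inverse q * u / w k = u / (q * w k)"
    using q by (simp_all add: power2_eq_square field_simps)
  let ?b = "bethe q s w k" and ?d = "d_eigen q w k"
  define \<alpha> where "\<alpha> = (\<lambda>z. br (q * z / w k))"
  show "transfer_col q s w u (Suc k) Up (bethe q s w (Suc k) J) \<sigma> = bethe q s w (Suc k) (insert u J) \<sigma>"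
  proof (cases \<tau>)
    case UUp
    show ?thesis
      unfolding r UUp transfer_col_snoc args(1)
      using B'[of J \<rho>] r u fin by (simp add: transfer_col_scale)
  next
    case Zero
    have "transfer_col q s w u (Suc k) Up (bethe q s w (Suc k) J) \<sigma> =
        br (u / w k) * (s * (\<Sum>a\<in>J. ?d a * (\<Prod>c\<in>J - {a}. \<alpha> c * exch_f q a c) * ?b (insert u (J - {a})) \<rho>))
        + s * ((\<Prod>c\<in>J. \<alpha> c) * (?d u * (\<Prod>c\<in>J. exch_f q u c) * ?b J \<rho>
         + (\<Sum>a\<in>J. ?d a * exch_g q u a * (\<Prod>c\<in>J - {a}. exch_f q a c) * ?b (insert u (J - {a})) \<rho>)))"
      unfolding r Zero transfer_col_snoc args(2)
      using D'[of J \<rho>] r by (simp add: transfer_col_scale transfer_col_sum B' \<alpha>_def)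
    also have "\<dots> = s * (?d u * (\<Prod>c\<in>J. \<alpha> c * exch_f q u c) * ?b J \<rho>)
        + s * (\<Sum>a\<in>J. br (u / w k) * (?d a * (\<Prod>c\<in>J - {a}. \<alpha> c * exch_f q a c) * ?b (insert u (J - {a})) \<rho>)
             + (\<Prod>c\<in>J. \<alpha> c) * (?d a * exch_g q u a * (\<Prod>c\<in>J - {a}. exch_f q a c) * ?b (insert u (J - {a})) \<rho>))"
      by (simp add: prod.distrib sum.distrib sum_distrib_left algebra_simps)
    also have "(\<Sum>a\<in>J. br (u / w k) * (?d a * (\<Prod>c\<in>J - {a}. \<alpha> c * exch_f q a c) * ?b (insert u (J - {a})) \<rho>)
             + (\<Prod>c\<in>J. \<alpha> c) * (?d a * exch_g q u a * (\<Prod>c\<in>J - {a}. exch_f q a c) * ?b (insert u (J - {a})) \<rho>))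
        = (\<Sum>a\<in>J. ?d a * (\<Prod>c\<in>insert u J - {a}. \<alpha> c * exch_f q a c) * ?b (insert u J - {a}) \<rho>)"
    proof (intro sum.cong refl)
      fix a assume a: "a \<in> J"
      have i: "insert u J - {a} = insert u (J - {a})" using a u by auto
      have "br (u / w k) * (?d a * (\<Prod>c\<in>J - {a}. \<alpha> c * exch_f q a c) * ?b (insert u (J - {a})) \<rho>)
             + (\<Prod>c\<in>J. \<alpha> c) * (?d a * exch_g q u a * (\<Prod>c\<in>J - {a}. exch_f q a c) * ?b (insert u (J - {a})) \<rho>)
          = (br (u / w k) + \<alpha> a * exch_g q u a) * (?d a * (\<Prod>c\<in>J - {a}. \<alpha> c * exch_f q a c) * ?b (insert u (J - {a})) \<rho>)"
        using fin a by (simp add: prod.remove[of J a] prod.distrib algebra_simps)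
      also have "br (u / w k) + \<alpha> a * exch_g q u a = \<alpha> u * exch_f q a u"
        unfolding \<alpha>_def by (rule weight_exch_f) (use q nz nzJ a w in auto)
      finally show "br (u / w k) * (?d a * (\<Prod>c\<in>J - {a}. \<alpha> c * exch_f q a c) * ?b (insert u (J - {a})) \<rho>)
             + (\<Prod>c\<in>J. \<alpha> c) * (?d a * exch_g q u a * (\<Prod>c\<in>J - {a}. exch_f q a c) * ?b (insert u (J - {a})) \<rho>)
          = ?d a * (\<Prod>c\<in>insert u J - {a}. \<alpha> c * exch_f q a c) * ?b (insert u J - {a}) \<rho>"
        unfolding i using u fin by (simp add: mult_ac)
    qed
    also have "s * (?d u * (\<Prod>c\<in>J. \<alpha> c * exch_f q u c) * ?b J \<rho>)
        + s * (\<Sum>a\<in>J. ?d a * (\<Prod>c\<in>insert u J - {a}. \<alpha> c * exch_f q a c) * ?b (insert u J - {a}) \<rho>)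
        = bethe q s w (Suc k) (insert u J) \<sigma>"
      using u fin by (simp add: r Zero \<alpha>_def algebra_simps)
    finally show ?thesis .
  next
    case DDn
    \<comment> \<open>The part common to all terms with \<open>a\<close> and \<open>b\<close> on the
      last site and \<open>u\<close> in the rest of the chain; it is symmetric in \<open>a\<close>
      and \<open>b\<close>.\<close>
    define E where "E = (\<lambda>a b. ?d a * ?d b * (\<Prod>c\<in>J - {a} - {b}. \<alpha> c * exch_f q a c * exch_f q b c) * ?b (insert u (J - {a} - {b})) \<rho>)"
    have "transfer_col q s w u (Suc k) Up (bethe q s w (Suc k) J) \<sigma> =
        br (u / (q * w k)) * (s\<^sup>2 / 2 * (\<Sum>a\<in>J. \<Sum>b\<in>J - {a}. E a b))
        + s * (s * (\<Sum>a\<in>J. ?d a * (\<Prod>c\<in>J - {a}. \<alpha> c * exch_f q a c) *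
           (?d u * (\<Prod>c\<in>J - {a}. exch_f q u c) * ?b (J - {a}) \<rho>
         + (\<Sum>b\<in>J - {a}. ?d b * exch_g q u b * (\<Prod>c\<in>J - {a} - {b}. exch_f q b c) * ?b (insert u (J - {a} - {b})) \<rho>))))"
    proof -
      have B1: "transfer_col q s w u k Up (bethe q s w k (J - {a} - {b})) \<rho> = bethe q s w k (insert u (J - {a} - {b})) \<rho>" for a b
        using r by (intro B') auto
      have D1: "transfer_col q s w u k Dn (bethe q s w k (J - {a})) \<rho> =
         ?d u * (\<Prod>c\<in>J - {a}. exch_f q u c) * ?b (J - {a}) \<rho>
         + (\<Sum>b\<in>J - {a}. ?d b * exch_g q u b * (\<Prod>c\<in>J - {a} - {b}. exch_f q b c) * ?b (insert u (J - {a} - {b})) \<rho>)" for a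
        using r by (intro D') auto
      show ?thesis
        unfolding r DDn transfer_col_snoc args(3) E_def
        by (simp add: transfer_col_scale transfer_col_sum transfer_col_sum' transfer_col_divide B1 D1 \<alpha>_def)
    qed
    also have "\<dots> = s\<^sup>2 * (\<Sum>a\<in>J. ?d u * ?d a * (\<Prod>c\<in>J - {a}. \<alpha> c * exch_f q u c * exch_f q a c) * ?b (J - {a}) \<rho>)
        + s\<^sup>2 * (\<Sum>a\<in>J. \<Sum>b\<in>J - {a}. (br (u / (q * w k)) / 2 + \<alpha> b * exch_f q a b * exch_g q u b) * E a b)"
    proof -
      have "?d a * (\<Prod>c\<in>J - {a}. \<alpha> c * exch_f q a c) *
           (?d u * (\<Prod>c\<in>J - {a}. exch_f q u c) * ?b (J - {a}) \<rho>
         + (\<Sum>b\<in>J - {a}. ?d b * exch_g q u b * (\<Prod>c\<in>J - {a} - {b}. exch_f q b c) * ?b (insert u (J - {a} - {b})) \<rho>))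
         = ?d u * ?d a * (\<Prod>c\<in>J - {a}. \<alpha> c * exch_f q u c * exch_f q a c) * ?b (J - {a}) \<rho>
         + (\<Sum>b\<in>J - {a}. \<alpha> b * exch_f q a b * exch_g q u b * E a b)" if a: "a \<in> J" for a
      proof -
        have e: "?d a * (\<Prod>c\<in>J - {a}. \<alpha> c * exch_f q a c) * (?d b * exch_g q u b * (\<Prod>c\<in>J - {a} - {b}. exch_f q b c) * ?b (insert u (J - {a} - {b})) \<rho>)
          = \<alpha> b * exch_f q a b * exch_g q u b * E a b" if "b \<in> J - {a}" for b
          using fin that by (simp add: E_def prod.remove[of "J - {a}" b] prod.distrib mult_ac)
        have "?d a * (\<Prod>c\<in>J - {a}. \<alpha> c * exch_f q a c) * (\<Sum>b\<in>J - {a}. ?d b * exch_g q u b * (\<Prod>c\<in>J - {a} - {b}. exch_f q b c) * ?b (insert u (J - {a} - {b})) \<rho>)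
          = (\<Sum>b\<in>J - {a}. \<alpha> b * exch_f q a b * exch_g q u b * E a b)"
          unfolding sum_distrib_left by (rule sum.cong[OF refl e])
        then show ?thesis
          unfolding distrib_left by (simp only: prod.distrib mult_ac)
      qed
      then show ?thesis
        by (simp add: sum.distrib sum_distrib_left distrib_right distrib_left power2_eq_square mult_ac)
    qed
    also have "(\<Sum>a\<in>J. \<Sum>b\<in>J - {a}. (br (u / (q * w k)) / 2 + \<alpha> b * exch_f q a b * exch_g q u b) * E a b)
        = (\<Sum>a\<in>J. \<Sum>b\<in>J - {a}. (\<alpha> u * exch_f q a u * exch_f q b u) * E a b / 2)"
    proof (subst sum_offdiag_sym[OF fin], intro sum.cong refl)
      fix a b assume a: "a \<in> J" and b: "b \<in> J - {a}"
      have sy: "E b a = E a b"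
        unfolding E_def by (simp add: Diff_insert[symmetric] insert_commute mult_ac)
      have *: "br (u / (q * w k)) + \<alpha> b * exch_f q a b * exch_g q u b + \<alpha> a * exch_f q b a * exch_g q u a = \<alpha> u * exch_f q a u * exch_f q b u"
        unfolding \<alpha>_def by (rule weight_exch_f_exch_f) (use q nz nzJ nzJ2 a b w in auto)
      show "((br (u / (q * w k)) / 2 + \<alpha> b * exch_f q a b * exch_g q u b) * E a b
         + (br (u / (q * w k)) / 2 + \<alpha> a * exch_f q b a * exch_g q u a) * E b a) / 2
         = (\<alpha> u * exch_f q a u * exch_f q b u) * E a b / 2"
        unfolding sy *[symmetric] by (simp add: algebra_simps)
    qed
    also have "s\<^sup>2 * (\<Sum>a\<in>J. ?d u * ?d a * (\<Prod>c\<in>J - {a}. \<alpha> c * exch_f q u c * exch_f q a c) * ?b (J - {a}) \<rho>)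
        + s\<^sup>2 * (\<Sum>a\<in>J. \<Sum>b\<in>J - {a}. (\<alpha> u * exch_f q a u * exch_f q b u) * E a b / 2)
        = bethe q s w (Suc k) (insert u J) \<sigma>"
    proof -
      have i: "insert u J - {u} = J" using u by auto
      have ia: "insert u J - {a} = insert u (J - {a})" if "a \<in> J" for a using that u by auto
      have ib: "insert u (J - {a}) - {b} = insert u (J - {a} - {b})" if "b \<in> J - {a}" for a b using that u by auto
      have iu: "insert u (J - {a}) - {u} = J - {a}" for a using u by auto
      define Z where "Z = (\<lambda>a. ?d u * ?d a * (\<Prod>c\<in>J - {a}. \<alpha> c * exch_f q u c * exch_f q a c) * ?b (J - {a}) \<rho>)"
      define T where "T = (\<lambda>I a b. ?d a * ?d b * (\<Prod>c\<in>I - {a} - {b}. \<alpha> c * exch_f q a c * exch_f q b c) * ?b (I - {a} - {b}) \<rho>)"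
      have T1: "T (insert u J) a b = (\<alpha> u * exch_f q a u * exch_f q b u) * E a b" if "a \<in> J" "b \<in> J - {a}" for a b
        unfolding T_def ia[OF that(1)] ib[OF that(2)] E_def using u fin by (simp add: mult_ac)
      have T1': "sum (T (insert u J) a) (J - {a}) = (\<Sum>b\<in>J - {a}. (\<alpha> u * exch_f q a u * exch_f q b u) * E a b)" if "a \<in> J" for a
        by (rule sum.cong[OF refl T1[OF that]])
      \<comment> \<open>A pair containing \<open>u\<close> occurs twice in the double sum, once in
        each order, which compensates the factor \<open>1 / 2\<close>.\<close>
      have T2: "T (insert u J) u b = Z b" for b
        unfolding T_def Z_def i by simp
      have T3: "T (insert u J) a u = Z a" if "a \<in> J" for a
        unfolding T_def Z_def ia[OF that] iu by (simp add: mult_ac)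
      have "bethe q s w (Suc k) (insert u J) \<sigma> = s\<^sup>2 / 2 * (\<Sum>a\<in>insert u J. \<Sum>b\<in>insert u J - {a}. T (insert u J) a b)"
        by (simp add: r DDn T_def \<alpha>_def)
      also have "(\<Sum>a\<in>insert u J. \<Sum>b\<in>insert u J - {a}. T (insert u J) a b)
         = (\<Sum>b\<in>J. Z b) + (\<Sum>a\<in>J. Z a + (\<Sum>b\<in>J - {a}. (\<alpha> u * exch_f q a u * exch_f q b u) * E a b))"
        using fin u by (simp add: i T2 ia T3 T1' cong: sum.cong)
      finally have f: "bethe q s w (Suc k) (insert u J) \<sigma> = s\<^sup>2 / 2 *
        ((\<Sum>b\<in>J. Z b) + (\<Sum>a\<in>J. Z a + (\<Sum>b\<in>J - {a}. (\<alpha> u * exch_f q a u * exch_f q b u) * E a b)))" .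
      have z: "(\<Sum>a\<in>J. ?d u * ?d a * (\<Prod>c\<in>J - {a}. \<alpha> c * exch_f q u c * exch_f q a c) * ?b (J - {a}) \<rho>) = (\<Sum>b\<in>J. Z b)"
        by (simp add: Z_def)
      show ?thesis
        unfolding z f by (simp add: sum.distrib algebra_simps sum_divide_distrib[symmetric] del: bethe.simps)
    qed
    finally show ?thesis .
  qed
qed

lemma B_action:
  assumes q: "q \<noteq> 0" and s: "s^2 = br q * br (q^2)" and w: "\<And>i. i < k \<Longrightarrow> w i \<noteq> 0"
  shows "B_action q s w k"
  using w
proof (induction k)
  case 0
  show ?case by (simp add: B_action_def)
next
  case (Suc k)
  then have B: "B_action q s w k" by simp
  show ?case
    by (rule B_action_step[OF q s _ B D_action_step[OF q s _ B]]) (use Suc.prems in auto)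
qed

text \<open>Here the rapidities are independent of \<open>w\<close>, so they can be varied although
  \<open>psi_D\<close> ties them to the inhomogeneities. Unlike \<open>bethe\<close>, this form has
  no denominators in differences of rapidities.\<close>

definition B_product :: "complex \<Rightarrow> complex \<Rightarrow> (nat \<Rightarrow> complex) \<Rightarrow> nat \<Rightarrow> complex list \<Rightarrow> chain_vec" where
  "B_product q s w N zs = foldr (\<lambda>z v. transfer_col q s w z N Up v) zs (all_up N)"

lemma B_product_eq_bethe:
  assumes q: "q \<noteq> 0" and s: "s^2 = br q * br (q^2)" and w: "\<And>i. i < N \<Longrightarrow> w i \<noteq> 0"
    and len: "length \<sigma> = N" and "distinct zs" "generic_set (set zs)"
  shows "B_product q s w N zs \<sigma> = bethe q s w N (set zs) \<sigma>"
  using assms(4-6)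
proof (induction zs arbitrary: \<sigma>)
  case Nil
  then show ?case by (simp add: B_product_def bethe_empty)
next
  case (Cons z zs)
  have "B_product q s w N (z # zs) \<sigma> = transfer_col q s w z N Up (B_product q s w N zs) \<sigma>"
    by (simp add: B_product_def)
  also have "\<dots> = transfer_col q s w z N Up (bethe q s w N (set zs)) \<sigma>"
    using Cons by (intro transfer_col_cong Cons.IH) (auto elim: generic_set_subset)
  also have "\<dots> = bethe q s w N (set (z # zs)) \<sigma>"
    using B_action[of q s N w] q s w Cons.prems unfolding B_action_def by auto
  finally show ?case .
qed

lemma psi_D_eq_B_product: "length \<sigma> = N \<Longrightarrow> psi_D q s N w \<sigma> = B_product q s w N (map w [0..<N]) \<sigma>"
proof -
  have "length \<sigma> = N \<Longrightarrow> foldr (\<lambda>j v. B_op q s N w (w j) v) js (all_up N) \<sigma> = B_product q s w N (map w js) \<sigma>" for js \<sigma>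
  proof (induction js arbitrary: \<sigma>)
    case (Cons j js)
    have "foldr (\<lambda>j v. B_op q s N w (w j) v) (j # js) (all_up N) \<sigma>
       = transfer_col q s w (w j) N Up (foldr (\<lambda>j v. B_op q s N w (w j) v) js (all_up N)) \<sigma>"
      using monodromy_eq_transfer_col[of \<sigma> N q s w "w j" _ Up "[]"] Cons.prems by (simp add: B_op_def)
    also have "\<dots> = transfer_col q s w (w j) N Up (B_product q s w N (map w js)) \<sigma>"
      by (rule transfer_col_cong) (use Cons in auto)
    finally show ?case by (simp add: B_product_def)
  qed (simp add: B_product_def)
  then show "length \<sigma> = N \<Longrightarrow> psi_D q s N w \<sigma> = B_product q s w N (map w [0..<N]) \<sigma>"
    unfolding psi_D_def .
qed


subsection \<open>Overlap with the boundary state\<close>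

text \<open>In terms of \<open>x^2 + x^(-2)\<close> for a spin one half boundary column \<open>x\<close>, the weights of a rapidity \<open>z\<close>
  on this column vanish at \<open>node_a q z\<close> and \<open>node_d q z\<close>. The columns \<open>q^(\<plusminus>1/2) x\<close> have these values at
  \<open>z = x\<close>.\<close>

definition node_a :: "complex \<Rightarrow> complex \<Rightarrow> complex" where "node_a q z = q * z^2 + 1 / (q * z^2)"
definition node_d :: "complex \<Rightarrow> complex \<Rightarrow> complex" where "node_d q z = z^2 / q + q / z^2"
definition eta_bracket :: "complex \<Rightarrow> complex \<Rightarrow> complex" where "eta_bracket z x = br (z / x) * br (z * x)"

lemma node_a_minus_node_a: "q \<noteq> 0 \<Longrightarrow> z \<noteq> 0 \<Longrightarrow> x \<noteq> 0 \<Longrightarrow> node_a q z - node_a q x = br (q * z * x) * br (z / x)"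
  by (simp add: node_a_def br_def field_simps power2_eq_square)

lemma node_d_minus_node_d: "q \<noteq> 0 \<Longrightarrow> z \<noteq> 0 \<Longrightarrow> x \<noteq> 0 \<Longrightarrow> node_d q z - node_d q x = br (z * x / q) * br (z / x)"
  by (simp add: node_d_def br_def field_simps power2_eq_square)

lemma node_d_minus_node_a: "q \<noteq> 0 \<Longrightarrow> z \<noteq> 0 \<Longrightarrow> x \<noteq> 0 \<Longrightarrow> node_d q z - node_a q x = br (z * x) * br (z / (q * x))"
  by (simp add: node_d_def node_a_def br_def field_simps power2_eq_square)

lemma node_a_minus_node_d: "q \<noteq> 0 \<Longrightarrow> z \<noteq> 0 \<Longrightarrow> x \<noteq> 0 \<Longrightarrow> node_a q z - node_d q x = br (z * x) * br (q * z / x)"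
  by (simp add: node_d_def node_a_def br_def field_simps power2_eq_square)

text \<open>The fusion identity: \<open>u\<close> and \<open>v\<close> are placed on the two spin
  one half columns of a pair in both orders. The factor \<open>q + 1 / q = [q^2]/[q]\<close> matches
  the one contained in \<open>s^2\<close>.\<close>

lemma bracket_symmetrised:
  assumes "q \<noteq> 0" "u \<noteq> 0" "v \<noteq> 0" "x \<noteq> 0" "br (u / v) \<noteq> 0"
  shows "(node_d q u - node_a q x) * (node_a q v - node_d q x) * exch_f q u v + (node_d q v - node_a q x) * (node_a q u - node_d q x) * exch_f q v u
    = (q + 1 / q) * eta_bracket u x * eta_bracket v x"
proof -
  have "u^2 - v^2 \<noteq> 0" and sw: "v^2 - u^2 = - (u^2 - v^2)"
    using assms by (simp_all add: br_divide)
  note ne = this(1)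
  have e: "node_d q z - node_a q x = (z^2 * x^2 - 1) * (z^2 - q^2 * x^2) / (q * z^2 * x^2)"
    "node_a q z - node_d q x = (z^2 * x^2 - 1) * (q^2 * z^2 - x^2) / (q * z^2 * x^2)"
    "eta_bracket z x = (z^2 * x^2 - 1) * (z^2 - x^2) / (z^2 * x^2)" if "z \<noteq> 0" for z
    using assms that by (simp_all add: node_d_def node_a_def eta_bracket_def br_def field_simps power2_eq_square)
  show ?thesis
    unfolding e[OF assms(2)] e[OF assms(3)]
    using assms(1-4) ne by (simp add: exch_f_eq sw divide_simps del: right_minus_eq minus_diff_eq)
      (simp add: algebra_simps power2_eq_square)
qed

text \<open>The three lines on the left belong to the three components of the boundary state on one
  pair of sites. Its coefficients are such that \<open>b\<close> separates into one factor for each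
  rapidity.\<close>

lemma chi_weights_symmetrised:
  assumes "q \<noteq> 0" "u \<noteq> 0" "v \<noteq> 0" "x \<noteq> 0" "b \<noteq> 0" "br (u / v) \<noteq> 0"
  shows "br (b * x) * br (b * q * x) * (br (u / (q * x)) * br (v / (q * x)))
    + br (inverse b * q * x) * br (b * q * x) * (br (u / (q * x)) * br (q * v * x) * exch_f q u v + br (v / (q * x)) * br (q * u * x) * exch_f q v u)
    + br (inverse b * x) * br (inverse b * q * x) * (br (q * u * x) * br (q * v * x))
    = br (q * x^2) * br (q^2 * x^2) * br (b / u) * br (b / v)"
proof -
  have "u^2 - v^2 \<noteq> 0" and sw: "v^2 - u^2 = - (u^2 - v^2)"
    using assms by (simp_all add: br_divide)
  note ne = this(1)
  have e: "br (z / (q * x)) = (z^2 - q^2 * x^2) / (q * z * x)"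
    "br (q * z * x) = (q^2 * z^2 * x^2 - 1) / (q * z * x)" "br (b / z) = (b^2 - z^2) / (b * z)" if "z \<noteq> 0" for z
    using assms that by (simp_all add: br_def field_simps power2_eq_square)
  have e': "br (b * x) = (b^2 * x^2 - 1) / (b * x)" "br (b * q * x) = (b^2 * q^2 * x^2 - 1) / (b * q * x)"
    "br (inverse b * q * x) = (q^2 * x^2 - b^2) / (b * q * x)" "br (inverse b * x) = (x^2 - b^2) / (b * x)"
    "br (q * x^2) = (q^2 * x^4 - 1) / (q * x^2)" "br (q^2 * x^2) = (q^4 * x^4 - 1) / (q^2 * x^2)"
    using assms by (simp_all add: br_def field_simps power2_eq_square power4_eq_xxxx)
  show ?thesis
    unfolding e[OF assms(2)] e[OF assms(3)] e'
    using assms(1-5) ne by (simp add: exch_f_eq sw divide_simps del: right_minus_eq minus_diff_eq)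
      (simp add: algebra_simps power2_eq_square power4_eq_xxxx)
qed

text \<open>The inhomogeneities are tied to \<open>x\<close> as in \<open>Xi_D\<close>, while the
  rapidities \<open>J\<close> are free.\<close>

definition overlap :: "complex \<Rightarrow> complex \<Rightarrow> complex \<Rightarrow> (nat \<Rightarrow> complex) \<Rightarrow> nat \<Rightarrow> complex set \<Rightarrow> complex" where
  "overlap q s b x n J = pairing (2 * n) (chi q b n x) (bethe q s (inhom x) (2 * n) J)"

lemma sum_lists_snoc:
  fixes f :: "spin_one list \<Rightarrow> complex"
  shows "(\<Sum>\<sigma> | length \<sigma> = Suc m. f \<sigma>) = (\<Sum>\<rho> | length \<rho> = m. f (\<rho> @ [UUp]) + f (\<rho> @ [Zero]) + f (\<rho> @ [DDn]))"
proof -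
  have fin: "finite {\<rho> :: spin_one list. length \<rho> = m}"
    using finite_lists_length_eq[of "UNIV :: spin_one set" m] by simp
  have "{\<sigma> :: spin_one list. length \<sigma> = Suc m} = (\<lambda>(\<rho>, \<tau>). \<rho> @ [\<tau>]) ` ({\<rho>. length \<rho> = m} \<times> UNIV)"
    by (auto simp: length_Suc_conv_rev)
  moreover have "inj_on (\<lambda>(\<rho> :: spin_one list, \<tau>). \<rho> @ [\<tau>]) ({\<rho>. length \<rho> = m} \<times> UNIV)"
    by (auto simp: inj_on_def)
  ultimately have "(\<Sum>\<sigma> | length \<sigma> = Suc m. f \<sigma>) = (\<Sum>(\<rho>, \<tau>)\<in>{\<rho>. length \<rho> = m} \<times> UNIV. f (\<rho> @ [\<tau>]))"
    by (simp add: sum.reindex case_prod_unfold)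
  also have "\<dots> = (\<Sum>\<rho> | length \<rho> = m. \<Sum>\<tau>\<in>UNIV. f (\<rho> @ [\<tau>]))"
    by (simp add: sum.cartesian_product)
  finally show ?thesis by (simp add: UNIV_spin_one add.assoc)
qed

lemma overlap_0: "overlap q s b x 0 J = (if J = {} then 1 else 0)"
  by (simp add: overlap_def pairing_def chi_def)

lemma chi_snoc2:
  "length \<rho> = 2 * n \<Longrightarrow> chi q b (Suc n) x (\<rho> @ [\<sigma>, \<tau>]) = chi q b n x \<rho> * chi_pair q b (x n) \<sigma> \<tau>"
  by (simp add: chi_def nth_append)

lemma inhom_even: "inhom x (2 * n) = x n" and inhom_odd: "inhom x (Suc (2 * n)) = inverse (x n)"
  by (simp_all add: inhom_def)

lemma bethe_pair_contraction:
  assumes q: "q \<noteq> 0" and b: "b \<noteq> 0" and x: "x n \<noteq> 0" and J: "generic_set J"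
  defines "w \<equiv> inhom x"
  shows "chi_pair q b (x n) UUp DDn * bethe q s w (Suc (Suc (2 * n))) J (\<rho> @ [UUp, DDn])
     + chi_pair q b (x n) Zero Zero * bethe q s w (Suc (Suc (2 * n))) J (\<rho> @ [Zero, Zero])
     + chi_pair q b (x n) DDn UUp * bethe q s w (Suc (Suc (2 * n))) J (\<rho> @ [DDn, UUp])
     = s^2 / 2 * br (q * (x n)^2) * br (q^2 * (x n)^2) * (\<Sum>u\<in>J. \<Sum>v\<in>J - {u}. br (b / u) * br (b / v) *
         (d_eigen q w (2 * n) u * d_eigen q w (2 * n) v *
          (\<Prod>c\<in>J - {u} - {v}. br (q * c / x n) * br (q * c * x n) * exch_f q u c * exch_f q v c) *
          bethe q s w (2 * n) (J - {u} - {v}) \<rho>))"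
proof -
  have fin: "finite J" using J by (simp add: generic_set_def)
  define d where "d = d_eigen q w (2 * n)"
  \<comment> \<open>A rapidity placed on the second site of the pair passes the first one with
    weight \<open>m\<close>; one placed on the first site passes the second one with weight
    \<open>p\<close>. A rapidity placed on neither picks up \<open>r\<close> and \<open>p\<close>,
    collected in \<open>E\<close>.\<close>
  define m where "m = (\<lambda>u. br (u / (q * x n)))"
  define p where "p = (\<lambda>u. br (q * u * x n))"
  define r where "r = (\<lambda>u. br (q * u / x n))"
  define E where "E = (\<lambda>u v. d u * d v * (\<Prod>c\<in>J - {u} - {v}. r c * p c * exch_f q u c * exch_f q v c) *
          bethe q s w (2 * n) (J - {u} - {v}) \<rho>)"
  have d': "d_eigen q w (Suc (2 * n)) = (\<lambda>u. d u * m u)"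
    by (simp add: fun_eq_iff d_eigen_def d_def m_def w_def inhom_even)
  have wx: "br (q * c / w (2 * n)) = r c" "br (q * c / w (Suc (2 * n))) = p c" for c
    by (simp_all add: w_def inhom_even inhom_odd divide_simps r_def p_def)
  have 1: "bethe q s w (Suc (Suc (2 * n))) J (\<rho> @ [UUp, DDn]) = s^2 * (\<Sum>u\<in>J. \<Sum>v\<in>J - {u}. m u * m v / 2 * E u v)"
    by (simp add: wx d' butlast_append) (simp add: E_def sum_distrib_left prod.distrib mult_ac)
  have 3: "bethe q s w (Suc (Suc (2 * n))) J (\<rho> @ [DDn, UUp]) = s^2 * (\<Sum>u\<in>J. \<Sum>v\<in>J - {u}. p u * p v / 2 * E u v)"
  proof -
    have e: "(\<Prod>c\<in>J. p c) * (d u * d v * (\<Prod>c\<in>J - {u} - {v}. r c * exch_f q u c * exch_f q v c) * bethe q s w (2 * n) (J - {u} - {v}) \<rho>)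
       = p u * p v * E u v" if "u \<in> J" "v \<in> J - {u}" for u v
      using that fin by (simp add: prod.remove[of J u] prod.remove[of "J - {u}" v] E_def prod.distrib mult_ac)
    have "bethe q s w (Suc (Suc (2 * n))) J (\<rho> @ [DDn, UUp]) = s^2 / 2 * (\<Sum>u\<in>J. \<Sum>v\<in>J - {u}. (\<Prod>c\<in>J. p c) *
       (d u * d v * (\<Prod>c\<in>J - {u} - {v}. r c * exch_f q u c * exch_f q v c) * bethe q s w (2 * n) (J - {u} - {v}) \<rho>))"
      by (simp add: wx butlast_append d_def[symmetric]) (simp add: sum_distrib_left mult_ac)
    also have "\<dots> = s^2 / 2 * (\<Sum>u\<in>J. \<Sum>v\<in>J - {u}. p u * p v * E u v)"
      by (intro arg_cong2[where f = times] refl sum.cong e)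
    finally show ?thesis
      by (simp add: sum_distrib_left mult_ac)
  qed
  have 2: "bethe q s w (Suc (Suc (2 * n))) J (\<rho> @ [Zero, Zero]) = s^2 * (\<Sum>u\<in>J. \<Sum>v\<in>J - {u}. m u * p v * exch_f q u v * E u v)"
  proof -
    have e: "d u * m u * (\<Prod>c\<in>J - {u}. p c * exch_f q u c) * (d v * (\<Prod>c\<in>J - {u} - {v}. r c * exch_f q v c) * bethe q s w (2 * n) (J - {u} - {v}) \<rho>)
      = m u * p v * exch_f q u v * E u v" if "v \<in> J - {u}" for u v
      using that fin by (simp add: prod.remove[of "J - {u}" v] E_def prod.distrib mult_ac)
    have "bethe q s w (Suc (Suc (2 * n))) J (\<rho> @ [Zero, Zero]) = s * s * (\<Sum>u\<in>J. \<Sum>v\<in>J - {u}.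
       d u * m u * (\<Prod>c\<in>J - {u}. p c * exch_f q u c) * (d v * (\<Prod>c\<in>J - {u} - {v}. r c * exch_f q v c) * bethe q s w (2 * n) (J - {u} - {v}) \<rho>))"
      by (simp add: wx d' butlast_append d_def[symmetric]) (simp add: sum_distrib_left mult_ac)
    also have "\<dots> = s * s * (\<Sum>u\<in>J. \<Sum>v\<in>J - {u}. m u * p v * exch_f q u v * E u v)"
      by (intro arg_cong2[where f = times] refl sum.cong e)
    finally show ?thesis
      by (simp add: power2_eq_square)
  qed
  let ?c1 = "br (b * x n) * br (b * q * x n)"
  let ?c2 = "br (inverse b * q * x n) * br (b * q * x n)"
  let ?c3 = "br (inverse b * x n) * br (inverse b * q * x n)"
  have alg: "((c1 * (a * b') / 2 + c2 * (a * d' * f) + c3 * (c * d') / 2) * e + (c1 * (b' * a) / 2 + c2 * (b' * c * g) + c3 * (d' * c) / 2) * e) / 2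
    = (c1 * (a * b') + c2 * (a * d' * f + b' * c * g) + c3 * (c * d')) / 2 * e" for a b' c d' e f g c1 c2 c3 :: complex
    by (simp add: field_simps)
  have "chi_pair q b (x n) UUp DDn * bethe q s w (Suc (Suc (2 * n))) J (\<rho> @ [UUp, DDn])
     + chi_pair q b (x n) Zero Zero * bethe q s w (Suc (Suc (2 * n))) J (\<rho> @ [Zero, Zero])
     + chi_pair q b (x n) DDn UUp * bethe q s w (Suc (Suc (2 * n))) J (\<rho> @ [DDn, UUp])
     = s^2 * (\<Sum>u\<in>J. \<Sum>v\<in>J - {u}. (?c1 * (m u * m v) / 2 + ?c2 * (m u * p v * exch_f q u v) + ?c3 * (p u * p v) / 2) * E u v)"
    unfolding 1 2 3 by (simp add: sum_distrib_left sum.distrib[symmetric] algebra_simps)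
  also have "(\<Sum>u\<in>J. \<Sum>v\<in>J - {u}. (?c1 * (m u * m v) / 2 + ?c2 * (m u * p v * exch_f q u v) + ?c3 * (p u * p v) / 2) * E u v)
    = (\<Sum>u\<in>J. \<Sum>v\<in>J - {u}. br (q * (x n)^2) * br (q^2 * (x n)^2) / 2 * (br (b / u) * br (b / v)) * E u v)"
  proof (subst sum_offdiag_sym[OF fin], intro sum.cong refl)
    fix u v assume u: "u \<in> J" and v: "v \<in> J - {u}"
    have sy: "E v u = E u v"
      unfolding E_def by (simp add: Diff_insert[symmetric] insert_commute mult_ac)
    have *: "?c1 * (m u * m v) + ?c2 * (m u * p v * exch_f q u v + m v * p u * exch_f q v u) + ?c3 * (p u * p v)
       = br (q * (x n)^2) * br (q^2 * (x n)^2) * br (b / u) * br (b / v)"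
      unfolding m_def p_def using J u v
      by (intro chi_weights_symmetrised q b x) (auto simp: generic_set_def)
    show "((?c1 * (m u * m v) / 2 + ?c2 * (m u * p v * exch_f q u v) + ?c3 * (p u * p v) / 2) * E u v
       + (?c1 * (m v * m u) / 2 + ?c2 * (m v * p u * exch_f q v u) + ?c3 * (p v * p u) / 2) * E v u) / 2
      = br (q * (x n)^2) * br (q^2 * (x n)^2) / 2 * (br (b / u) * br (b / v)) * E u v"
      unfolding sy alg * by simp
  qed
  finally show ?thesis
    by (simp add: E_def sum_distrib_left mult_ac d_def p_def r_def)
qed

text \<open>Only three of the nine spin configurations of the last pair occur in the boundary state.
  In each of them exactly two rapidities sit on the pair, so the recursion removes two elements of
  \<open>J\<close>.\<close>

lemma overlap_Suc:
  assumes q: "q \<noteq> 0" and b: "b \<noteq> 0" and x: "x n \<noteq> 0" and J: "generic_set J"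
  shows "overlap q s b x (Suc n) J =
     s^2 / 2 * br (q * (x n)^2) * br (q^2 * (x n)^2) * (\<Sum>u\<in>J. \<Sum>v\<in>J - {u}. br (b / u) * br (b / v) *
         (d_eigen q (inhom x) (2 * n) u * d_eigen q (inhom x) (2 * n) v *
          (\<Prod>c\<in>J - {u} - {v}. br (q * c / x n) * br (q * c * x n) * exch_f q u c * exch_f q v c) *
          overlap q s b x n (J - {u} - {v})))"
proof -
  let ?w = "inhom x"
  let ?L = "{\<rho> :: spin_one list. length \<rho> = 2 * n}"
  have "overlap q s b x (Suc n) J = (\<Sum>\<rho>\<in>?L. chi q b n x \<rho> *
     (chi_pair q b (x n) UUp DDn * bethe q s ?w (Suc (Suc (2 * n))) J (\<rho> @ [UUp, DDn])
     + chi_pair q b (x n) Zero Zero * bethe q s ?w (Suc (Suc (2 * n))) J (\<rho> @ [Zero, Zero])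
     + chi_pair q b (x n) DDn UUp * bethe q s ?w (Suc (Suc (2 * n))) J (\<rho> @ [DDn, UUp])))"
    unfolding overlap_def pairing_def mult_Suc_right add_2_eq_Suc sum_lists_snoc
    by (intro sum.cong refl) (simp add: chi_snoc2 algebra_simps del: bethe.simps)
  also have "\<dots> = (\<Sum>\<rho>\<in>?L. chi q b n x \<rho> *
     (s^2 / 2 * br (q * (x n)^2) * br (q^2 * (x n)^2) * (\<Sum>u\<in>J. \<Sum>v\<in>J - {u}. br (b / u) * br (b / v) *
         (d_eigen q ?w (2 * n) u * d_eigen q ?w (2 * n) v *
          (\<Prod>c\<in>J - {u} - {v}. br (q * c / x n) * br (q * c * x n) * exch_f q u c * exch_f q v c) *
          bethe q s ?w (2 * n) (J - {u} - {v}) \<rho>))))"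
    by (simp only: bethe_pair_contraction[where x = x and n = n and b = b and J = J, OF q b x J])
  also have "\<dots> = s^2 / 2 * br (q * (x n)^2) * br (q^2 * (x n)^2) * (\<Sum>u\<in>J. \<Sum>v\<in>J - {u}. br (b / u) * br (b / v) *
         (d_eigen q ?w (2 * n) u * d_eigen q ?w (2 * n) v *
          (\<Prod>c\<in>J - {u} - {v}. br (q * c / x n) * br (q * c * x n) * exch_f q u c * exch_f q v c) *
          (\<Sum>\<rho>\<in>?L. chi q b n x \<rho> * bethe q s ?w (2 * n) (J - {u} - {v}) \<rho>)))"
    unfolding sum_distrib_left
    by (subst sum.swap, intro sum.cong refl, subst sum.swap, intro sum.cong refl) (simp add: mult_ac)
  finally show ?thesis
    by (simp only: overlap_def pairing_def)
qed

text \<open>One step of this sum belongs to one spin one half boundary column, so that a pair of spin one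
  sites takes two steps.\<close>

primrec tsuchiya_sum :: "complex \<Rightarrow> complex list \<Rightarrow> complex set \<Rightarrow> complex" where
  "tsuchiya_sum q [] = (\<lambda>J. if J = {} then 1 else 0)"
| "tsuchiya_sum q (\<xi> # \<xi>s) = (\<lambda>J. \<Sum>u\<in>J. (\<Prod>\<eta>\<leftarrow>\<xi>s. node_d q u - \<eta>) * (\<Prod>c\<in>J - {u}. (node_a q c - \<xi>) * exch_f q u c) * tsuchiya_sum q \<xi>s (J - {u}))"

text \<open>\<open>node_a q x\<close> and \<open>node_d q x\<close> are the values of
  \<open>z^2 + z^(-2)\<close> at \<open>q^(1/2) x\<close> and \<open>q^(-1/2) x\<close>, so each
  \<open>x i\<close> contributes its two fused columns.\<close>

primrec nodes :: "complex \<Rightarrow> (nat \<Rightarrow> complex) \<Rightarrow> nat \<Rightarrow> complex list" where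
  "nodes q x 0 = []"
| "nodes q x (Suc n) = node_d q (x n) # node_a q (x n) # nodes q x n"

lemma d_eigen_eta_bracket:
  assumes "q \<noteq> 0" "z \<noteq> 0" "\<And>i. i < n \<Longrightarrow> x i \<noteq> 0"
  shows "d_eigen q (inhom x) (2 * n) z * (\<Prod>i<n. eta_bracket z (x i)) = (\<Prod>\<eta>\<leftarrow>nodes q x n. node_d q z - \<eta>)"
  using assms(3)
proof (induction n)
  case (Suc n)
  have x: "x n \<noteq> 0" using Suc.prems by simp
  have inverse_div: "z / (q * inverse (x n)) = z * x n / q"
    by (simp add: divide_inverse)
  have "d_eigen q (inhom x) (2 * Suc n) z = d_eigen q (inhom x) (2 * n) z * (br (z / (q * x n)) * br (z * x n / q))"
    using x inverse_div by (simp add: d_eigen_def inhom_even inhom_odd)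
  then have "d_eigen q (inhom x) (2 * Suc n) z * (\<Prod>i<Suc n. eta_bracket z (x i))
     = (d_eigen q (inhom x) (2 * n) z * (\<Prod>i<n. eta_bracket z (x i))) * (br (z / (q * x n)) * br (z * x n / q) * eta_bracket z (x n))"
    by simp
  also have "br (z / (q * x n)) * br (z * x n / q) * eta_bracket z (x n) = (node_d q z - node_d q (x n)) * (node_d q z - node_a q (x n))"
    using assms x by (simp add: node_d_minus_node_d node_d_minus_node_a eta_bracket_def)
  finally show ?case using Suc by simp
qed (simp add: d_eigen_def)

text \<open>Passing a pair of spin one half columns costs a rapidity one \<open>eta_bracket\<close>
  more than passing the two spin one sites, and for the two rapidities on the pair
  \<open>bracket_symmetrised\<close> yields the same factors. Multiplying the overlap by all of them
  makes the two recursions agree.\<close>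

lemma overlap_eq_tsuchiya_sum:
  assumes q: "q \<noteq> 0" and s: "s^2 = br q * br (q^2)" and b: "b \<noteq> 0" and x: "\<And>i. i < n \<Longrightarrow> x i \<noteq> 0"
    and J: "generic_set J"
  shows "overlap q s b x n J * (\<Prod>c\<in>J. \<Prod>i<n. eta_bracket c (x i)) =
    (\<Prod>i<n. (br q)^2 * br (q * (x i)^2) * br (q^2 * (x i)^2)) * (\<Prod>c\<in>J. br (b / c)) * tsuchiya_sum q (nodes q x n) J"
  using x J
proof (induction n arbitrary: J)
  case 0
  then show ?case by (simp add: overlap_0)
next
  case (Suc n)
  have xn: "x n \<noteq> 0" using Suc.prems by simp
  have fin: "finite J" using Suc.prems by (simp add: generic_set_def)
  let ?d = "d_eigen q (inhom x) (2 * n)"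
  define K where "K = br (q * (x n)^2) * br (q^2 * (x n)^2)"
  define C where "C = (\<Prod>i<n. (br q)^2 * br (q * (x i)^2) * br (q^2 * (x i)^2))"
  define P where "P = (\<lambda>u. \<Prod>\<eta>\<leftarrow>nodes q x n. node_d q u - \<eta>)"
  define \<Phi> where "\<Phi> = (\<lambda>u. \<Prod>i<n. eta_bracket u (x i))"
  define A where "A = (\<lambda>c. (node_a q c - node_d q (x n)) * (node_a q c - node_a q (x n)))"
  define E where "E = (\<lambda>u v. P u * P v * (\<Prod>c\<in>J - {u} - {v}. A c * exch_f q u c * exch_f q v c) * tsuchiya_sum q (nodes q x n) (J - {u} - {v}))"
  define B where "B = (\<Prod>c\<in>J. br (b / c))"
  \<comment> \<open>Since \<open>[q^2] = [q](q + 1/q)\<close>; the second factor is absorbed by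
    \<open>bracket_symmetrised\<close>.\<close>
  have s2: "s^2 = (br q)^2 * (q + 1 / q)"
    unfolding s using q by (simp add: br_def field_simps power2_eq_square)
  have nz: "u \<noteq> 0" if "u \<in> J" for u using that Suc.prems by (auto simp: generic_set_def)
  have rem: "(\<Prod>c\<in>J. g c) = g u * (g v * (\<Prod>c\<in>J - {u} - {v}. g c))" if "u \<in> J" "v \<in> J - {u}" for u v and g :: "complex \<Rightarrow> complex"
    using that fin by (simp add: prod.remove[of J u] prod.remove[of "J - {u}" v])
  have dP: "?d u * \<Phi> u = P u" if "u \<in> J" for u
    unfolding P_def \<Phi>_def by (rule d_eigen_eta_bracket[OF q nz[OF that]]) (use Suc.prems in auto)
  have Aphi: "br (q * c / x n) * br (q * c * x n) * eta_bracket c (x n) = A c" if "c \<in> J" for c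
    unfolding A_def eta_bracket_def using q nz[OF that] xn by (simp add: node_a_minus_node_a node_a_minus_node_d)
  have trm: "br (b / u) * br (b / v) * (?d u * ?d v *
          (\<Prod>c\<in>J - {u} - {v}. br (q * c / x n) * br (q * c * x n) * exch_f q u c * exch_f q v c) *
          overlap q s b x n (J - {u} - {v})) * (\<Prod>c\<in>J. \<Prod>i<Suc n. eta_bracket c (x i))
        = C * B * (eta_bracket u (x n) * eta_bracket v (x n) * E u v)"
    if u: "u \<in> J" and v: "v \<in> J - {u}" for u v
  proof -
    let ?I = "J - {u} - {v}"
    have IH: "overlap q s b x n ?I * (\<Prod>c\<in>?I. \<Phi> c) = C * (\<Prod>c\<in>?I. br (b / c)) * tsuchiya_sum q (nodes q x n) ?I"
      unfolding C_def \<Phi>_def using Suc.prems by (intro Suc.IH) (auto elim: generic_set_subset)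
    have "(\<Prod>c\<in>J. \<Prod>i<Suc n. eta_bracket c (x i)) = (\<Prod>c\<in>J. \<Phi> c) * (\<Prod>c\<in>J. eta_bracket c (x n))"
      by (simp add: prod.distrib \<Phi>_def)
    also have "\<dots> = \<Phi> u * \<Phi> v * (\<Prod>c\<in>?I. \<Phi> c) * (eta_bracket u (x n) * eta_bracket v (x n)) * (\<Prod>c\<in>?I. eta_bracket c (x n))"
      unfolding rem[OF u v] by (simp only: mult_ac)
    finally have "br (b / u) * br (b / v) * (?d u * ?d v *
          (\<Prod>c\<in>?I. br (q * c / x n) * br (q * c * x n) * exch_f q u c * exch_f q v c) *
          overlap q s b x n ?I) * (\<Prod>c\<in>J. \<Prod>i<Suc n. eta_bracket c (x i))
      = br (b / u) * br (b / v) * ((?d u * \<Phi> u) * (?d v * \<Phi> v)) *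
        (eta_bracket u (x n) * eta_bracket v (x n)) * ((\<Prod>c\<in>?I. br (q * c / x n) * br (q * c * x n) * exch_f q u c * exch_f q v c) * (\<Prod>c\<in>?I. eta_bracket c (x n)))
        * (overlap q s b x n ?I * (\<Prod>c\<in>?I. \<Phi> c))"
      by (simp only: mult_ac)
    also have "(\<Prod>c\<in>?I. br (q * c / x n) * br (q * c * x n) * exch_f q u c * exch_f q v c) * (\<Prod>c\<in>?I. eta_bracket c (x n))
       = (\<Prod>c\<in>?I. A c * exch_f q u c * exch_f q v c)"
    proof -
      have "(\<Prod>c\<in>?I. br (q * c / x n) * br (q * c * x n) * exch_f q u c * exch_f q v c) * (\<Prod>c\<in>?I. eta_bracket c (x n))
        = (\<Prod>c\<in>?I. (br (q * c / x n) * br (q * c * x n) * eta_bracket c (x n)) * exch_f q u c * exch_f q v c)"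
        unfolding prod.distrib[symmetric] by (simp only: mult_ac)
      also have "\<dots> = (\<Prod>c\<in>?I. A c * exch_f q u c * exch_f q v c)"
        by (rule prod.cong) (simp_all add: Aphi)
      finally show ?thesis .
    qed
    finally show ?thesis
      unfolding IH dP[OF u] dP[OF DiffD1[OF v]] B_def rem[OF u v] E_def by (simp only: mult_ac)
  qed
  have "overlap q s b x (Suc n) J * (\<Prod>c\<in>J. \<Prod>i<Suc n. eta_bracket c (x i))
    = s^2 / 2 * K * (\<Sum>u\<in>J. \<Sum>v\<in>J - {u}. C * B * (eta_bracket u (x n) * eta_bracket v (x n) * E u v))"
  proof -
    have "overlap q s b x (Suc n) J * (\<Prod>c\<in>J. \<Prod>i<Suc n. eta_bracket c (x i)) = s^2 / 2 * K *
      ((\<Sum>u\<in>J. \<Sum>v\<in>J - {u}. br (b / u) * br (b / v) * (?d u * ?d v *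
          (\<Prod>c\<in>J - {u} - {v}. br (q * c / x n) * br (q * c * x n) * exch_f q u c * exch_f q v c) *
          overlap q s b x n (J - {u} - {v}))) * (\<Prod>c\<in>J. \<Prod>i<Suc n. eta_bracket c (x i)))"
      unfolding overlap_Suc[where x = x and n = n and b = b and J = J, OF q b xn Suc.prems(2)] K_def
      by (simp only: mult.assoc)
    also have "\<dots> = s^2 / 2 * K * (\<Sum>u\<in>J. \<Sum>v\<in>J - {u}. C * B * (eta_bracket u (x n) * eta_bracket v (x n) * E u v))"
      unfolding sum_distrib_right by (intro arg_cong2[where f = times] refl sum.cong trm)
    finally show ?thesis .
  qed
  also have "\<dots> = (br q)^2 * K * C * B * (\<Sum>u\<in>J. \<Sum>v\<in>J - {u}. (q + 1 / q) * (eta_bracket u (x n) * eta_bracket v (x n)) * E u v / 2)"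
    unfolding s2 by (simp add: sum_distrib_left mult_ac)
  also have "(\<Sum>u\<in>J. \<Sum>v\<in>J - {u}. (q + 1 / q) * (eta_bracket u (x n) * eta_bracket v (x n)) * E u v / 2)
     = (\<Sum>u\<in>J. \<Sum>v\<in>J - {u}. (node_d q u - node_a q (x n)) * (node_a q v - node_d q (x n)) * exch_f q u v * E u v)"
  \<comment> \<open>Fusion read backwards: the summand with the two columns treated differently is
    averaged over the exchange of \<open>u\<close> and \<open>v\<close>.\<close>
  proof (rule sym, subst sum_offdiag_sym[OF fin], intro sum.cong refl)
    fix u v assume u: "u \<in> J" and v: "v \<in> J - {u}"
    have sy: "E v u = E u v"
      unfolding E_def by (simp add: Diff_insert[symmetric] insert_commute mult_ac)
    have *: "(node_d q u - node_a q (x n)) * (node_a q v - node_d q (x n)) * exch_f q u v + (node_d q v - node_a q (x n)) * (node_a q u - node_d q (x n)) * exch_f q v u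
        = (q + 1 / q) * eta_bracket u (x n) * eta_bracket v (x n)"
      using Suc.prems(2) u v by (intro bracket_symmetrised q xn) (auto simp: generic_set_def)
    show "((node_d q u - node_a q (x n)) * (node_a q v - node_d q (x n)) * exch_f q u v * E u v +
         (node_d q v - node_a q (x n)) * (node_a q u - node_d q (x n)) * exch_f q v u * E v u) / 2
        = (q + 1 / q) * (eta_bracket u (x n) * eta_bracket v (x n)) * E u v / 2"
      unfolding sy distrib_right[symmetric] * by (simp add: mult_ac)
  qed
  also have "(\<Sum>u\<in>J. \<Sum>v\<in>J - {u}. (node_d q u - node_a q (x n)) * (node_a q v - node_d q (x n)) * exch_f q u v * E u v)
     = tsuchiya_sum q (nodes q x (Suc n)) J"
  proof -
    have e: "(node_d q u - node_a q (x n)) * P u * (\<Prod>c\<in>J - {u}. (node_a q c - node_d q (x n)) * exch_f q u c) *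
        (P v * (\<Prod>c\<in>J - {u} - {v}. (node_a q c - node_a q (x n)) * exch_f q v c) * tsuchiya_sum q (nodes q x n) (J - {u} - {v}))
      = (node_d q u - node_a q (x n)) * (node_a q v - node_d q (x n)) * exch_f q u v * E u v" if v: "v \<in> J - {u}" for u v
    proof -
      have "(\<Prod>c\<in>J - {u}. (node_a q c - node_d q (x n)) * exch_f q u c) = (node_a q v - node_d q (x n)) * exch_f q u v * (\<Prod>c\<in>J - {u} - {v}. (node_a q c - node_d q (x n)) * exch_f q u c)"
        using v fin by (simp add: prod.remove[of "J - {u}" v])
      then show ?thesis by (simp add: E_def A_def prod.distrib mult_ac)
    qed
    have "tsuchiya_sum q (nodes q x (Suc n)) J = (\<Sum>u\<in>J. \<Sum>v\<in>J - {u}.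
        (node_d q u - node_a q (x n)) * P u * (\<Prod>c\<in>J - {u}. (node_a q c - node_d q (x n)) * exch_f q u c) *
        (P v * (\<Prod>c\<in>J - {u} - {v}. (node_a q c - node_a q (x n)) * exch_f q v c) * tsuchiya_sum q (nodes q x n) (J - {u} - {v})))"
      unfolding sum_distrib_left[symmetric] by (simp add: P_def)
    then show ?thesis
      by (simp only: e cong: sum.cong)
  qed
  finally show ?case
    by (simp add: K_def C_def B_def mult_ac)
qed


subsection \<open>Determinants divided by Vandermonde products\<close>

text \<open>\<open>vdet e fs J\<close> is the determinant with rows \<open>fs\<close> and columns \<open>J\<close>, divided by the Vandermonde product
  of \<open>e\<close>, up to sign, in the form of its expansion along the first row. The quotient does not depend on an ordering
  of the columns.\<close>

primrec vdet :: "('i \<Rightarrow> complex) \<Rightarrow> ('i \<Rightarrow> complex) list \<Rightarrow> 'i set \<Rightarrow> complex" where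
  "vdet e [] = (\<lambda>J. if J = {} then 1 else 0)"
| "vdet e (f # fs) = (\<lambda>J. \<Sum>a\<in>J. f a / (\<Prod>c\<in>J - {a}. e c - e a) * vdet e fs (J - {a}))"

text \<open>Exchanging the columns chosen for the first two rows changes only the order in the
  factor \<open>e a - e b\<close>, hence the sign.\<close>

lemma vdet_swap:
  assumes "finite J"
  shows "vdet e (f # g # fs) J = - vdet e (g # f # fs) J"
proof -
  have *: "f b / (\<Prod>c\<in>J - {b}. e c - e b) * (g a / (\<Prod>c\<in>J - {b} - {a}. e c - e a) * vdet e fs (J - {b} - {a}))
      = - (g a / (\<Prod>c\<in>J - {a}. e c - e a) * (f b / (\<Prod>c\<in>J - {a} - {b}. e c - e b) * vdet e fs (J - {a} - {b})))"
    if "a \<in> J" "b \<in> J - {a}" for a b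
  proof -
    have i: "J - {b} - {a} = J - {a} - {b}" by auto
    define d where "d = e a - e b"
    have d': "e b - e a = - d" by (simp add: d_def)
    have "(\<Prod>c\<in>J - {b}. e c - e b) = d * (\<Prod>c\<in>J - {a} - {b}. e c - e b)"
      using that assms by (subst prod.remove[of "J - {b}" a]) (auto simp: i d_def)
    moreover have "(\<Prod>c\<in>J - {a}. e c - e a) = - d * (\<Prod>c\<in>J - {a} - {b}. e c - e a)"
      using that assms by (subst prod.remove[of "J - {a}" b]) (auto simp: d')
    ultimately show ?thesis by (simp add: i mult_ac)
  qed
  have "vdet e (f # g # fs) J = (\<Sum>a\<in>J. \<Sum>b\<in>J - {a}. f a / (\<Prod>c\<in>J - {a}. e c - e a) *
     (g b / (\<Prod>c\<in>J - {a} - {b}. e c - e b) * vdet e fs (J - {a} - {b})))"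
    by (simp add: sum_distrib_left)
  also have "\<dots> = (\<Sum>a\<in>J. \<Sum>b\<in>J - {a}. f b / (\<Prod>c\<in>J - {b}. e c - e b) *
     (g a / (\<Prod>c\<in>J - {b} - {a}. e c - e a) * vdet e fs (J - {b} - {a})))"
    by (rule sum_offdiag_swap[OF assms])
  also have "\<dots> = (\<Sum>a\<in>J. \<Sum>b\<in>J - {a}. - (g a / (\<Prod>c\<in>J - {a}. e c - e a) *
     (f b / (\<Prod>c\<in>J - {a} - {b}. e c - e b) * vdet e fs (J - {a} - {b}))))"
    by (intro sum.cong refl *)
  also have "\<dots> = - vdet e (g # f # fs) J"
    by (simp add: sum_distrib_left sum_negf)
  finally show ?thesis .
qed

lemma vdet_repeat: "finite J \<Longrightarrow> f \<in> set fs \<Longrightarrow> vdet e (f # fs) J = 0"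
proof (induction fs arbitrary: J)
  case (Cons g fs)
  show ?case
  proof (cases "f = g")
    case True
    then have "vdet e (f # g # fs) J = - vdet e (f # g # fs) J" using vdet_swap[OF Cons.prems(1), of e f g fs] by simp
    then show ?thesis by simp
  next
    case False
    then have "vdet e (f # fs) (J - {a}) = 0" for a using Cons by simp
    then show ?thesis unfolding vdet_swap[OF Cons.prems(1), of e f g fs] by (subst vdet.simps(2)) simp
  qed
qed simp

lemma vdet_add: "vdet e ((\<lambda>a. x * f a + y * g a) # fs) J = x * vdet e (f # fs) J + y * vdet e (g # fs) J"
  by (simp add: sum_distrib_left sum.distrib[symmetric] add_divide_distrib distrib_right mult.assoc)

lemma vdet_cong:
  assumes "\<And>k a. k \<in> set ks \<Longrightarrow> a \<in> J \<Longrightarrow> F k a = G k a"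
  shows "vdet e (map F ks) J = vdet e (map G ks) J"
  using assms
proof (induction ks arbitrary: J)
  case (Cons k ks)
  have "vdet e (map F ks) (J - {a}) = vdet e (map G ks) (J - {a})" for a
    by (rule Cons.IH) (use Cons.prems in auto)
  then show ?case using Cons.prems by simp
qed simp

lemma vdet_col_scale:
  assumes "finite J"
  shows "vdet e (map (\<lambda>k a. r a * F k a) ks) J = (\<Prod>a\<in>J. r a) * vdet e (map F ks) J"
  using assms
proof (induction ks arbitrary: J)
  case (Cons k ks)
  have "(\<Prod>a\<in>J. r a) = r a * (\<Prod>a\<in>J - {a}. r a)" if "a \<in> J" for a
    using Cons.prems that by (simp add: prod.remove)
  then show ?case using Cons by (simp add: sum_distrib_left mult_ac)
qed auto

lemma vdet_row_scale: "vdet e (map (\<lambda>k a. r k * F k a) ks) J = (\<Prod>k\<leftarrow>ks. r k) * vdet e (map F ks) J"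
  by (induction ks arbitrary: J) (simp_all add: sum_distrib_left mult_ac)

text \<open>Lets the columns carry fixed labels while their rapidities move, as in the limits
  below.\<close>

lemma vdet_reindex:
  assumes "inj_on h J"
  shows "vdet e fs (h ` J) = vdet (e \<circ> h) (map (\<lambda>f. f \<circ> h) fs) J"
  using assms
proof (induction fs arbitrary: J)
  case (Cons f fs)
  have i: "h ` J - {h a} = h ` (J - {a})" if "a \<in> J" for a
    using Cons.prems that by (auto simp: inj_on_def)
  have j: "inj_on h (J - {a})" for a using Cons.prems by (rule inj_on_subset) auto
  show ?case
    using Cons.prems by (simp add: sum.reindex i Cons.IH[OF j] prod.reindex[OF j])
qed simp

text \<open>Invariant under \<open>z \<rightarrow> 1/z\<close> and
  \<open>z \<rightarrow> -z\<close>; all Vandermonde products in the rapidities are taken in this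
  variable.\<close>

definition eta :: "complex \<Rightarrow> complex" where "eta z = z^2 + 1 / z^2"

text \<open>Up to row and column factors, its inverse is the entry of Tsuchiya's matrix for a square
  root of \<open>q\<close>. Products over all other nodes, as they appear below, are these entries
  with the denominators of the column cleared.\<close>

definition node_kernel :: "complex \<Rightarrow> complex \<Rightarrow> complex \<Rightarrow> complex" where
  "node_kernel q \<xi> z = (node_a q z - \<xi>) * (node_d q z - \<xi>)"

primrec vandermonde :: "complex list \<Rightarrow> complex" where
  "vandermonde [] = 1"
| "vandermonde (\<xi> # \<xi>s) = (\<Prod>\<eta>\<leftarrow>\<xi>s. \<xi> - \<eta>) * vandermonde \<xi>s"

lemma eta_diff: "u \<noteq> 0 \<Longrightarrow> v \<noteq> 0 \<Longrightarrow> eta u - eta v = br (u / v) * br (u * v)"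
  by (simp add: eta_def br_def field_simps power2_eq_square)

text \<open>Extending the fraction by \<open>br (c * u)\<close> turns the denominator into a
  Vandermonde factor and the numerator into a factor of
  \<open>node_kernel q (node_a q u) c\<close>.\<close>

lemma exch_f_eta:
  assumes "q \<noteq> 0" "u \<noteq> 0" "c \<noteq> 0" "eta c \<noteq> eta u"
  shows "exch_f q u c = (node_d q c - node_a q u) / (eta c - eta u)"
proof -
  have "br (c / u) * br (c * u) \<noteq> 0" using assms eta_diff[of c u] by (metis right_minus_eq)
  moreover have "br (q * u / c) = - br (c / (q * u))" "br (u / c) = - br (c / u)"
    using assms br_swap[of c "q * u"] br_swap[of c u] by simp_all
  ultimately show ?thesis
    using assms by (simp add: exch_f_def node_d_minus_node_a eta_diff mult_ac)
qed

lemma poly_eq_by_nodes: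
  fixes p r :: "complex poly"
  assumes "finite A" "\<And>x. x \<in> A \<Longrightarrow> poly p x = poly r x" "degree p < card A" "degree r < card A"
  shows "p = r"
proof -
  have "p - r = 0"
  proof (rule ccontr)
    assume nz: "p - r \<noteq> 0"
    have "A \<subseteq> {x. poly (p - r) x = 0}" using assms by auto
    then have "card A \<le> card {x. poly (p - r) x = 0}"
      by (intro card_mono poly_roots_finite nz)
    also have "\<dots> \<le> degree (p - r)" by (rule card_poly_roots_bound[OF nz])
    finally show False using assms degree_diff_le_max[of p r] by linarith
  qed
  then show ?thesis by simp
qed

lemma degree_prod_linear: "finite A \<Longrightarrow> degree (\<Prod>c\<in>A. [:f c, g c:]) \<le> card (A :: 'i set)" for f g :: "'i \<Rightarrow> complex"
proof -
  assume "finite A"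
  then have "degree (\<Prod>c\<in>A. [:f c, g c:]) \<le> (\<Sum>c\<in>A. degree [:f c, g c:])"
    using degree_prod_sum_le[of A "\<lambda>c. [:f c, g c:]"] by (simp add: comp_def)
  also have "\<dots> \<le> (\<Sum>c\<in>A. 1)" by (intro sum_mono) (simp add: degree_pCons_le)
  finally show ?thesis by simp
qed

lemma disjoint_mono: "A \<subseteq> A' \<Longrightarrow> B \<subseteq> B' \<Longrightarrow> A' \<inter> B' = {} \<Longrightarrow> A \<inter> B = {}"
  by blast

text \<open>As polynomials in the first node, both sides have degree at most twice the number of remaining
  nodes. They agree at the points \<open>node_a q c\<close>, where all but one summand vanish, and at the remaining
  nodes, where both sides are zero, the right-hand one because two rows coincide.\<close>

lemma tsuchiya_sum_eq_vdet:
  assumes q: "q \<noteq> 0" and fin: "finite J" and nz: "0 \<notin> J" and ie: "inj_on eta J" and ia: "inj_on (node_a q) J"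
    and ks: "distinct ks" "inj_on \<xi> (set ks)" "length ks = card J"
    and dis: "\<xi> ` set ks \<inter> node_a q ` J = {}"
  shows "tsuchiya_sum q (map \<xi> ks) J * vandermonde (map \<xi> ks) =
     vdet eta (map (\<lambda>k z. \<Prod>k'\<in>set ks - {k}. node_kernel q (\<xi> k') z) ks) J"
  using fin nz ie ia ks dis
proof (induction ks arbitrary: J)
  case Nil
  then show ?case by simp
next
  case (Cons k0 ks)
  let ?X = "set ks"
  have k0: "k0 \<notin> ?X" and finJ: "finite J" and dk: "distinct ks" using Cons.prems by auto
  have etane: "eta c \<noteq> eta a" if "a \<in> J" "c \<in> J - {a}" for a c
    using Cons.prems(3) that by (auto simp: inj_on_def)
  define P where "P = (\<lambda>k z. \<Prod>k'\<in>?X - {k}. node_kernel q (\<xi> k') z)"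
  define m where "m = (\<lambda>a. vdet eta (map P ks) (J - {a}))"
  \<comment> \<open>\<open>A\<close> and \<open>B\<close> collect what does not depend on the first
    node. As polynomials in that node, \<open>L\<close> is the recursion of
    \<open>tsuchiya_sum\<close> and \<open>R\<close> the expansion of the determinant along its
    first row; by the induction hypothesis both contain the same minors \<open>m\<close>.\<close>
  define A where "A = (\<lambda>a. (\<Prod>k\<in>?X. node_d q a - \<xi> k) * (\<Prod>c\<in>J - {a}. exch_f q a c) * m a)"
  define B where "B = (\<lambda>a. (\<Prod>k\<in>?X. node_kernel q (\<xi> k) a) / (\<Prod>c\<in>J - {a}. eta c - eta a) * m a)"
  define L where "L = (\<Sum>a\<in>J. [:A a:] * (\<Prod>c\<in>J - {a}. [:node_a q c, -1:]) * (\<Prod>k\<in>?X. [:- \<xi> k, 1:]))"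
  define R where "R = (\<Sum>a\<in>J. [:B a:] * ((\<Prod>c\<in>J - {a}. [:node_a q c, -1:]) * (\<Prod>c\<in>J - {a}. [:node_d q c, -1:])))"
  have L: "poly L u = (\<Sum>a\<in>J. A a * (\<Prod>c\<in>J - {a}. node_a q c - u) * (\<Prod>k\<in>?X. u - \<xi> k))" for u
    by (simp add: L_def poly_sum poly_prod mult.assoc)
  have R: "poly R u = (\<Sum>a\<in>J. B a * (\<Prod>c\<in>J - {a}. node_kernel q u c))" for u
    by (simp add: R_def poly_sum poly_prod node_kernel_def prod.distrib mult_ac)
  have cJ: "card J = Suc (card ?X)" using Cons.prems dk by (simp add: distinct_card)
  have cJ': "card (J - {a}) = card ?X" if "a \<in> J" for a using cJ finJ that by simp
  have "L = R"
  proof (rule poly_eq_by_nodes)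
    \<comment> \<open>These are \<open>2 * card ?X + 1\<close> points, one more than the degree
      bound.\<close>
    let ?N = "node_a q ` J \<union> \<xi> ` ?X"
    show "finite ?N" using finJ by simp
    have card: "card ?N = card J + card ?X"
    proof -
      have "inj_on \<xi> ?X" by (rule inj_on_subset[OF Cons.prems(6)]) auto
      then show ?thesis
        using Cons.prems(4,8) finJ by (subst card_Un_disjoint) (auto simp: card_image)
    qed
    have "degree L \<le> card ?X + card ?X" unfolding L_def
    proof (rule degree_sum_le[OF finJ])
      fix a assume a: "a \<in> J"
      have "degree ([:A a:] * (\<Prod>c\<in>J - {a}. [:node_a q c, -1:]) * (\<Prod>k\<in>?X. [:- \<xi> k, 1:]))
        \<le> degree [:A a:] + degree (\<Prod>c\<in>J - {a}. [:node_a q c, -1:]) + degree (\<Prod>k\<in>?X. [:- \<xi> k, 1:])"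
        using degree_mult_le order_trans add_right_mono by meson
      also have "\<dots> \<le> 0 + card (J - {a}) + card ?X"
        by (intro add_mono degree_prod_linear) (use finJ in auto)
      finally show "degree ([:A a:] * (\<Prod>c\<in>J - {a}. [:node_a q c, -1:]) * (\<Prod>k\<in>?X. [:- \<xi> k, 1:])) \<le> card ?X + card ?X"
        using cJ'[OF a] by simp
    qed
    then show "degree L < card ?N" using card cJ by simp
    have "degree R \<le> card ?X + card ?X" unfolding R_def
    proof (rule degree_sum_le[OF finJ])
      fix a assume a: "a \<in> J"
      have "degree ([:B a:] * ((\<Prod>c\<in>J - {a}. [:node_a q c, -1:]) * (\<Prod>c\<in>J - {a}. [:node_d q c, -1:])))
        \<le> degree [:B a:] + (degree (\<Prod>c\<in>J - {a}. [:node_a q c, -1:]) + degree (\<Prod>c\<in>J - {a}. [:node_d q c, -1:]))"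
        using degree_mult_le order_trans add_left_mono by meson
      also have "\<dots> \<le> 0 + (card (J - {a}) + card (J - {a}))"
        by (intro add_mono degree_prod_linear) (use finJ in auto)
      finally show "degree ([:B a:] * ((\<Prod>c\<in>J - {a}. [:node_a q c, -1:]) * (\<Prod>c\<in>J - {a}. [:node_d q c, -1:]))) \<le> card ?X + card ?X"
        using cJ'[OF a] by simp
    qed
    then show "degree R < card ?N" using card cJ by simp
    fix u assume "u \<in> ?N"
    then consider w where "w \<in> J" "u = node_a q w" | k where "k \<in> ?X" "u = \<xi> k" by auto
    then show "poly L u = poly R u"
    proof cases
      case 1
      \<comment> \<open>At the point belonging to \<open>w\<close>, each summand with
        \<open>a \<noteq> w\<close> contains the vanishing factor with \<open>c = w\<close>.\<close>
      have z: "(\<Prod>c\<in>J - {a}. node_a q c - u) = 0" "(\<Prod>c\<in>J - {a}. node_kernel q u c) = 0" if "a \<in> J - {w}" for a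
      proof -
        have "w \<in> J - {a}" "finite (J - {a})" using that 1 finJ by auto
        moreover have "node_a q w - u = 0" "node_kernel q u w = 0" using 1 by (simp_all add: node_kernel_def)
        ultimately show "(\<Prod>c\<in>J - {a}. node_a q c - u) = 0" "(\<Prod>c\<in>J - {a}. node_kernel q u c) = 0"
          by (meson prod_zero)+
      qed
      have wn: "w \<noteq> 0" using 1 Cons.prems by auto
      have "poly L u = A w * (\<Prod>c\<in>J - {w}. node_a q c - u) * (\<Prod>k\<in>?X. u - \<xi> k)"
        unfolding L by (subst sum.remove[OF finJ 1(1)]) (simp add: z)
      also have "\<dots> = ((\<Prod>k\<in>?X. node_d q w - \<xi> k) * (\<Prod>k\<in>?X. node_a q w - \<xi> k)) *
         ((\<Prod>c\<in>J - {w}. exch_f q w c) * (\<Prod>c\<in>J - {w}. node_a q c - u)) * m w"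
        by (simp add: A_def 1 mult_ac)
      also have "(\<Prod>k\<in>?X. node_d q w - \<xi> k) * (\<Prod>k\<in>?X. node_a q w - \<xi> k) = (\<Prod>k\<in>?X. node_kernel q (\<xi> k) w)"
        by (simp add: node_kernel_def prod.distrib mult_ac)
      also have "(\<Prod>c\<in>J - {w}. exch_f q w c) * (\<Prod>c\<in>J - {w}. node_a q c - u) = (\<Prod>c\<in>J - {w}. node_kernel q u c) / (\<Prod>c\<in>J - {w}. eta c - eta w)"
        unfolding prod.distrib[symmetric] prod_dividef[symmetric]
      proof (rule prod.cong[OF refl])
        fix c assume c: "c \<in> J - {w}"
        have "exch_f q w c = (node_d q c - node_a q w) / (eta c - eta w)"
          by (rule exch_f_eta[OF q wn]) (use c etane[OF 1(1) c] Cons.prems in auto)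
        then show "exch_f q w c * (node_a q c - u) = node_kernel q u c / (eta c - eta w)"
          by (simp add: node_kernel_def 1 mult_ac)
      qed
      also have "(\<Prod>k\<in>?X. node_kernel q (\<xi> k) w) * ((\<Prod>c\<in>J - {w}. node_kernel q u c) / (\<Prod>c\<in>J - {w}. eta c - eta w)) * m w = B w * (\<Prod>c\<in>J - {w}. node_kernel q u c)"
        by (simp add: B_def)
      also have "\<dots> = poly R u"
        unfolding R by (subst sum.remove[OF finJ 1(1)]) (simp add: z)
      finally show ?thesis .
    next
      case 2
      have "(\<Prod>k\<in>?X. u - \<xi> k) = 0" by (rule prod_zero) (use 2 in auto)
      then have "poly L u = 0" unfolding L by (simp only: mult_zero_right sum.neutral_const)
      moreover have "poly R u = (\<Prod>c\<in>J. node_kernel q u c) * vdet eta (P k # map P ks) J"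
      proof -
        \<comment> \<open>The factor of \<open>B a\<close> that belongs to \<open>k\<close>
          completes the product to one over all of \<open>J\<close>, independent of
          \<open>a\<close>. What is left is the expansion of a determinant whose first row occurs
          again below.\<close>
        have "B a * (\<Prod>c\<in>J - {a}. node_kernel q u c) = (\<Prod>c\<in>J. node_kernel q u c) * (P k a / (\<Prod>c\<in>J - {a}. eta c - eta a) * m a)"
          if "a \<in> J" for a
          using that finJ 2 by (simp add: B_def P_def prod.remove[of J a] prod.remove[of ?X k])
        then show ?thesis by (simp add: R m_def sum_distrib_left)
      qed
      moreover have "vdet eta (P k # map P ks) J = 0"
        by (rule vdet_repeat[OF finJ]) (use 2 in auto)
      ultimately show ?thesis by simp
    qed
  qed
  have IH: "tsuchiya_sum q (map \<xi> ks) (J - {a}) * vandermonde (map \<xi> ks) = m a" if a: "a \<in> J" for a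
    unfolding m_def P_def
  proof (rule Cons.IH)
    show "length ks = card (J - {a})" using Cons.prems(7) a finJ by simp
    show "inj_on eta (J - {a})" by (rule inj_on_subset[OF Cons.prems(3)]) blast
    show "inj_on (node_a q) (J - {a})" by (rule inj_on_subset[OF Cons.prems(4)]) blast
    show "inj_on \<xi> ?X" by (rule inj_on_subset[OF Cons.prems(6)]) auto
    show "\<xi> ` ?X \<inter> node_a q ` (J - {a}) = {}"
      by (rule disjoint_mono[OF _ _ Cons.prems(8)]) auto
    show "0 \<notin> J - {a}" using Cons.prems(2) by simp
    show "finite (J - {a})" using finJ by simp
  qed (rule dk)
  have lst: "(\<Prod>\<eta>\<leftarrow>map \<xi> ks. g \<eta>) = (\<Prod>k\<in>?X. g (\<xi> k))" for g :: "complex \<Rightarrow> complex"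
    using dk by (simp add: prod.distinct_set_conv_list comp_def)
  have "tsuchiya_sum q (map \<xi> (k0 # ks)) J * vandermonde (map \<xi> (k0 # ks)) = poly L (\<xi> k0)"
  proof -
    have "(\<Prod>\<eta>\<leftarrow>map \<xi> ks. node_d q a - \<eta>) * (\<Prod>c\<in>J - {a}. (node_a q c - \<xi> k0) * exch_f q a c) * tsuchiya_sum q (map \<xi> ks) (J - {a}) *
       ((\<Prod>\<eta>\<leftarrow>map \<xi> ks. \<xi> k0 - \<eta>) * vandermonde (map \<xi> ks))
       = A a * (\<Prod>c\<in>J - {a}. node_a q c - \<xi> k0) * (\<Prod>k\<in>?X. \<xi> k0 - \<xi> k)" if a: "a \<in> J" for a
      unfolding A_def IH[OF a, symmetric] lst by (simp add: prod.distrib mult_ac)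
    then show ?thesis
      unfolding L by (simp add: sum_distrib_right del: map_map)
  qed
  also have "\<dots> = poly R (\<xi> k0)" by (simp add: \<open>L = R\<close>)
  also have "\<dots> = vdet eta (map (\<lambda>k z. \<Prod>k'\<in>set (k0 # ks) - {k}. node_kernel q (\<xi> k') z) (k0 # ks)) J"
  proof -
    have i2: "set (k0 # ks) - {k} = insert k0 (?X - {k})" if "k \<in> ?X" for k
      using k0 that by auto
    have i1: "set (k0 # ks) - {k0} = ?X" using k0 by auto
    have "vdet eta (map (\<lambda>k z. \<Prod>k'\<in>set (k0 # ks) - {k}. node_kernel q (\<xi> k') z) ks) I
      = vdet eta (map (\<lambda>k z. node_kernel q (\<xi> k0) z * P k z) ks) I" for I
    proof (rule vdet_cong)
      fix k z assume k: "k \<in> ?X"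
      have "finite (?X - {k})" "k0 \<notin> ?X - {k}" using k0 by auto
      then show "(\<Prod>k'\<in>set (k0 # ks) - {k}. node_kernel q (\<xi> k') z) = node_kernel q (\<xi> k0) z * P k z"
        unfolding i2[OF k] P_def by (rule prod.insert)
    qed
    then have "vdet eta (map (\<lambda>k z. \<Prod>k'\<in>set (k0 # ks) - {k}. node_kernel q (\<xi> k') z) ks) (J - {a}) = (\<Prod>c\<in>J - {a}. node_kernel q (\<xi> k0) c) * m a" for a
      using finJ by (simp add: vdet_col_scale m_def)
    note e = this
    show ?thesis
      unfolding R list.map vdet.simps i1 e B_def by (intro sum.cong refl) (simp only: times_divide_eq_left times_divide_eq_right mult_ac)
  qed
  finally show ?case .
qed


subsection \<open>The overlap as a determinant of size 2n\<close>

lemma eta_bracket_eq: "z \<noteq> 0 \<Longrightarrow> x \<noteq> 0 \<Longrightarrow> eta_bracket z x = eta z - eta x"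
  by (simp add: eta_bracket_def eta_diff)

text \<open>Both nodes of \<open>x\<close> share the factor \<open>eta z - eta x\<close> and differ
  only in \<open>q * x\<close> against \<open>x / q\<close>. This coincidence, special to fused
  columns, is what allows the reduction from size \<open>2n\<close> to \<open>n\<close>.\<close>

lemma node_kernel_node_a: "q \<noteq> 0 \<Longrightarrow> z \<noteq> 0 \<Longrightarrow> x \<noteq> 0 \<Longrightarrow> node_kernel q (node_a q x) z = (eta z - eta x) * (eta z - eta (q * x))"
  by (simp add: node_kernel_def node_a_minus_node_a node_d_minus_node_a eta_diff mult_ac)

lemma node_kernel_node_d: "q \<noteq> 0 \<Longrightarrow> z \<noteq> 0 \<Longrightarrow> x \<noteq> 0 \<Longrightarrow> node_kernel q (node_d q x) z = (eta z - eta x) * (eta z - eta (x / q))"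
  by (simp add: node_kernel_def node_a_minus_node_d node_d_minus_node_d eta_diff mult_ac)

primrec row_idx :: "nat \<Rightarrow> (nat \<times> bool) list" where
  "row_idx 0 = []"
| "row_idx (Suc n) = (n, True) # (n, False) # row_idx n"

definition node :: "complex \<Rightarrow> (nat \<Rightarrow> complex) \<Rightarrow> nat \<times> bool \<Rightarrow> complex" where
  "node q x = (\<lambda>(i, s). if s then node_d q (x i) else node_a q (x i))"

lemma nodes_eq: "nodes q x n = map (node q x) (row_idx n)"
  by (induction n) (simp_all add: node_def)

lemma set_row_idx: "set (row_idx n) = {..<n} \<times> UNIV"
proof (induction n)
  case (Suc n)
  have "p \<in> set (row_idx (Suc n)) \<longleftrightarrow> p \<in> {..<Suc n} \<times> UNIV" for p
    using Suc by (cases p; cases "snd p") (auto simp: less_Suc_eq)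
  then show ?case by blast
qed simp

lemma distinct_row_idx: "distinct (row_idx n)"
  by (induction n) (auto simp: set_row_idx)

lemma length_row_idx: "length (row_idx n) = 2 * n"
  by (induction n) auto

text \<open>The pair \<open>k\<close> contributes \<open>\<eta> - eta (x k)\<close> twice; one copy
  goes into a common column factor. The copy kept here makes the rows of pair \<open>i\<close>
  vanish at the rapidities \<open>1/x k\<close> with \<open>k \<noteq> i\<close>.\<close>

definition cofactor_poly :: "complex \<Rightarrow> (nat \<Rightarrow> complex) \<Rightarrow> nat \<Rightarrow> nat \<Rightarrow> complex \<Rightarrow> complex" where
  "cofactor_poly q x n i \<eta> = (\<Prod>k\<in>{..<n} - {i}. (\<eta> - eta (x k)) * (\<eta> - eta (q * x k)) * (\<eta> - eta (x k / q)))"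

text \<open>Row \<open>(i, s)\<close> omits its own kernel, so from pair \<open>i\<close> the kernel
  of the opposite node is left: \<open>True\<close>, that is \<open>node_d\<close>, goes with
  \<open>q * x i\<close>.\<close>

definition row_poly :: "complex \<Rightarrow> (nat \<Rightarrow> complex) \<Rightarrow> nat \<Rightarrow> nat \<times> bool \<Rightarrow> complex \<Rightarrow> complex" where
  "row_poly q x n = (\<lambda>(i, s) \<eta>. (\<eta> - eta (if s then q * x i else x i / q)) * cofactor_poly q x n i \<eta>)"

lemma prod_node_kernel_eq_row_poly:
  assumes q: "q \<noteq> 0" and z: "z \<noteq> 0" and x: "\<And>i. i < n \<Longrightarrow> x i \<noteq> 0" and k: "k \<in> set (row_idx n)"
  shows "(\<Prod>k'\<in>set (row_idx n) - {k}. node_kernel q (node q x k') z) = (\<Prod>i<n. eta z - eta (x i)) * row_poly q x n k (eta z)"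
proof -
  obtain i s where k': "k = (i, s)" and i: "i < n" using k unfolding set_row_idx by (cases k) auto
  have "set (row_idx n) - {k} = insert (i, \<not> s) (({..<n} - {i}) \<times> UNIV)"
    using i by (auto simp: set_row_idx k')
  then have "(\<Prod>k'\<in>set (row_idx n) - {k}. node_kernel q (node q x k') z)
     = node_kernel q (node q x (i, \<not> s)) z * (\<Prod>k'\<in>({..<n} - {i}) \<times> UNIV. node_kernel q (node q x k') z)"
    by simp
  also have "node_kernel q (node q x (i, \<not> s)) z = (eta z - eta (x i)) * (eta z - eta (if s then q * x i else x i / q))"
    using q z x[OF i] by (simp add: node_def node_kernel_node_a node_kernel_node_d)
  also have "(\<Prod>k'\<in>({..<n} - {i}) \<times> UNIV. node_kernel q (node q x k') z)
     = (\<Prod>l\<in>{..<n} - {i}. \<Prod>s\<in>UNIV. node_kernel q (node q x (l, s)) z)"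
    by (simp add: prod.cartesian_product)
  also have "\<dots> = (\<Prod>l\<in>{..<n} - {i}. node_kernel q (node_d q (x l)) z * node_kernel q (node_a q (x l)) z)"
    by (simp add: UNIV_bool node_def mult_ac)
  also have "\<dots> = (\<Prod>l\<in>{..<n} - {i}. (eta z - eta (x l)) *
       ((eta z - eta (x l)) * (eta z - eta (q * x l)) * (eta z - eta (x l / q))))"
    using q z x by (intro prod.cong refl) (simp add: node_kernel_node_a node_kernel_node_d)
  also have "\<dots> = (\<Prod>l\<in>{..<n} - {i}. eta z - eta (x l)) * cofactor_poly q x n i (eta z)"
    by (simp add: cofactor_poly_def prod.distrib)
  also have "(eta z - eta (x i)) * (eta z - eta (if s then q * x i else x i / q)) *
      ((\<Prod>l\<in>{..<n} - {i}. eta z - eta (x l)) * cofactor_poly q x n i (eta z))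
     = (\<Prod>i<n. eta z - eta (x i)) * row_poly q x n k (eta z)"
    using i by (simp add: prod.remove[of "{..<n}" i] row_poly_def k')
  finally show ?thesis .
qed

definition norm_const :: "complex \<Rightarrow> (nat \<Rightarrow> complex) \<Rightarrow> nat \<Rightarrow> complex" where
  "norm_const q x n = (\<Prod>i<n. (br q)^2 * br (q * (x i)^2) * br (q^2 * (x i)^2))"

lemma overlap_eq_vdet_generic:
  assumes q: "q \<noteq> 0" and s: "s^2 = br q * br (q^2)" and b: "b \<noteq> 0" and x: "\<And>i. i < n \<Longrightarrow> x i \<noteq> 0"
    and ix: "inj_on (node q x) ({..<n} \<times> UNIV)"
    and J: "generic_set J" "card J = 2 * n" "inj_on eta J" "inj_on (node_a q) J"
    and ne: "\<And>z i. z \<in> J \<Longrightarrow> i < n \<Longrightarrow> eta z \<noteq> eta (x i) \<and> node_a q z \<noteq> node_a q (x i) \<and> node_a q z \<noteq> node_d q (x i)"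
  shows "overlap q s b x n J * vandermonde (nodes q x n) =
    norm_const q x n * (\<Prod>c\<in>J. br (b / c)) * vdet eta (map (\<lambda>k z. row_poly q x n k (eta z)) (row_idx n)) J"
proof -
  have fin: "finite J" and J0: "0 \<notin> J" using J by (simp_all add: generic_set_def)
  have nz: "z \<noteq> 0" if "z \<in> J" for z using J0 that by auto
  define \<Phi> where "\<Phi> = (\<Prod>c\<in>J. \<Prod>i<n. eta_bracket c (x i))"
  have \<Phi>: "\<Phi> = (\<Prod>c\<in>J. \<Prod>i<n. eta c - eta (x i))"
    unfolding \<Phi>_def using x nz by (intro prod.cong refl eta_bracket_eq) auto
  have \<Phi>0: "\<Phi> \<noteq> 0" unfolding \<Phi> using ne fin by simp
  have "overlap q s b x n J * \<Phi> = norm_const q x n * (\<Prod>c\<in>J. br (b / c)) * tsuchiya_sum q (nodes q x n) J"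
    unfolding \<Phi>_def norm_const_def by (rule overlap_eq_tsuchiya_sum[OF q s b x J(1)])
  then have "overlap q s b x n J * \<Phi> * vandermonde (nodes q x n)
     = norm_const q x n * (\<Prod>c\<in>J. br (b / c)) * (tsuchiya_sum q (nodes q x n) J * vandermonde (nodes q x n))"
    by simp
  also have "tsuchiya_sum q (nodes q x n) J * vandermonde (nodes q x n)
     = vdet eta (map (\<lambda>k z. \<Prod>k'\<in>set (row_idx n) - {k}. node_kernel q (node q x k') z) (row_idx n)) J"
    unfolding nodes_eq
  proof (rule tsuchiya_sum_eq_vdet[OF q fin J0 J(3,4) distinct_row_idx])
    show "node q x ` set (row_idx n) \<inter> node_a q ` J = {}"
      using ne by (fastforce simp: set_row_idx node_def split: if_splits)
  qed (use ix J in \<open>simp_all add: set_row_idx length_row_idx\<close>)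
  also have "\<dots> = vdet eta (map (\<lambda>k z. (\<Prod>i<n. eta z - eta (x i)) * row_poly q x n k (eta z)) (row_idx n)) J"
    by (rule vdet_cong) (use prod_node_kernel_eq_row_poly[OF q nz x] in auto)
  also have "\<dots> = \<Phi> * vdet eta (map (\<lambda>k z. row_poly q x n k (eta z)) (row_idx n)) J"
    unfolding \<Phi> by (rule vdet_col_scale[OF fin])
  finally show ?thesis using \<Phi>0 by (simp add: mult_ac)
qed

section \<open>Continuity in the rapidities\<close>

lemma isCont_br: "isCont f t \<Longrightarrow> f t \<noteq> 0 \<Longrightarrow> isCont (\<lambda>t. br (f t)) t" for f :: "complex \<Rightarrow> complex"
  unfolding br_def by (intro continuous_intros)

lemma isCont_R_mat:
  assumes "q \<noteq> 0" "isCont f t" "f t \<noteq> 0"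
  shows "isCont (\<lambda>t. R_mat q s (f t) \<alpha> \<beta>) (t :: complex)"
proof -
  have "isCont (\<lambda>t. R_diag q (f t) \<alpha>) t"
    by (cases "(q, f t, \<alpha>)" rule: R_diag.cases) (use assms in \<open>auto intro!: isCont_br continuous_intros\<close>)
  moreover have "(\<lambda>t. R_mat q s (f t) \<alpha> \<beta>) = (if \<alpha> = \<beta> then (\<lambda>t. R_diag q (f t) \<alpha>) else (\<lambda>t. R_mat q s 1 \<alpha> \<beta>))"
    by (simp add: R_mat_def fun_eq_iff)
  ultimately show ?thesis by (cases "\<alpha> = \<beta>") simp_all
qed

lemma isCont_transfer_col:
  assumes q: "q \<noteq> 0" and w: "\<And>i. i < k \<Longrightarrow> w i \<noteq> 0" and z: "isCont z t" "z t \<noteq> 0"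
    and v: "\<And>\<rho>. isCont (\<lambda>t. v t \<rho>) (t :: complex)"
  shows "isCont (\<lambda>t. transfer_col q s w (z t) k a (v t) \<sigma>) t"
  using w v
proof (induction k arbitrary: a v \<sigma>)
  case 0
  then show ?case by (cases "a = Dn") simp_all
next
  case (Suc k)
  have "isCont (\<lambda>t. inverse q * z t / w k) t"
    using z Suc.prems(1)[of k] by (intro continuous_intros) auto
  moreover have "inverse q * z t / w k \<noteq> 0" using z q Suc.prems(1)[of k] by auto
  ultimately have R: "isCont (\<lambda>t. R_mat q s (inverse q * z t / w k) \<alpha> \<beta>) t" for \<alpha> \<beta>
    by (rule isCont_R_mat[OF q])
  have "isCont (\<lambda>t. transfer_col q s w (z t) k e (\<lambda>\<rho>. v t (\<rho> @ [\<tau>])) (butlast \<sigma>)) t" for e \<tau>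
    by (rule Suc.IH) (use Suc.prems in auto)
  then show ?case
    unfolding transfer_col.simps case_prod_unfold by (intro continuous_intros R)
qed

lemma isCont_B_product:
  assumes q: "q \<noteq> 0" and w: "\<And>i. i < N \<Longrightarrow> w i \<noteq> 0"
    and z: "\<And>k. k \<in> set ks \<Longrightarrow> isCont (\<lambda>t. z t k) t \<and> z t k \<noteq> (0::complex)"
  shows "isCont (\<lambda>t. B_product q s w N (map (z t) ks) \<sigma>) (t :: complex)"
  using z
proof (induction ks arbitrary: \<sigma>)
  case (Cons k ks)
  then show ?case
    unfolding B_product_def list.map foldr_Cons comp_def by (intro isCont_transfer_col q w) auto
qed (simp add: B_product_def)

lemma isCont_eq_at_limit:
  fixes f g :: "complex \<Rightarrow> complex"
  assumes "isCont f t" "isCont g t" "eventually (\<lambda>t. f t = g t) (at t)"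
  shows "f t = g t"
proof (rule tendsto_unique[of "at t"])
  show "(f \<longlongrightarrow> f t) (at t)" using assms(1) by (simp add: isCont_def)
  show "(f \<longlongrightarrow> g t) (at t)"
    using assms(2,3) by (simp add: isCont_def tendsto_cong)
qed simp

lemma isCont_vdet:
  assumes "finite J" "\<And>a. a \<in> J \<Longrightarrow> isCont (\<lambda>t. e t a) (t :: complex)" "inj_on (e t) J"
    "\<And>k a. k \<in> set ks \<Longrightarrow> a \<in> J \<Longrightarrow> isCont (\<lambda>t. F t k a) t"
  shows "isCont (\<lambda>t. vdet (e t) (map (F t) ks) J) t"
  using assms
proof (induction ks arbitrary: J)
  case (Cons k ks)
  have "isCont (\<lambda>t. vdet (e t) (map (F t) ks) (J - {a})) t" for a
    by (rule Cons.IH) (use Cons.prems in \<open>auto intro: inj_on_subset\<close>)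
  moreover have "(\<Prod>c\<in>J - {a}. e t c - e t a) \<noteq> 0" if "a \<in> J" for a
    using Cons.prems that by (auto simp: inj_on_def)
  ultimately show ?case
    unfolding list.map vdet.simps using Cons.prems by (intro continuous_intros) auto
qed simp

lemma br_eq_0_iff: "z \<noteq> 0 \<Longrightarrow> br z = 0 \<longleftrightarrow> z = 1 \<or> z = -1"
  by (simp add: br_def field_simps square_eq_1_iff)

lemma eventually_br_nz: "c \<noteq> 0 \<Longrightarrow> eventually (\<lambda>t. br (c * t) \<noteq> 0) (at (1 :: complex))"
proof -
  assume c: "c \<noteq> 0"
  have "eventually (\<lambda>t. t \<noteq> 0 \<and> t \<noteq> 1 / c \<and> t \<noteq> - 1 / c) (at (1 :: complex))"
    by (intro eventually_conj eventually_neq_at_within)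
  then show ?thesis
    by eventually_elim (use c in \<open>auto simp: br_eq_0_iff field_simps\<close>)
qed

lemma eventually_br_sq_nz: "c \<noteq> 0 \<Longrightarrow> eventually (\<lambda>t. br (c * t^2) \<noteq> 0) (at (1 :: complex))"
proof -
  assume c: "c \<noteq> 0"
  have e: "t^2 = w \<longleftrightarrow> t = csqrt w \<or> t = - csqrt w" for t w
    by (metis power2_csqrt power2_eq_iff)
  have "eventually (\<lambda>t. t \<noteq> 0 \<and> t \<noteq> csqrt (1 / c) \<and> t \<noteq> - csqrt (1 / c) \<and> t \<noteq> csqrt (- 1 / c) \<and> t \<noteq> - csqrt (- 1 / c)) (at (1 :: complex))"
    by (intro eventually_conj eventually_neq_at_within)
  then show ?thesis
  proof eventually_elim
    case (elim t)
    then have "t^2 \<noteq> 1 / c" "t^2 \<noteq> - 1 / c" unfolding e by auto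
    then show ?case using c elim by (auto simp: br_eq_0_iff field_simps)
  qed
qed

lemma overlap_eq_B_product:
  assumes "q \<noteq> 0" "s^2 = br q * br (q^2)" "\<And>i. i < n \<Longrightarrow> x i \<noteq> 0" "distinct zs" "generic_set (set zs)"
  shows "overlap q s b x n (set zs) = pairing (2 * n) (chi q b n x) (B_product q s (inhom x) (2 * n) zs)"
proof -
  have "inhom x i \<noteq> 0" if "i < 2 * n" for i using assms(3)[of "i div 2"] that by (auto simp: inhom_def)
  then show ?thesis
    unfolding overlap_def pairing_def using assms by (intro sum.cong refl) (simp add: B_product_eq_bethe)
qed

lemma generic_set_eta:
  assumes "finite J" "0 \<notin> J" "inj_on eta J"
  shows "generic_set J"
  unfolding generic_set_def
proof (intro conjI ballI impI assms(1,2))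
  fix a c assume ac: "a \<in> J" "c \<in> J" "a \<noteq> c"
  then have "a \<noteq> 0" "c \<noteq> 0" "eta a - eta c \<noteq> 0" using assms by (auto simp: inj_on_def)
  then show "br (a / c) \<noteq> 0" by (auto simp: eta_diff)
qed

lemma isCont_eta: "isCont f t \<Longrightarrow> f t \<noteq> 0 \<Longrightarrow> isCont (\<lambda>t. eta (f t)) t" for f :: "complex \<Rightarrow> complex"
  unfolding eta_def by (intro continuous_intros) auto

lemma isCont_row_poly: "isCont f t \<Longrightarrow> isCont (\<lambda>t. row_poly q x n k (f t)) t" for f :: "complex \<Rightarrow> complex"
  unfolding row_poly_def cofactor_poly_def case_prod_unfold by (intro continuous_intros)

text \<open>The common factor of both sides of \<open>overlap_eq_tsuchiya_sum\<close> can only be cancelled for generic rapidities. Scaling all rapidities by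
  \<open>t \<rightarrow> 1\<close> removes this restriction; it is needed below for rapidities \<open>1/x\<^sub>j\<close>.\<close>

lemma overlap_eq_vdet:
  assumes q: "q \<noteq> 0" and s: "s^2 = br q * br (q^2)" and b: "b \<noteq> 0" and x: "\<And>i. i < n \<Longrightarrow> x i \<noteq> 0"
    and ix: "inj_on (node q x) ({..<n} \<times> UNIV)"
    and J: "finite J" "0 \<notin> J" "card J = 2 * n" "inj_on eta J"
  shows "overlap q s b x n J * vandermonde (nodes q x n) =
    norm_const q x n * (\<Prod>c\<in>J. br (b / c)) * vdet eta (map (\<lambda>k z. row_poly q x n k (eta z)) (row_idx n)) J"
proof -
  obtain zs where zs: "set zs = J" "distinct zs" using finite_distinct_list[OF J(1)] by auto
  have nz: "z \<noteq> 0" if "z \<in> J" for z using J(2) that by auto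
  \<comment> \<open>Written with \<open>B_product\<close>, which is continuous at all non-zero
    rapidities, instead of the Bethe vectors with their denominators.\<close>
  define f where "f = (\<lambda>t. pairing (2 * n) (chi q b n x) (B_product q s (inhom x) (2 * n) (map (\<lambda>z. t * z) zs)) * vandermonde (nodes q x n))"
  define g where "g = (\<lambda>t. norm_const q x n * (\<Prod>c\<in>J. br (b / (t * c))) *
     vdet (\<lambda>c. eta (t * c)) (map (\<lambda>k c. row_poly q x n k (eta (t * c))) (row_idx n)) J)"
  have ih: "inhom x i \<noteq> 0" if "i < 2 * n" for i using x[of "i div 2"] that by (auto simp: inhom_def)
  have "isCont f 1"
    unfolding f_def pairing_def using nz zs by (intro continuous_intros isCont_B_product q ih) auto
  moreover have "isCont g 1"
    unfolding g_def using nz J(4) b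
    by (intro continuous_intros isCont_vdet J(1) isCont_br isCont_eta isCont_row_poly) auto
  moreover have "eventually (\<lambda>t. f t = g t) (at 1)"
  proof -
    have "eventually (\<lambda>t. (\<forall>a\<in>J. \<forall>c\<in>J. br (a * c * t^2) \<noteq> 0 \<and> br (q * a * c * t^2) \<noteq> 0) \<and>
        (\<forall>a\<in>J. \<forall>i\<in>{..<n}. br (a / x i * t) \<noteq> 0 \<and> br (a * x i * t) \<noteq> 0 \<and> br (q * a * x i * t) \<noteq> 0 \<and> br (q * a / x i * t) \<noteq> 0) \<and> t \<noteq> 0) (at 1)"
      by (intro eventually_conj eventually_ball_finite ballI J(1) eventually_br_nz eventually_br_sq_nz eventually_neq_at_within finite_lessThan)
        (use q nz x in auto)
    then show ?thesis
    proof eventually_elim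
      case (elim t)
      let ?h = "\<lambda>z. t * z"
      have t: "t \<noteq> 0" and ih: "inj_on ?h J" using elim by (auto simp: inj_on_def)
      have aJ: "br (a / c) \<noteq> 0" if "a \<in> J" "c \<in> J" "a \<noteq> c" for a c
        using generic_set_eta[OF J(1,2,4)] that by (simp add: generic_set_def)
      have ie: "inj_on eta (?h ` J)"
      proof (rule inj_onI, elim imageE)
        fix a c u v assume *: "eta u = eta v" "u = t * a" "v = t * c" "a \<in> J" "c \<in> J"
        have "eta (t * a) - eta (t * c) = br (a / c) * br (a * c * t^2)"
          using t nz[OF *(4)] nz[OF *(5)] by (simp add: eta_diff power2_eq_square mult_ac)
        then have "br (a / c) * br (a * c * t^2) = 0" using *(1-3) by simp
        then have "br (a / c) = 0" using elim *(4,5) by auto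
        then have "a = c" using aJ[OF *(4,5)] by blast
        then show "u = v" using *(2,3) by simp
      qed
      have ia: "inj_on (node_a q) (?h ` J)"
      proof (rule inj_onI, elim imageE)
        fix a c u v assume *: "node_a q u = node_a q v" "u = t * a" "v = t * c" "a \<in> J" "c \<in> J"
        have "node_a q (t * a) - node_a q (t * c) = br (q * a * c * t^2) * br (a / c)"
          using t nz[OF *(4)] nz[OF *(5)] q by (simp add: node_a_minus_node_a power2_eq_square mult_ac)
        then have "br (q * a * c * t^2) * br (a / c) = 0" using *(1-3) by simp
        then have "br (a / c) = 0" using elim *(4,5) by auto
        then have "a = c" using aJ[OF *(4,5)] by blast
        then show "u = v" using *(2,3) by simp
      qed
      have J': "finite (?h ` J)" "0 \<notin> ?h ` J" "card (?h ` J) = 2 * n"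
        using J ih t by (auto simp: card_image)
      have gs: "generic_set (?h ` J)" by (rule generic_set_eta[OF J'(1,2) ie])
      have "f t = overlap q s b x n (set (map ?h zs)) * vandermonde (nodes q x n)"
        unfolding f_def by (subst overlap_eq_B_product[OF q s x]) (use zs ih gs in \<open>simp_all add: distinct_map\<close>)
      also have "\<dots> = overlap q s b x n (?h ` J) * vandermonde (nodes q x n)" by (simp add: zs)
      also have "\<dots> = norm_const q x n * (\<Prod>c\<in>?h ` J. br (b / c)) * vdet eta (map (\<lambda>k z. row_poly q x n k (eta z)) (row_idx n)) (?h ` J)"
      proof (rule overlap_eq_vdet_generic[OF q s b x ix gs J'(3) ie ia])
        fix z i assume "z \<in> ?h ` J" and i: "i < n"
        then obtain a where a: "a \<in> J" "z = t * a" by auto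
        have "eta z - eta (x i) = br (a / x i * t) * br (a * x i * t)" "node_a q z - node_a q (x i) = br (q * a * x i * t) * br (a / x i * t)"
          "node_a q z - node_d q (x i) = br (a * x i * t) * br (q * a / x i * t)"
          using a t q nz[OF a(1)] x[OF i] by (simp_all add: eta_diff node_a_minus_node_a node_a_minus_node_d mult_ac)
        then have "eta z - eta (x i) \<noteq> 0" "node_a q z - node_a q (x i) \<noteq> 0" "node_a q z - node_d q (x i) \<noteq> 0"
          using elim a i by simp_all
        then show "eta z \<noteq> eta (x i) \<and> node_a q z \<noteq> node_a q (x i) \<and> node_a q z \<noteq> node_d q (x i)" by simp
      qed
      also have "\<dots> = g t"
        unfolding g_def vdet_reindex[OF ih] by (simp add: prod.reindex[OF ih] comp_def)
      finally show ?case .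
    qed
  qed
  ultimately have "f 1 = g 1" by (rule isCont_eq_at_limit)
  moreover have "f 1 = overlap q s b x n J * vandermonde (nodes q x n)"
  proof -
    have "overlap q s b x n (set zs) = pairing (2 * n) (chi q b n x) (B_product q s (inhom x) (2 * n) zs)"
      by (rule overlap_eq_B_product[OF q s x zs(2)]) (simp_all add: zs generic_set_eta[OF J(1,2,4)])
    then show ?thesis by (simp add: f_def zs(1) map_idI)
  qed
  ultimately show ?thesis by (simp add: g_def)
qed


subsection \<open>Reduction to a determinant of size n\<close>

lemma vdet_vanish: "finite J \<Longrightarrow> a \<in> J \<Longrightarrow> (\<And>f. f \<in> set fs \<Longrightarrow> f a = 0) \<Longrightarrow> vdet e fs J = 0"
proof (induction fs arbitrary: J)
  case (Cons f fs)
  have "f b / (\<Prod>c\<in>J - {b}. e c - e b) * vdet e fs (J - {b}) = 0" if "b \<in> J" for b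
  proof (cases "b = a")
    case False
    then have "vdet e fs (J - {b}) = 0" using Cons by auto
    then show ?thesis by simp
  qed (use Cons.prems in simp)
  then show ?case unfolding vdet.simps by (intro sum.neutral) blast
qed auto

text \<open>The row operation for the two rows of one \<open>x i\<close>: modulo the first row, only
  the multiple of \<open>g\<close> counts in the second.\<close>

lemma vdet_second:
  assumes "finite J"
  shows "vdet e (f # (\<lambda>a. x * f a + y * g a) # fs) J = y * vdet e (f # g # fs) J"
proof -
  have "vdet e (f # (\<lambda>a. x * f a + y * g a) # fs) J = - (x * vdet e (f # f # fs) J + y * vdet e (g # f # fs) J)"
    by (simp only: vdet_swap[OF assms, of e f "\<lambda>a. x * f a + y * g a"] vdet_add)
  also have "vdet e (f # f # fs) J = 0" by (rule vdet_repeat[OF assms]) simp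
  also have "vdet e (g # f # fs) J = - vdet e (f # g # fs) J" by (rule vdet_swap[OF assms])
  finally show ?thesis by simp
qed

primrec interleave :: "(nat \<Rightarrow> 'a) \<Rightarrow> (nat \<Rightarrow> 'a) \<Rightarrow> nat \<Rightarrow> 'a list" where
  "interleave f g 0 = []"
| "interleave f g (Suc n) = f n # g n # interleave f g n"

lemma set_interleave: "set (interleave f g n) = f ` {..<n} \<union> g ` {..<n}"
  by (induction n) (auto simp: lessThan_Suc)

lemma vdet_tail_scale:
  assumes "\<And>K. finite K \<Longrightarrow> vdet e fs K = c * vdet e gs K" "finite J"
  shows "vdet e (f # fs) J = c * vdet e (f # gs) J"
  using assms by (simp add: sum_distrib_left mult_ac)

lemma vdet_row_idx:
  assumes "\<And>i. i < n \<Longrightarrow> F (i, True) = f i"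
    and "\<And>i. i < n \<Longrightarrow> F (i, False) = (\<lambda>a. \<alpha> i * f i a + \<beta> i * g i a)" and "finite J"
  shows "vdet e (map F (row_idx n)) J = (\<Prod>i<n. \<beta> i) * vdet e (interleave f g n) J"
  using assms
proof (induction n arbitrary: J)
  case (Suc n)
  have IH: "vdet e (map F (row_idx n)) K = (\<Prod>i<n. \<beta> i) * vdet e (interleave f g n) K" if "finite K" for K
    using Suc that by simp
  have "vdet e (map F (row_idx (Suc n))) J = vdet e (f n # (\<lambda>a. \<alpha> n * f n a + \<beta> n * g n a) # map F (row_idx n)) J"
    using Suc.prems(1,2)[of n] by simp
  also have "\<dots> = \<beta> n * vdet e (f n # g n # map F (row_idx n)) J"
    by (rule vdet_second[OF Suc.prems(3)])
  also have "vdet e (f n # g n # map F (row_idx n)) J = (\<Prod>i<n. \<beta> i) * vdet e (f n # g n # interleave f g n) J"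
    by (intro vdet_tail_scale IH Suc.prems(3))
  finally show ?case by simp
qed simp

text \<open>Block triangular: on the columns tagged \<open>True\<close> the \<open>f\<close> rows
  are diagonal and the \<open>g\<close> rows vanish. The products on the left are the part of the
  Vandermonde product that involves these columns. The set \<open>K\<close> varies because expanding
  along a \<open>g\<close> row removes an element of it.\<close>

lemma vdet_interleave:
  fixes e :: "nat \<times> bool \<Rightarrow> complex"
  assumes "finite K" "\<And>i j. i < n \<Longrightarrow> j < n \<Longrightarrow> i \<noteq> j \<Longrightarrow> f i (j, True) = 0"
    and "\<And>i j. i < n \<Longrightarrow> j < n \<Longrightarrow> g i (j, True) = 0"
    and "\<And>i j. i < j \<Longrightarrow> j < n \<Longrightarrow> e (i, True) \<noteq> e (j, True)"
    and "\<And>i k. i < n \<Longrightarrow> k \<in> K \<Longrightarrow> e (k, False) \<noteq> e (i, True)"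
  shows "vdet e (interleave f g n) ({..<n} \<times> {True} \<union> K \<times> {False}) *
      ((\<Prod>j<n. \<Prod>i<j. e (i, True) - e (j, True)) * (\<Prod>i<n. \<Prod>k\<in>K. e (k, False) - e (i, True)))
    = (\<Prod>i<n. (-1)^i * f i (i, True)) * vdet (\<lambda>k. e (k, False)) (map (\<lambda>i k. g i (k, False)) (rev [0..<n])) K"
  using assms
proof (induction n arbitrary: K)
  case 0
  then show ?case by simp
next
  case (Suc m)
  let ?T = "\<lambda>i. e (i, True)" and ?F = "\<lambda>k. e (k, False)"
  let ?J = "{..<Suc m} \<times> {True} \<union> K \<times> {False}" and ?I = "\<lambda>K. {..<m} \<times> {True} \<union> K \<times> {False}"
  let ?gs = "map (\<lambda>i k. g i (k, False)) (rev [0..<m])"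
  define P where "P = (\<Prod>j<m. \<Prod>i<j. ?T i - ?T j)"
  define Q where "Q = (\<lambda>K. \<Prod>i<m. \<Prod>k\<in>K. ?F k - ?T i)"
  define S where "S = (\<Prod>i<m. (-1)^i * f i (i, True))"
  have fin: "finite K" by fact
  have J': "?J - {(m, True)} = ?I K" by auto
  have I': "?I K - {(k, False)} = ?I (K - {k})" for k by auto
  have prI: "(\<Prod>c\<in>?I L. h c) = (\<Prod>i<m. h (i, True)) * (\<Prod>k\<in>L. h (k, False))" if "finite L" for L and h :: "nat \<times> bool \<Rightarrow> complex"
  proof -
    have "(\<Prod>c\<in>?I L. h c) = (\<Prod>c\<in>{..<m} \<times> {True}. h c) * (\<Prod>c\<in>L \<times> {False}. h c)"
      using that by (intro prod.union_disjoint) auto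
    moreover have "{..<m} \<times> {True} = (\<lambda>i. (i, True)) ` {..<m}" "L \<times> {False} = (\<lambda>i. (i, False)) ` L" by auto
    ultimately show ?thesis by (simp add: prod.reindex inj_on_def)
  qed
  have sumK: "(\<Sum>a\<in>K \<times> {False}. h a) = (\<Sum>k\<in>K. h (k, False))" for h :: "nat \<times> bool \<Rightarrow> complex"
  proof -
    have im: "K \<times> {False} = (\<lambda>k. (k, False)) ` K" by auto
    show ?thesis unfolding im by (subst sum.reindex) (auto simp: inj_on_def)
  qed
  define A where "A = (\<Prod>i<m. ?T i - ?T m)"
  define B where "B = (\<Prod>k\<in>K. ?F k - ?T m)"
  have AB: "A \<noteq> 0" "B \<noteq> 0" unfolding A_def B_def using Suc.prems(4)[of _ m] Suc.prems(5)[of m] fin by auto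
  have 1: "vdet e (interleave f g (Suc m)) ?J = f m (m, True) / (A * B) * vdet e (g m # interleave f g m) (?I K)"
  proof -
    define h where "h = (\<lambda>a. f m a / (\<Prod>c\<in>?J - {a}. e c - e a) * vdet e (g m # interleave f g m) (?J - {a}))"
    \<comment> \<open>If \<open>f m\<close> takes any other column, then \<open>(m, True)\<close>
      remains and is zero in all remaining rows.\<close>
    have z: "h a = 0" if "a \<in> ?J - {(m, True)}" for a
    proof -
      have "vdet e (g m # interleave f g m) (?J - {a}) = 0"
      proof (rule vdet_vanish[of _ "(m, True)"])
        fix f' assume "f' \<in> set (g m # interleave f g m)"
        then have "f' = g m \<or> f' \<in> f ` {..<m} \<or> f' \<in> g ` {..<m}" by (auto simp: set_interleave)
        then show "f' (m, True) = 0"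
          by (elim disjE imageE) (simp_all add: Suc.prems(2)[of _ m] Suc.prems(3)[of _ m])
      qed (use that fin in auto)
      then show ?thesis unfolding h_def by (simp only: mult_zero_right)
    qed
    have "vdet e (interleave f g (Suc m)) ?J = (\<Sum>a\<in>?J. h a)"
      by (simp only: interleave.simps vdet.simps(2)[of e "f m"] h_def)
    also have "\<dots> = h (m, True) + (\<Sum>a\<in>?J - {(m, True)}. h a)"
      by (rule sum.remove) (use fin in auto)
    also have "(\<Sum>a\<in>?J - {(m, True)}. h a) = 0"
      by (rule sum.neutral) (use z in blast)
    finally have "vdet e (interleave f g (Suc m)) ?J = f m (m, True) / (\<Prod>c\<in>?J - {(m, True)}. e c - e (m, True)) * vdet e (g m # interleave f g m) (?J - {(m, True)})"
      unfolding h_def by simp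
    then show ?thesis unfolding J' by (simp only: prI[OF fin] A_def B_def)
  qed
  have 2: "vdet e (g m # interleave f g m) (?I K) = (\<Sum>k\<in>K. g m (k, False) /
      ((\<Prod>i<m. ?T i - ?F k) * (\<Prod>k'\<in>K - {k}. ?F k' - ?F k)) * vdet e (interleave f g m) (?I (K - {k})))"
  proof -
    have "vdet e (g m # interleave f g m) (?I K) = (\<Sum>a\<in>K \<times> {False}. g m a / (\<Prod>c\<in>?I K - {a}. e c - e a) * vdet e (interleave f g m) (?I K - {a}))"
      unfolding vdet.simps(2) using fin Suc.prems(3) by (intro sum.mono_neutral_right) auto
    also have "\<dots> = (\<Sum>k\<in>K. g m (k, False) / (\<Prod>c\<in>?I K - {(k, False)}. e c - e (k, False)) * vdet e (interleave f g m) (?I K - {(k, False)}))"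
      by (rule sumK)
    finally show ?thesis
      unfolding I' by (simp only: prI finite_Diff[OF fin])
  qed
  have IH: "vdet e (interleave f g m) (?I (K - {k})) * (P * Q (K - {k})) = S * vdet ?F ?gs (K - {k})" for k
    unfolding P_def Q_def S_def by (rule Suc.IH) (use Suc.prems in auto)
  have tm: "g m (k, False) / ((\<Prod>i<m. ?T i - ?F k) * (\<Prod>k'\<in>K - {k}. ?F k' - ?F k)) * vdet e (interleave f g m) (?I (K - {k})) * (P * Q K)
     = (-1)^m * S * (g m (k, False) / (\<Prod>k'\<in>K - {k}. ?F k' - ?F k) * vdet ?F ?gs (K - {k}))" if k: "k \<in> K" for k
  proof -
    define C where "C = (\<Prod>i<m. ?T i - ?F k)"
    have "\<forall>i<m. e (i, True) \<noteq> e (k, False)" by (metis Suc.prems(5) k less_SucI)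
    then have C0: "C \<noteq> 0" unfolding C_def by simp
    \<comment> \<open>Source of the signs: expanding along \<open>g m\<close> gives the differences
      with the \<open>m\<close> remaining \<open>True\<close> columns in the opposite order.\<close>
    have "(\<Prod>i<m. ?F k - ?T i) = (\<Prod>i<m. (-1) * (?T i - ?F k))" by (intro prod.cong) auto
    also have "\<dots> = (-1)^m * C" unfolding prod.distrib C_def by simp
    finally have QK: "Q K = (-1)^m * C * Q (K - {k})"
      using fin k by (simp add: Q_def prod.remove[of K k] prod.distrib)
    show ?thesis
      unfolding QK C_def[symmetric] using C0 IH[of k] by (simp add: mult_ac)
  qed
  have "vdet e (interleave f g (Suc m)) ?J * ((\<Prod>j<Suc m. \<Prod>i<j. ?T i - ?T j) * (\<Prod>i<Suc m. \<Prod>k\<in>K. ?F k - ?T i))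
     = vdet e (interleave f g (Suc m)) ?J * (A * B) * (P * Q K)"
    by (simp add: P_def Q_def A_def B_def mult_ac)
  also have "\<dots> = f m (m, True) * (vdet e (g m # interleave f g m) (?I K) * (P * Q K))"
    unfolding 1 using AB by simp
  also have "\<dots> = f m (m, True) * ((-1)^m * S * vdet ?F ((\<lambda>k. g m (k, False)) # ?gs) K)"
  proof -
    have "vdet e (g m # interleave f g m) (?I K) * (P * Q K) = (\<Sum>k\<in>K. (-1)^m * S * (g m (k, False) / (\<Prod>k'\<in>K - {k}. ?F k' - ?F k) * vdet ?F ?gs (K - {k})))"
      unfolding 2 sum_distrib_right by (rule sum.cong[OF refl tm])
    then show ?thesis by (simp only: vdet.simps sum_distrib_left)
  qed
  also have "\<dots> = (\<Prod>i<Suc m. (-1)^i * f i (i, True)) * vdet ?F (map (\<lambda>i k. g i (k, False)) (rev [0..<Suc m])) K"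
    by (simp add: S_def mult_ac)
  finally show ?case .
qed

section \<open>Comparison with the determinant of a matrix\<close>

abbreviation skip :: "nat \<Rightarrow> nat \<Rightarrow> nat" where "skip j i \<equiv> (if i < j then i else Suc i)"

lemma prod_skip:
  fixes F :: "nat \<Rightarrow> complex"
  assumes "j \<le> n"
  shows "(\<Prod>a<Suc n. F a) = F j * (\<Prod>a<n. F (skip j a))"
  using assms
proof (induction n)
  case (Suc n)
  show ?case
  proof (cases "j = Suc n")
    case True
    then have "(\<Prod>a<Suc n. F (skip j a)) = (\<Prod>a<Suc n. F a)" by (intro prod.cong) auto
    then show ?thesis using True by simp
  next
    case False
    then show ?thesis using Suc by (simp add: mult_ac)
  qed
qed simp

text \<open>The \<open>n - j\<close> factors pairing \<open>j\<close> with a larger index have to be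
  reversed. The resulting sign is that of the cofactor at row \<open>n\<close> and column
  \<open>j\<close>.\<close>

lemma prod_pairs_skip:
  fixes e :: "nat \<Rightarrow> complex"
  assumes "j \<le> n"
  shows "(\<Prod>b<Suc n. \<Prod>a<b. e a - e b) = (-1)^(n + j) * (\<Prod>a<n. e (skip j a) - e j) * (\<Prod>b<n. \<Prod>a<b. e (skip j a) - e (skip j b))"
  using assms
proof (induction n)
  case 0
  then show ?case by simp
next
  case (Suc n)
  show ?case
  proof (cases "j = Suc n")
    case True
    have "(\<Prod>a<Suc n. e (skip j a) - e j) = (\<Prod>a<Suc n. e a - e j)"
      "(\<Prod>b<Suc n. \<Prod>a<b. e (skip j a) - e (skip j b)) = (\<Prod>b<Suc n. \<Prod>a<b. e a - e b)"
      using True by (auto intro!: prod.cong)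
    then show ?thesis using True by (simp add: mult_ac power_add)
  next
    case False
    then have j: "j \<le> n" using Suc.prems by simp
    define d where "d = e (Suc n) - e j"
    have l: "(\<Prod>a<Suc n. e (skip j a) - e j) = (\<Prod>a<n. e (skip j a) - e j) * d"
      using j by (simp add: d_def)
    have r: "(\<Prod>b<Suc n. \<Prod>a<b. e (skip j a) - e (skip j b))
      = (\<Prod>b<n. \<Prod>a<b. e (skip j a) - e (skip j b)) * (\<Prod>a<n. e (skip j a) - e (Suc n))"
      using j by simp
    have "(\<Prod>b<Suc (Suc n). \<Prod>a<b. e a - e b) = (\<Prod>b<Suc n. \<Prod>a<b. e a - e b) * (\<Prod>a<Suc n. e a - e (Suc n))"
      by (rule prod.lessThan_Suc)
    also have "(\<Prod>a<Suc n. e a - e (Suc n)) = (-1) * d * (\<Prod>a<n. e (skip j a) - e (Suc n))"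
      by (subst prod_skip[OF j]) (simp add: d_def)
    finally show ?thesis
      unfolding Suc.IH[OF j] l r add_Suc power_Suc by (simp only: mult_ac)
  qed
qed

text \<open>Laplace expansion along the last row, hence the reversed list of rows. The cofactor
  signs cancel against those of \<open>prod_pairs_skip\<close>.\<close>

lemma det_eq_vdet:
  fixes e :: "nat \<Rightarrow> complex"
  assumes "inj_on e {..<n}"
  shows "Determinant.det (mat n n (\<lambda>(i, j). g i j)) =
     (\<Prod>b<n. \<Prod>a<b. e a - e b) * vdet e (map g (rev [0..<n])) {..<n}"
  using assms
proof (induction n arbitrary: e g)
  case 0
  then show ?case by simp
next
  case (Suc n)
  let ?A = "mat (Suc n) (Suc n) (\<lambda>(i, j). g i j)"
  have "Determinant.det ?A = (\<Sum>j<Suc n. ?A $$ (n, j) * cofactor ?A n j)"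
    by (rule laplace_expansion_row) auto
  also have "\<dots> = (\<Sum>j<Suc n. (\<Prod>b<Suc n. \<Prod>a<b. e a - e b) * (g n j / (\<Prod>c\<in>{..<Suc n} - {j}. e c - e j) * vdet e (map g (rev [0..<n])) ({..<Suc n} - {j})))"
  proof (rule sum.cong[OF refl])
    fix j assume "j \<in> {..<Suc n}"
    then have j: "j \<le> n" by simp
    have im: "{..<Suc n} - {j} = skip j ` {..<n}"
    proof (rule Set.set_eqI)
      fix a show "a \<in> {..<Suc n} - {j} \<longleftrightarrow> a \<in> skip j ` {..<n}"
      proof (cases "a < j")
        case True
        then show ?thesis using j by (auto intro!: image_eqI[of a _ a])
      next
        case False
        then show ?thesis using j by (auto intro!: image_eqI[of a _ "a - 1"])
      qed
    qed
    have isk: "inj_on (skip j) {..<n}" by (auto simp: inj_on_def split: if_splits)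
    have ie: "inj_on (e \<circ> skip j) {..<n}"
      by (rule comp_inj_on[OF isk]) (rule inj_on_subset[OF Suc.prems], auto)
    have md: "mat_delete ?A n j = mat n n (\<lambda>(i, k). (g i \<circ> skip j) k)"
      unfolding mat_delete_def using j by (intro eq_matI) auto
    have nz: "(\<Prod>a<n. e (skip j a) - e j) \<noteq> 0"
    proof -
      have "e (skip j a) - e j \<noteq> 0" if "a < n" for a
        using inj_onD[OF Suc.prems, of "skip j a" j] that j by auto
      then show ?thesis by (simp del: right_minus_eq)
    qed
    have "cofactor ?A n j = (-1)^(n + j) * ((\<Prod>b<n. \<Prod>a<b. e (skip j a) - e (skip j b)) * vdet (e \<circ> skip j) (map (\<lambda>i. g i \<circ> skip j) (rev [0..<n])) {..<n})"
      unfolding Determinant.cofactor_def md Suc.IH[OF ie] by simp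
    also have "vdet (e \<circ> skip j) (map (\<lambda>i. g i \<circ> skip j) (rev [0..<n])) {..<n} = vdet e (map g (rev [0..<n])) ({..<Suc n} - {j})"
      unfolding im vdet_reindex[OF isk] by (simp add: comp_def)
    finally show "?A $$ (n, j) * cofactor ?A n j = (\<Prod>b<Suc n. \<Prod>a<b. e a - e b) * (g n j / (\<Prod>c\<in>{..<Suc n} - {j}. e c - e j) * vdet e (map g (rev [0..<n])) ({..<Suc n} - {j}))"
      unfolding prod_pairs_skip[OF j] im prod.reindex[OF isk] comp_def using j nz by (simp add: mult_ac)
  qed
  also have "\<dots> = (\<Prod>b<Suc n. \<Prod>a<b. e a - e b) * vdet e (map g (rev [0..<Suc n])) {..<Suc n}"
  proof -
    have r: "rev [0..<Suc n] = n # rev [0..<n]" by simp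
    show ?thesis unfolding r list.map vdet.simps by (rule sum_distrib_left[symmetric])
  qed
  finally show ?case .
qed


lemma eta_inverse: "eta (inverse z) = eta z"
  by (simp add: eta_def field_simps)

definition entry :: "complex \<Rightarrow> complex \<Rightarrow> complex \<Rightarrow> complex" where
  "entry q x y = 1 / (br (q * x / y) * br (q * y / x)) - 1 / (br (q * x * y) * br (q / (x * y)))"

text \<open>Over a common denominator the numerator is a function of \<open>x\<close> times a
  function of \<open>y\<close>, so it leaves the determinant as row and column factors.\<close>

lemma entry_eq:
  assumes "q \<noteq> 0" "x \<noteq> 0" "y \<noteq> 0" "eta y \<noteq> eta (q * x)" "eta y \<noteq> eta (x / q)"
  shows "entry q x y = - (br (x^2) * br (y^2)) / ((eta y - eta (q * x)) * (eta y - eta (x / q)))"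
proof -
  have 1: "eta (q * x) - eta y = br (q * x / y) * br (q * x * y)"
    "eta (x / q) - eta y = br (q * y / x) * br (q / (x * y))"
    using assms(1-3) by (simp_all add: eta_def br_def field_simps power2_eq_square)
  have nz: "br (q * x / y) \<noteq> 0" "br (q * x * y) \<noteq> 0" "br (q * y / x) \<noteq> 0" "br (q / (x * y)) \<noteq> 0"
    using 1 assms(4,5) by auto
  have 2: "br (q * x * y) * br (q / (x * y)) - br (q * x / y) * br (q * y / x) = - (br (x^2) * br (y^2))"
    using assms(1-3) by (simp add: br_def field_simps power2_eq_square)
  have "entry q x y = (br (q * x * y) * br (q / (x * y)) - br (q * x / y) * br (q * y / x)) /
     ((br (q * x / y) * br (q * x * y)) * (br (q * y / x) * br (q / (x * y))))"
    using nz by (simp add: entry_def divide_simps)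
  also have "\<dots> = - (br (x^2) * br (y^2)) / ((eta y - eta (q * x)) * (eta y - eta (x / q)))"
    unfolding 1[symmetric] 2 by (simp add: algebra_simps)
  finally show ?thesis .
qed

text \<open>The tag \<open>True\<close> marks the half at \<open>1/x j\<close>. By
  \<open>eta_inverse\<close> these columns have \<open>eta\<close> equal to
  \<open>eta (x j)\<close>, a zero of the row polynomials of every other pair.\<close>

definition rapidity :: "(nat \<Rightarrow> complex) \<Rightarrow> (nat \<Rightarrow> complex) \<Rightarrow> nat \<times> bool \<Rightarrow> complex" where
  "rapidity x y = (\<lambda>(j, s). if s then inverse (x j) else y j)"

text \<open>The two rows of pair \<open>i\<close> are linear polynomials times the same
  \<open>cofactor_poly\<close>. One of them can be replaced by the combination with linear factor
  \<open>\<eta> - eta (x i)\<close>, which vanishes on all columns \<open>1/x j\<close>, and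
  \<open>vdet_interleave\<close> applies.\<close>

lemma overlap_half_inverse_rapidities:
  assumes q: "q \<noteq> 0" and s: "s^2 = br q * br (q^2)" and b: "b \<noteq> 0" and x: "\<And>i. i < n \<Longrightarrow> x i \<noteq> 0"
    and y: "\<And>i. i < n \<Longrightarrow> y i \<noteq> 0"
    and ix: "inj_on (node q x) ({..<n} \<times> UNIV)"
    and iy: "inj_on (\<lambda>p. eta (rapidity x y p)) ({..<n} \<times> UNIV)"
    and xq: "\<And>i. i < n \<Longrightarrow> eta (x i) \<noteq> eta (q * x i)"
  shows "overlap q s b x n (rapidity x y ` ({..<n} \<times> UNIV)) * vandermonde (nodes q x n) * (\<Prod>j<n. \<Prod>i<j. eta (x i) - eta (x j)) =
    norm_const q x n * (\<Prod>i<n. br (b * x i) * br (b / y i)) *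
    (\<Prod>i<n. (-1)^i * ((eta (x i / q) - eta (q * x i)) * cofactor_poly q x n i (eta (x i)))) *
    vdet (\<lambda>k. eta (y k)) (map (\<lambda>i k. \<Prod>l\<in>{..<n} - {i}. (eta (y k) - eta (q * x l)) * (eta (y k) - eta (x l / q))) (rev [0..<n])) {..<n}"
proof -
  let ?I = "{..<n} \<times> (UNIV :: bool set)"
  let ?h = "rapidity x y"
  define e where "e = (\<lambda>p. eta (?h p))"
  have eT: "e (i, True) = eta (x i)" and eF: "e (i, False) = eta (y i)" for i
    by (simp_all add: e_def rapidity_def eta_inverse)
  have iy': "inj_on (eta \<circ> ?h) ?I" using iy by (simp add: comp_def)
  have injh: "inj_on ?h ?I" by (rule inj_on_imageI2[OF iy'])
  have injeta: "inj_on eta (?h ` ?I)" by (rule inj_on_imageI[OF iy'])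
  have I: "?I = {..<n} \<times> {True} \<union> {..<n} \<times> {False}" by (auto simp: UNIV_bool)
  have ne: "e p \<noteq> e p'" if "p \<in> ?I" "p' \<in> ?I" "p \<noteq> p'" for p p'
    using inj_onD[OF iy, of p p'] that by (auto simp: e_def)
  have J: "finite (?h ` ?I)" "0 \<notin> ?h ` ?I" "card (?h ` ?I) = 2 * n"
    using x y injh by (auto simp: rapidity_def card_image split: if_splits)
  define f where "f = (\<lambda>i p. row_poly q x n (i, True) (e p))"
  define g where "g = (\<lambda>i p. (e p - eta (x i)) * cofactor_poly q x n i (e p))"
  \<comment> \<open>Chosen so that \<open>\<eta> - C = \<alpha> i * (\<eta> - B) + \<beta> i *
    (\<eta> - A)\<close> with \<open>A\<close>, \<open>B\<close>, \<open>C\<close> the values of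
    \<open>eta\<close> at \<open>x i\<close>, \<open>q * x i\<close>,
    \<open>x i / q\<close>.\<close>
  define \<beta> where "\<beta> = (\<lambda>i. (eta (x i / q) - eta (q * x i)) / (eta (x i) - eta (q * x i)))"
  define \<alpha> where "\<alpha> = (\<lambda>i. (eta (x i) - eta (x i / q)) / (eta (x i) - eta (q * x i)))"
  have "overlap q s b x n (?h ` ?I) * vandermonde (nodes q x n) =
    norm_const q x n * (\<Prod>c\<in>?h ` ?I. br (b / c)) * vdet eta (map (\<lambda>k z. row_poly q x n k (eta z)) (row_idx n)) (?h ` ?I)"
    by (rule overlap_eq_vdet[OF q s b x ix J injeta])
  also have "(\<Prod>c\<in>?h ` ?I. br (b / c)) = (\<Prod>i<n. br (b * x i) * br (b / y i))"
  proof -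
    have "(\<Prod>c\<in>?h ` ?I. br (b / c)) = (\<Prod>p\<in>?I. br (b / ?h p))" by (simp add: prod.reindex[OF injh])
    also have "\<dots> = (\<Prod>i<n. \<Prod>s\<in>UNIV. br (b / ?h (i, s)))" by (simp add: prod.cartesian_product)
    finally show ?thesis by (simp add: UNIV_bool rapidity_def divide_inverse mult_ac)
  qed
  also have "vdet eta (map (\<lambda>k z. row_poly q x n k (eta z)) (row_idx n)) (?h ` ?I) = vdet e (map (\<lambda>k p. row_poly q x n k (e p)) (row_idx n)) ?I"
    unfolding vdet_reindex[OF injh] by (simp add: comp_def e_def)
  also have "\<dots> = (\<Prod>i<n. \<beta> i) * vdet e (interleave f g n) ?I"
  proof (rule vdet_row_idx)
    fix i assume i: "i < n"
    show "(\<lambda>p. row_poly q x n (i, True) (e p)) = f i" by (simp add: f_def)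
    show "(\<lambda>p. row_poly q x n (i, False) (e p)) = (\<lambda>a. \<alpha> i * f i a + \<beta> i * g i a)"
    proof
      fix p
      define A where "A = eta (x i)"
      define B where "B = eta (q * x i)"
      define C where "C = eta (x i / q)"
      have "A - B \<noteq> 0" using xq[OF i] by (simp add: A_def B_def)
      moreover have "(A - C) / (A - B) * (e p - B) + (C - B) / (A - B) * (e p - A) = (A - B) * (e p - C) / (A - B)"
        unfolding times_divide_eq_left add_divide_distrib[symmetric] by (simp add: algebra_simps)
      ultimately have "e p - C = (A - C) / (A - B) * (e p - B) + (C - B) / (A - B) * (e p - A)"
        by simp
      then have "(e p - C) * cofactor_poly q x n i (e p) = ((A - C) / (A - B) * (e p - B) + (C - B) / (A - B) * (e p - A)) * cofactor_poly q x n i (e p)"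
        by simp
      then show "row_poly q x n (i, False) (e p) = \<alpha> i * f i p + \<beta> i * g i p"
        by (simp add: row_poly_def \<alpha>_def \<beta>_def f_def g_def A_def B_def C_def distrib_right mult.assoc)
    qed
  qed simp
  finally have 1: "overlap q s b x n (?h ` ?I) * vandermonde (nodes q x n) = norm_const q x n * (\<Prod>i<n. br (b * x i) * br (b / y i)) *
     ((\<Prod>i<n. \<beta> i) * vdet e (interleave f g n) ?I)" .
  \<comment> \<open>These cross differences are also the common column factors of the
    \<open>g\<close> rows, so they cancel between the two sides of
    \<open>vdet_interleave\<close>.\<close>
  define Q where "Q = (\<Prod>i<n. \<Prod>k<n. eta (y k) - eta (x i))"
  define P where "P = (\<Prod>j<n. \<Prod>i<j. eta (x i) - eta (x j))"
  define D where "D = vdet (\<lambda>k. eta (y k)) (map (\<lambda>i k. \<Prod>l\<in>{..<n} - {i}. (eta (y k) - eta (q * x l)) * (eta (y k) - eta (x l / q))) (rev [0..<n])) {..<n}"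
  have Q0: "Q \<noteq> 0"
  proof -
    have "eta (y k) \<noteq> eta (x i)" if "i < n" "k < n" for i k
      using ne[of "(k, False)" "(i, True)"] that by (simp add: eT eF)
    then show ?thesis by (simp add: Q_def)
  qed
  have 2: "vdet e (interleave f g n) ?I * (P * Q) = (\<Prod>i<n. (-1)^i * f i (i, True)) *
      vdet (\<lambda>k. e (k, False)) (map (\<lambda>i k. g i (k, False)) (rev [0..<n])) {..<n}"
  proof -
    have c0: "cofactor_poly q x n i (eta (x j)) = 0" if "j < n" "i \<noteq> j" for i j
      unfolding cofactor_poly_def by (rule prod_zero) (use that in auto)
    have gz: "g i (j, True) = 0" if "i < n" "j < n" for i j
      using c0[of j i] that by (cases "i = j") (simp_all add: g_def eT)
    have fz: "f i (j, True) = 0" if "i < n" "j < n" "i \<noteq> j" for i j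
      using c0[of j i] that by (simp add: f_def eT row_poly_def)
    have "vdet e (interleave f g n) ({..<n} \<times> {True} \<union> {..<n} \<times> {False}) *
      ((\<Prod>j<n. \<Prod>i<j. e (i, True) - e (j, True)) * (\<Prod>i<n. \<Prod>k\<in>{..<n}. e (k, False) - e (i, True)))
      = (\<Prod>i<n. (-1)^i * f i (i, True)) * vdet (\<lambda>k. e (k, False)) (map (\<lambda>i k. g i (k, False)) (rev [0..<n])) {..<n}"
    proof (rule vdet_interleave)
      show "e (i, True) \<noteq> e (j, True)" if "i < j" "j < n" for i j
        by (rule ne) (use that in auto)
      show "e (k, False) \<noteq> e (i, True)" if "i < n" "k \<in> {..<n}" for i k
        by (rule ne) (use that in auto)
    qed (use fz gz in auto)
    then show ?thesis by (simp add: I eT eF P_def Q_def)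
  qed
  also have "vdet (\<lambda>k. e (k, False)) (map (\<lambda>i k. g i (k, False)) (rev [0..<n])) {..<n} = Q * D"
  proof -
    have "vdet (\<lambda>k. e (k, False)) (map (\<lambda>i k. g i (k, False)) (rev [0..<n])) {..<n} =
      vdet (\<lambda>k. eta (y k)) (map (\<lambda>i k. (\<Prod>l<n. eta (y k) - eta (x l)) * (\<Prod>l\<in>{..<n} - {i}. (eta (y k) - eta (q * x l)) * (eta (y k) - eta (x l / q)))) (rev [0..<n])) {..<n}"
      unfolding eF
    proof (rule vdet_cong)
      fix i k assume "i \<in> set (rev [0..<n])"
      then have i: "i < n" by simp
      show "g i (k, False) = (\<Prod>l<n. eta (y k) - eta (x l)) * (\<Prod>l\<in>{..<n} - {i}. (eta (y k) - eta (q * x l)) * (eta (y k) - eta (x l / q)))"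
        using i by (simp add: g_def eF cofactor_poly_def prod.remove[of "{..<n}" i] prod.distrib mult_ac)
    qed
    also have "\<dots> = (\<Prod>k<n. \<Prod>l<n. eta (y k) - eta (x l)) * D"
      unfolding D_def by (rule vdet_col_scale) simp
    also have "(\<Prod>k<n. \<Prod>l<n. eta (y k) - eta (x l)) = Q"
      unfolding Q_def by (rule prod.swap)
    finally show ?thesis .
  qed
  finally have 3: "vdet e (interleave f g n) ?I * P = (\<Prod>i<n. (-1)^i * f i (i, True)) * D"
    using Q0 by simp
  have "overlap q s b x n (?h ` ?I) * vandermonde (nodes q x n) * P = norm_const q x n * (\<Prod>i<n. br (b * x i) * br (b / y i)) *
     ((\<Prod>i<n. \<beta> i) * (vdet e (interleave f g n) ?I * P))"
    unfolding 1 by (simp only: mult_ac)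
  also have "\<dots> = norm_const q x n * (\<Prod>i<n. br (b * x i) * br (b / y i)) *
     (((\<Prod>i<n. \<beta> i) * (\<Prod>i<n. (-1)^i * f i (i, True))) * D)"
    unfolding 3 by (simp only: mult_ac)
  \<comment> \<open>The denominator of \<open>\<beta> i\<close> is the linear factor of the diagonal
    entry \<open>f i (i, True)\<close>.\<close>
  also have "(\<Prod>i<n. \<beta> i) * (\<Prod>i<n. (-1)^i * f i (i, True)) = (\<Prod>i<n. (-1)^i * ((eta (x i / q) - eta (q * x i)) * cofactor_poly q x n i (eta (x i))))"
    unfolding prod.distrib[symmetric]
    by (intro prod.cong refl) (use xq in \<open>simp add: \<beta>_def f_def eT row_poly_def\<close>)
  finally show ?thesis by (simp add: P_def D_def mult_ac)
qed

definition shifted_prod :: "complex \<Rightarrow> (nat \<Rightarrow> complex) \<Rightarrow> nat \<Rightarrow> complex \<Rightarrow> complex" where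
  "shifted_prod q x n \<eta> = (\<Prod>l<n. (\<eta> - eta (q * x l)) * (\<eta> - eta (x l / q)))"

text \<open>Dividing column \<open>k\<close> of the determinant of size \<open>n\<close> by the full
  product \<open>shifted_prod\<close> leaves the inverse denominators of \<open>entry_eq\<close>,
  which are Tsuchiya's entries up to row and column factors.\<close>

lemma overlap_eq_det:
  assumes q: "q \<noteq> 0" and s: "s^2 = br q * br (q^2)" and b: "b \<noteq> 0" and x: "\<And>i. i < n \<Longrightarrow> x i \<noteq> 0"
    and y: "\<And>i. i < n \<Longrightarrow> y i \<noteq> 0"
    and ix: "inj_on (node q x) ({..<n} \<times> UNIV)"
    and iy: "inj_on (\<lambda>p. eta (rapidity x y p)) ({..<n} \<times> UNIV)"
    and xq: "\<And>i. i < n \<Longrightarrow> eta (x i) \<noteq> eta (q * x i)"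
    and yx: "\<And>i k. i < n \<Longrightarrow> k < n \<Longrightarrow> eta (y k) \<noteq> eta (q * x i) \<and> eta (y k) \<noteq> eta (x i / q)"
    and sq: "\<And>i. i < n \<Longrightarrow> br ((x i)^2) \<noteq> 0 \<and> br ((y i)^2) \<noteq> 0"
  shows "overlap q s b x n (rapidity x y ` ({..<n} \<times> UNIV)) * vandermonde (nodes q x n) *
      (\<Prod>j<n. \<Prod>i<j. eta (x i) - eta (x j)) * (\<Prod>j<n. \<Prod>i<j. eta (y i) - eta (y j)) =
    norm_const q x n * (\<Prod>i<n. br (b * x i) * br (b / y i)) *
    (\<Prod>i<n. (-1)^i * ((eta (x i / q) - eta (q * x i)) * cofactor_poly q x n i (eta (x i)))) *
    (\<Prod>i<n. - 1 / br ((x i)^2)) * (\<Prod>k<n. shifted_prod q x n (eta (y k)) / br ((y k)^2)) *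
    Determinant.det (mat n n (\<lambda>(i, k). entry q (x i) (y k)))"
proof -
  let ?r = "\<lambda>i. - 1 / br ((x i)^2)" and ?c = "\<lambda>k. shifted_prod q x n (eta (y k)) / br ((y k)^2)"
  let ?e = "\<lambda>k. eta (y k)"
  have "inj_on ?e {..<n}"
  proof (rule inj_onI)
    fix i k assume "i \<in> {..<n}" "k \<in> {..<n}" "?e i = ?e k"
    then have "(i, False) = (k, False)" by (intro inj_onD[OF iy]) (simp_all add: rapidity_def)
    then show "i = k" by simp
  qed
  note det = det_eq_vdet[OF this, of "\<lambda>i k. entry q (x i) (y k)"]
  have "vdet ?e (map (\<lambda>i k. \<Prod>l\<in>{..<n} - {i}. (eta (y k) - eta (q * x l)) * (eta (y k) - eta (x l / q))) (rev [0..<n])) {..<n}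
    = vdet ?e (map (\<lambda>i k. ?c k * (?r i * entry q (x i) (y k))) (rev [0..<n])) {..<n}"
  proof (rule vdet_cong)
    fix i k assume "i \<in> set (rev [0..<n])" "k \<in> {..<n}"
    then have i: "i < n" and k: "k < n" by simp_all
    define A where "A = (eta (y k) - eta (q * x i)) * (eta (y k) - eta (x i / q))"
    have A0: "A \<noteq> 0" using yx[OF i k] by (simp add: A_def)
    have "entry q (x i) (y k) = - (br ((x i)^2) * br ((y k)^2)) / A"
      unfolding A_def by (rule entry_eq) (use q x[OF i] y[OF k] yx[OF i k] in auto)
    moreover have "shifted_prod q x n (eta (y k)) = A * (\<Prod>l\<in>{..<n} - {i}. (eta (y k) - eta (q * x l)) * (eta (y k) - eta (x l / q)))"
      using i by (simp add: shifted_prod_def A_def prod.remove[of "{..<n}" i])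
    ultimately show "(\<Prod>l\<in>{..<n} - {i}. (eta (y k) - eta (q * x l)) * (eta (y k) - eta (x l / q))) = ?c k * (?r i * entry q (x i) (y k))"
      using A0 sq[OF i] sq[OF k] by simp
  qed
  also have "\<dots> = (\<Prod>k<n. ?c k) * ((\<Prod>i<n. ?r i) * vdet ?e (map (\<lambda>i k. entry q (x i) (y k)) (rev [0..<n])) {..<n})"
  proof -
    have "(\<Prod>i\<leftarrow>rev [0..<n]. ?r i) = (\<Prod>i<n. ?r i)"
      by (subst prod.distinct_set_conv_list[symmetric]) (auto intro!: prod.cong)
    then show ?thesis
      unfolding vdet_col_scale[OF finite_lessThan, where r = ?c and F = "\<lambda>i k. ?r i * entry q (x i) (y k)"]
        vdet_row_scale[where r = ?r and F = "\<lambda>i k. entry q (x i) (y k)"] by simp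
  qed
  finally have e: "vdet ?e (map (\<lambda>i k. \<Prod>l\<in>{..<n} - {i}. (eta (y k) - eta (q * x l)) * (eta (y k) - eta (x l / q))) (rev [0..<n])) {..<n}
    = (\<Prod>k<n. ?c k) * ((\<Prod>i<n. ?r i) * vdet ?e (map (\<lambda>i k. entry q (x i) (y k)) (rev [0..<n])) {..<n})" .
  have "overlap q s b x n (rapidity x y ` ({..<n} \<times> UNIV)) * vandermonde (nodes q x n) * (\<Prod>j<n. \<Prod>i<j. eta (x i) - eta (x j)) =
    norm_const q x n * (\<Prod>i<n. br (b * x i) * br (b / y i)) *
    (\<Prod>i<n. (-1)^i * ((eta (x i / q) - eta (q * x i)) * cofactor_poly q x n i (eta (x i)))) *
    ((\<Prod>k<n. ?c k) * ((\<Prod>i<n. ?r i) * vdet ?e (map (\<lambda>i k. entry q (x i) (y k)) (rev [0..<n])) {..<n}))"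
    unfolding e[symmetric] by (rule overlap_half_inverse_rapidities[OF q s b x y ix iy xq])
  then show ?thesis
    unfolding det by (simp only: mult_ac)
qed


subsection \<open>The limit of coinciding parameters\<close>

lemma isCont_det:
  fixes A :: "complex \<Rightarrow> nat \<Rightarrow> nat \<Rightarrow> complex"
  assumes "\<And>i j. i < n \<Longrightarrow> j < n \<Longrightarrow> isCont (\<lambda>t. A t i j) t"
  shows "isCont (\<lambda>t. Determinant.det (mat n n (\<lambda>(i, j). A t i j))) t"
proof -
  have pn: "p i < n" if "p permutes {0..<n}" "i \<in> {0..<n}" for p i
    using permutes_in_image[OF that(1), of i] that(2) by simp
  have "Determinant.det (mat n n (\<lambda>(i, j). A t i j)) =
     (\<Sum>p | p permutes {0..<n}. signof p * (\<Prod>i = 0..<n. A t i (p i)))" for t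
    unfolding Determinant.det_def using pn by (auto intro!: sum.cong prod.cong)
  then show ?thesis
    using assms pn by (auto intro!: continuous_intros)
qed

lemma eventually_eta_ne: "c \<noteq> 0 \<Longrightarrow> d \<noteq> 0 \<Longrightarrow> eventually (\<lambda>t. eta (c * t) \<noteq> eta d) (at (1 :: complex))"
proof -
  assume cd: "c \<noteq> 0" "d \<noteq> 0"
  have "eventually (\<lambda>t. br (c / d * t) \<noteq> 0 \<and> br (c * d * t) \<noteq> 0 \<and> t \<noteq> 0) (at (1 :: complex))"
    using cd by (intro eventually_conj eventually_br_nz eventually_neq_at_within) auto
  then show ?thesis
  proof eventually_elim
    case (elim t)
    then have "eta (c * t) - eta d \<noteq> 0" using cd by (simp add: eta_diff mult_ac)
    then show ?case by simp
  qed
qed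

section \<open>Comparison of the prefactors\<close>

definition bracket4 :: "complex \<Rightarrow> complex \<Rightarrow> complex \<Rightarrow> complex" where
  "bracket4 q x y = br (q * x / y) * br (q * y / x) * br (q * x * y) * br (q / (x * y))"

text \<open>Identifies the factors of Tsuchiya's numerator product with the denominators of
  \<open>entry_eq\<close>.\<close>

lemma bracket4_eta: "q \<noteq> 0 \<Longrightarrow> x \<noteq> 0 \<Longrightarrow> y \<noteq> 0 \<Longrightarrow> (eta y - eta (q * x)) * (eta y - eta (x / q)) = bracket4 q x y"
proof -
  assume "q \<noteq> 0" "x \<noteq> 0" "y \<noteq> 0"
  then have "eta y - eta (q * x) = - (br (q * x / y) * br (q * x * y))"
    "eta y - eta (x / q) = - (br (q * y / x) * br (q / (x * y)))"
    by (simp_all add: eta_def br_def field_simps power2_eq_square)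
  then show ?thesis by (simp add: bracket4_def mult_ac)
qed

lemma bracket4_sym: "bracket4 q x y = bracket4 q y x"
  by (simp add: bracket4_def mult_ac)

lemma prod_offdiag: "(\<Prod>i<n. \<Prod>k\<in>{..<n} - {i}. F i k) = (\<Prod>j<n. \<Prod>i<j. F i j * F j i)" for F :: "nat \<Rightarrow> nat \<Rightarrow> complex"
proof (induction n)
  case (Suc n)
  have i: "{..<Suc n} - {i} = insert n ({..<n} - {i})" if "i < n" for i using that by auto
  have "(\<Prod>i<n. \<Prod>k\<in>{..<Suc n} - {i}. F i k) = (\<Prod>i<n. F i n * (\<Prod>k\<in>{..<n} - {i}. F i k))"
    by (intro prod.cong refl) (simp add: i)
  moreover have "{..<Suc n} - {n} = {..<n}" by auto
  ultimately show ?case using Suc by (simp add: prod.distrib mult_ac)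
qed simp

lemma prod_inhom: "(\<Prod>k<2 * n. h (inhom x k)) = (\<Prod>i<n. h (x i) * h (inverse (x i)))" for h :: "complex \<Rightarrow> complex"
  by (induction n) (simp_all add: inhom_even inhom_odd mult.assoc)

text \<open>The two sites of one \<open>x i\<close> give \<open>[q x_i^2]\<close>; the four pairs of
  sites from two different \<open>x i\<close> give one \<open>bracket4\<close>.\<close>

lemma prod_inhom_pairs:
  assumes "\<And>i. i < n \<Longrightarrow> x i \<noteq> 0"
  shows "(\<Prod>j<2 * n. \<Prod>i<j. br (q * inhom x i / inhom x j)) =
    (\<Prod>i<n. br (q * (x i)^2)) * (\<Prod>j<n. \<Prod>i<j. bracket4 q (x i) (x j))"
  using assms
proof (induction n)
  case (Suc n)
  have "(\<Prod>j<2 * Suc n. \<Prod>i<j. br (q * inhom x i / inhom x j)) =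
     (\<Prod>j<2 * n. \<Prod>i<j. br (q * inhom x i / inhom x j)) * (\<Prod>i<2 * n. br (q * inhom x i / x n)) *
     ((\<Prod>i<2 * n. br (q * inhom x i / inverse (x n))) * br (q * x n / inverse (x n)))"
    by (simp add: inhom_even inhom_odd)
  also have "(\<Prod>i<2 * n. br (q * inhom x i / x n)) = (\<Prod>i<n. br (q * x i / x n) * br (q * inverse (x i) / x n))"
    by (rule prod_inhom)
  also have "(\<Prod>i<2 * n. br (q * inhom x i / inverse (x n))) = (\<Prod>i<n. br (q * x i / inverse (x n)) * br (q * inverse (x i) / inverse (x n)))"
    by (rule prod_inhom)
  also have "br (q * x n / inverse (x n)) = br (q * (x n)^2)"
    by (simp add: divide_inverse power2_eq_square mult_ac)
  finally have "(\<Prod>j<2 * Suc n. \<Prod>i<j. br (q * inhom x i / inhom x j)) =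
     (\<Prod>j<2 * n. \<Prod>i<j. br (q * inhom x i / inhom x j)) * br (q * (x n)^2) *
     (\<Prod>i<n. br (q * x i / x n) * br (q * inverse (x i) / x n) * (br (q * x i / inverse (x n)) * br (q * inverse (x i) / inverse (x n))))"
    by (simp add: prod.distrib mult_ac)
  also have "(\<Prod>i<n. br (q * x i / x n) * br (q * inverse (x i) / x n) * (br (q * x i / inverse (x n)) * br (q * inverse (x i) / inverse (x n))))
     = (\<Prod>i<n. bracket4 q (x i) (x n))"
    by (intro prod.cong refl) (simp add: bracket4_def divide_inverse mult_ac)
  also have "(\<Prod>j<2 * n. \<Prod>i<j. br (q * inhom x i / inhom x j)) = (\<Prod>i<n. br (q * (x i)^2)) * (\<Prod>j<n. \<Prod>i<j. bracket4 q (x i) (x j))"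
    by (rule Suc.IH) (use Suc.prems in simp)
  finally show ?case by (simp add: mult_ac)
qed simp

text \<open>The four differences between the nodes of two pairs consist of eight brackets: the four
  of \<open>bracket4\<close>, and twice the two of an \<open>eta\<close> difference. The signs
  cancel.\<close>

lemma vandermonde_nodes:
  assumes q: "q \<noteq> 0" and x: "\<And>i. i < n \<Longrightarrow> x i \<noteq> 0"
  shows "vandermonde (nodes q x n) = (\<Prod>i<n. node_d q (x i) - node_a q (x i)) *
    ((\<Prod>j<n. \<Prod>i<j. bracket4 q (x i) (x j)) * (\<Prod>j<n. \<Prod>i<j. (eta (x i) - eta (x j))^2))"
  using x
proof (induction n)
  case (Suc n)
  have l: "(\<Prod>\<eta>\<leftarrow>nodes q x n. u - \<eta>) = (\<Prod>i<n. (u - node_d q (x i)) * (u - node_a q (x i)))" for u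
    by (induction n) (simp_all add: mult_ac)
  have "vandermonde (nodes q x (Suc n)) = (node_d q (x n) - node_a q (x n)) * vandermonde (nodes q x n) *
     (\<Prod>i<n. (node_d q (x n) - node_d q (x i)) * (node_d q (x n) - node_a q (x i)) * ((node_a q (x n) - node_d q (x i)) * (node_a q (x n) - node_a q (x i))))"
    by (simp add: l prod.distrib mult_ac)
  also have "(\<Prod>i<n. (node_d q (x n) - node_d q (x i)) * (node_d q (x n) - node_a q (x i)) * ((node_a q (x n) - node_d q (x i)) * (node_a q (x n) - node_a q (x i))))
     = (\<Prod>i<n. bracket4 q (x i) (x n) * (eta (x i) - eta (x n))^2)"
  proof (intro prod.cong refl)
    fix i assume "i \<in> {..<n}"
    then have X: "x i \<noteq> 0" "x n \<noteq> 0" using Suc.prems by auto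
    define A where "A = br (q * x i / x n)"
    define B where "B = br (q * x n / x i)"
    define C where "C = br (q * x i * x n)"
    define D where "D = br (q / (x i * x n))"
    define E where "E = br (x i / x n)"
    define G where "G = br (x i * x n)"
    have "node_d q (x n) - node_d q (x i) = D * E" "node_d q (x n) - node_a q (x i) = - (G * A)"
      "node_a q (x n) - node_d q (x i) = G * B" "node_a q (x n) - node_a q (x i) = - (C * E)" "eta (x i) - eta (x n) = E * G"
      "bracket4 q (x i) (x n) = A * B * C * D"
      using q X by (simp_all add: A_def B_def C_def D_def E_def G_def bracket4_def eta_def node_a_def node_d_def br_def field_simps power2_eq_square)
    then show "(node_d q (x n) - node_d q (x i)) * (node_d q (x n) - node_a q (x i)) * ((node_a q (x n) - node_d q (x i)) * (node_a q (x n) - node_a q (x i)))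
      = bracket4 q (x i) (x n) * (eta (x i) - eta (x n))^2"
      by (simp add: power2_eq_square mult_ac)
  qed
  finally show ?case using Suc by (simp add: prod.distrib mult_ac)
qed simp

text \<open>Everything except the determinant. Factors with two indices are products of
  \<open>BB\<close>, \<open>PP\<close> and \<open>QQ\<close> on both sides; those with one index are
  compared termwise in \<open>S\<close>.\<close>

lemma prefactors_agree:
  assumes q: "q \<noteq> 0" and x: "\<And>i. i < n \<Longrightarrow> x i \<noteq> 0"
    and ne: "\<And>i j. i < j \<Longrightarrow> j < n \<Longrightarrow> eta (x i) \<noteq> eta (x j)"
    and sq: "\<And>i. i < n \<Longrightarrow> br ((x i)^2) \<noteq> 0"
  shows "norm_const q x n * (\<Prod>i<n. br (b * x i) * br (b / x i)) *
      (\<Prod>i<n. (-1)^i * ((eta (x i / q) - eta (q * x i)) * cofactor_poly q x n i (eta (x i)))) *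
      (\<Prod>i<n. - 1 / br ((x i)^2)) * (\<Prod>k<n. shifted_prod q x n (eta (x k)) / br ((x k)^2))
    = br q ^ n * (\<Prod>i<n. br (b * x i)) * (\<Prod>j<2 * n. \<Prod>i<j. br (q * inhom x i / inhom x j)) *
      ((br (q^2) ^ n * (\<Prod>i<n. br (b / x i) * br (q^2 * (x i)^2)) *
      (\<Prod>i<n. \<Prod>j<n. br (q * x i / x j) * br (q * x j / x i) *
                      br (q * x i * x j) * br (q / (x i * x j))))
     / ((\<Prod>j<n. \<Prod>i<j. br (x j / x i) * br (x i / x j)) *
        (\<Prod>j<n. \<Prod>i\<le>j. br (1 / (x i * x j)) * br (x i * x j)))) *
      vandermonde (nodes q x n) * (\<Prod>j<n. \<Prod>i<j. eta (x i) - eta (x j)) * (\<Prod>j<n. \<Prod>i<j. eta (x i) - eta (x j))"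
proof -
  define BB where "BB = (\<Prod>j<n. \<Prod>i<j. (eta (x i) - eta (x j))^2)"
  define PP where "PP = (\<Prod>j<n. \<Prod>i<j. bracket4 q (x i) (x j))"
  define QQ where "QQ = (\<Prod>k<n. shifted_prod q x n (eta (x k)))"
  define H where "H = (\<Prod>i<n. eta (x i / q) - eta (q * x i))"
  define D1 where "D1 = (\<Prod>i<n. br (1 / (x i * x i)) * br (x i * x i))"
  define V1 where "V1 = (\<Prod>i<n. node_d q (x i) - node_a q (x i))"
  have BB0: "BB \<noteq> 0" using ne by (auto simp: BB_def)
  have P: "(\<Prod>j<n. \<Prod>i<j. eta (x i) - eta (x j)) * (\<Prod>j<n. \<Prod>i<j. eta (x i) - eta (x j)) = BB"
    by (simp add: BB_def power2_eq_square prod.distrib)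
  have V: "vandermonde (nodes q x n) = V1 * (PP * BB)"
    using vandermonde_nodes[OF q x] by (simp add: V1_def PP_def BB_def)
  have W: "(\<Prod>j<2 * n. \<Prod>i<j. br (q * inhom x i / inhom x j)) = (\<Prod>i<n. br (q * (x i)^2)) * PP"
    using prod_inhom_pairs[OF x] by (simp add: PP_def)
  have N: "(\<Prod>i<n. \<Prod>j<n. br (q * x i / x j) * br (q * x j / x i) * br (q * x i * x j) * br (q / (x i * x j))) = QQ"
  proof -
    have "QQ = (\<Prod>k<n. \<Prod>l<n. bracket4 q (x l) (x k))"
      unfolding QQ_def shifted_prod_def using q x by (intro prod.cong refl) (simp add: bracket4_eta)
    also have "\<dots> = (\<Prod>i<n. \<Prod>j<n. bracket4 q (x i) (x j))" by (rule prod.swap)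
    finally show ?thesis by (simp add: bracket4_def)
  qed
  have D: "(\<Prod>j<n. \<Prod>i<j. br (x j / x i) * br (x i / x j)) * (\<Prod>j<n. \<Prod>i\<le>j. br (1 / (x i * x j)) * br (x i * x j)) = D1 * BB"
  proof -
    have "(\<Prod>j<n. \<Prod>i<j. br (x j / x i) * br (x i / x j)) * (\<Prod>j<n. \<Prod>i<j. br (1 / (x i * x j)) * br (x i * x j)) = BB"
      unfolding BB_def prod.distrib[symmetric]
    proof (intro prod.cong refl)
      fix i j assume "j \<in> {..<n}" "i \<in> {..<j}"
      then have X: "x i \<noteq> 0" "x j \<noteq> 0" using x[of i] x[of j] by auto
      then have "br (x j / x i) = - br (x i / x j)" "br (1 / (x i * x j)) = - br (x i * x j)"
        by (simp_all add: br_def field_simps)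
      then show "br (x j / x i) * br (x i / x j) * (br (1 / (x i * x j)) * br (x i * x j)) = (eta (x i) - eta (x j))^2"
        using X by (simp add: eta_diff power2_eq_square mult_ac)
    qed
    then show ?thesis
      by (simp add: D1_def prod.distrib mult_ac flip: lessThan_Suc_atMost)
  qed
  have C: "(\<Prod>i<n. (-1)^i * ((eta (x i / q) - eta (q * x i)) * cofactor_poly q x n i (eta (x i)))) = H * (BB * (PP * PP))"
  proof -
    have "(\<Prod>i<n. cofactor_poly q x n i (eta (x i))) = (\<Prod>j<n. \<Prod>i<j. (eta (x i) - eta (x j)) * (eta (x i) - eta (q * x j)) * (eta (x i) - eta (x j / q)) *
      ((eta (x j) - eta (x i)) * (eta (x j) - eta (q * x i)) * (eta (x j) - eta (x i / q))))"
      unfolding cofactor_poly_def by (rule prod_offdiag)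
    also have "\<dots> = (\<Prod>j<n. \<Prod>i<j. (-1) * ((eta (x i) - eta (x j))^2 * (bracket4 q (x i) (x j) * bracket4 q (x i) (x j))))"
    proof (intro prod.cong refl)
      fix i j assume "j \<in> {..<n}" "i \<in> {..<j}"
      then have X: "x i \<noteq> 0" "x j \<noteq> 0" using x[of i] x[of j] by auto
      define d where "d = eta (x i) - eta (x j)"
      have d': "eta (x j) - eta (x i) = - d" by (simp add: d_def)
      have "d * (eta (x i) - eta (q * x j)) * (eta (x i) - eta (x j / q)) * ((- d) * (eta (x j) - eta (q * x i)) * (eta (x j) - eta (x i / q)))
        = - (d^2 * (((eta (x i) - eta (q * x j)) * (eta (x i) - eta (x j / q))) * ((eta (x j) - eta (q * x i)) * (eta (x j) - eta (x i / q)))))"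
        by (simp add: power2_eq_square mult_ac)
      also have "\<dots> = (-1) * (d^2 * (bracket4 q (x i) (x j) * bracket4 q (x i) (x j)))"
        unfolding bracket4_eta[OF q X] bracket4_eta[OF q X(2,1)] bracket4_sym[of q "x j" "x i"] by simp
      finally show "(eta (x i) - eta (x j)) * (eta (x i) - eta (q * x j)) * (eta (x i) - eta (x j / q)) *
        ((eta (x j) - eta (x i)) * (eta (x j) - eta (q * x i)) * (eta (x j) - eta (x i / q)))
        = (-1) * ((eta (x i) - eta (x j))^2 * (bracket4 q (x i) (x j) * bracket4 q (x i) (x j)))"
        unfolding d_def[symmetric] d' .
    qed
    also have "\<dots> = (\<Prod>j<n. (-1)^j) * (BB * (PP * PP))"
      by (simp only: prod.distrib BB_def PP_def prod_constant card_lessThan)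
    finally have c: "(\<Prod>i<n. cofactor_poly q x n i (eta (x i))) = (\<Prod>j<n. (-1)^j) * (BB * (PP * PP))" .
    \<comment> \<open>Each pair \<open>i < j\<close> of cofactors gives one sign; together they
      cancel the signs \<open>(-1)^i\<close> left by \<open>vdet_interleave\<close>.\<close>
    have "(\<Prod>j<n. (-1)^j) * (\<Prod>j<n. (-1)^j) = (1 :: complex)"
      by (simp add: prod.distrib[symmetric] power_add[symmetric])
    then show ?thesis
      unfolding prod.distrib c H_def by (simp add: mult_ac)
  qed
  have S: "norm_const q x n * H * (\<Prod>i<n. - 1 / br ((x i)^2)) * (\<Prod>i<n. 1 / br ((x i)^2)) =
     br q ^ n * (\<Prod>i<n. br (q * (x i)^2)) * br (q^2) ^ n * (\<Prod>i<n. br (q^2 * (x i)^2)) * V1 / D1"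
  proof -
    have "br q ^ n = (\<Prod>i<n. br q)" "br (q^2) ^ n = (\<Prod>i<n. br (q^2))" by simp_all
    then show ?thesis
      unfolding norm_const_def H_def V1_def D1_def
    proof (simp only: prod.distrib[symmetric] prod_dividef[symmetric], intro prod.cong refl)
      fix i assume "i \<in> {..<n}"
      then have X: "x i \<noteq> 0" "br ((x i)^2) \<noteq> 0" using x sq by auto
      have e: "eta (x i / q) - eta (q * x i) = - (br (q^2) * br ((x i)^2))" "node_d q (x i) - node_a q (x i) = - (br q * br ((x i)^2))"
        "br (1 / (x i * x i)) = - br ((x i)^2)" "br (x i * x i) = br ((x i)^2)"
        using q X(1) by (simp_all add: eta_def node_a_def node_d_def br_def field_simps power2_eq_square)
      show "(br q)\<^sup>2 * br (q * (x i)\<^sup>2) * br (q\<^sup>2 * (x i)\<^sup>2) * (eta (x i / q) - eta (q * x i)) * (- 1 / br ((x i)\<^sup>2)) * (1 / br ((x i)\<^sup>2)) =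
         br q * br (q * (x i)\<^sup>2) * br (q\<^sup>2) * br (q\<^sup>2 * (x i)\<^sup>2) * (node_d q (x i) - node_a q (x i)) / (br (1 / (x i * x i)) * br (x i * x i))"
        unfolding e using X(2) by (simp add: power2_eq_square)
    qed
  qed
  have Q: "(\<Prod>k<n. shifted_prod q x n (eta (x k)) / br ((x k)^2)) = QQ * (\<Prod>i<n. 1 / br ((x i)^2))"
    by (simp add: QQ_def prod.distrib[symmetric])
  have "norm_const q x n * (\<Prod>i<n. br (b * x i) * br (b / x i)) * (H * (BB * (PP * PP))) *
      (\<Prod>i<n. - 1 / br ((x i)^2)) * (QQ * (\<Prod>i<n. 1 / br ((x i)^2)))
    = (norm_const q x n * H * (\<Prod>i<n. - 1 / br ((x i)^2)) * (\<Prod>i<n. 1 / br ((x i)^2))) *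
      ((\<Prod>i<n. br (b * x i)) * (\<Prod>i<n. br (b / x i)) * BB * PP * PP * QQ)"
    by (simp only: prod.distrib mult_ac)
  also have "\<dots> = br q ^ n * (\<Prod>i<n. br (b * x i)) * ((\<Prod>i<n. br (q * (x i)^2)) * PP) *
      ((br (q^2) ^ n * ((\<Prod>i<n. br (b / x i)) * (\<Prod>i<n. br (q^2 * (x i)^2))) * QQ) / (D1 * BB)) * (V1 * (PP * BB)) * BB"
    unfolding S using BB0 by (simp add: mult_ac)
  finally show ?thesis
    unfolding C Q W N D V mult.assoc[of _ "\<Prod>j<n. \<Prod>i<j. eta (x i) - eta (x j)" "\<Prod>j<n. \<Prod>i<j. eta (x i) - eta (x j)"] P
    by (simp only: prod.distrib)
qed


section \<open>Return to \<open>Xi_D\<close> at coinciding parameters\<close>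

lemma rapidity_image: "rapidity x x ` ({..<n} \<times> UNIV) = inhom x ` {..<2 * n}"
proof -
  have "inhom x ` {..<2 * n} = x ` {..<n} \<union> (\<lambda>i. inverse (x i)) ` {..<n}"
    by (induction n) (auto simp: lessThan_Suc inhom_even inhom_odd)
  moreover have "rapidity x x ` ({..<n} \<times> UNIV) = x ` {..<n} \<union> (\<lambda>i. inverse (x i)) ` {..<n}"
    by (force simp: rapidity_def image_def UNIV_bool)
  ultimately show ?thesis by simp
qed

lemma br_one: "br 1 = 0"
  by (simp add: br_def)

lemma inj_on_rapidity:
  assumes x: "\<And>i. i < n \<Longrightarrow> x i \<noteq> 0"
    and d: "\<And>i j. i < n \<Longrightarrow> j < n \<Longrightarrow> i \<noteq> j \<Longrightarrow> br (x i / x j) \<noteq> 0"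
    and m: "\<And>i j. i < n \<Longrightarrow> j < n \<Longrightarrow> br (x i * x j) \<noteq> 0"
  shows "inj_on (rapidity x x) ({..<n} \<times> UNIV)" "generic_set (rapidity x x ` ({..<n} \<times> UNIV))"
proof -
  let ?h = "rapidity x x"
  have br: "br (?h (i, s) / ?h (j, s')) \<noteq> 0" if "i < n" "j < n" "(i, s) \<noteq> (j, s')" for i j s s'
  proof (cases "s = s'")
    case True
    then have "i \<noteq> j" using that by simp
    then show ?thesis using d[of i j] d[of j i] that x True by (cases s') (simp_all add: rapidity_def divide_inverse mult_ac)
  next
    case False
    have "br (inverse (x i) / x j) = - br (x i * x j)" using x that by (simp add: br_def field_simps)
    then show ?thesis using False m[of i j] that by (cases s; cases s') (simp_all add: rapidity_def divide_inverse mult_ac)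
  qed
  have nz: "?h (i, s) \<noteq> 0" if "i < n" for i s using x[OF that] by (simp add: rapidity_def)
  show inj: "inj_on ?h ({..<n} \<times> UNIV)"
  proof (rule inj_onI)
    fix p p' assume p: "p \<in> {..<n} \<times> UNIV" "p' \<in> {..<n} \<times> UNIV" and e: "?h p = ?h p'"
    obtain i s j s' where pp: "p = (i, s)" "p' = (j, s')" by (cases p; cases p')
    have "?h p / ?h p' = 1" using e nz p pp by auto
    then have "br (?h (i, s) / ?h (j, s')) = 0" by (simp add: pp br_one)
    then show "p = p'" using br[of i j s s'] p pp by auto
  qed
  show "generic_set (?h ` ({..<n} \<times> UNIV))"
    unfolding generic_set_def
  proof (intro conjI ballI impI)
    show "0 \<notin> ?h ` ({..<n} \<times> UNIV)" using nz by force
    fix a c assume "a \<in> ?h ` ({..<n} \<times> UNIV)" "c \<in> ?h ` ({..<n} \<times> UNIV)" "a \<noteq> c"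
    then obtain p p' where p: "a = ?h p" "c = ?h p'" "p \<in> {..<n} \<times> UNIV" "p' \<in> {..<n} \<times> UNIV" "p \<noteq> p'" by blast
    then show "br (a / c) \<noteq> 0"
      using br[of "fst p" "fst p'" "snd p" "snd p'"] by (cases p; cases p') simp
  qed simp
qed

lemma Xi_D_eq_overlap:
  assumes q: "q \<noteq> 0" and s: "s^2 = br q * br (q^2)" and x: "\<And>i. i < n \<Longrightarrow> x i \<noteq> 0"
    and inj: "inj_on (rapidity x x) ({..<n} \<times> UNIV)" and gen: "generic_set (rapidity x x ` ({..<n} \<times> UNIV))"
  shows "Xi_D q s n x b = overlap q s b x n (rapidity x x ` ({..<n} \<times> UNIV))"
proof -
  let ?zs = "map (inhom x) [0..<2 * n]"
  have set: "set ?zs = rapidity x x ` ({..<n} \<times> UNIV)"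
    by (simp add: rapidity_image atLeast0LessThan)
  have "card (set ?zs) = length ?zs"
    unfolding set by (simp add: card_image[OF inj])
  then have "distinct ?zs" by (rule card_distinct)
  have "Xi_D q s n x b = pairing (2 * n) (chi q b n x) (B_product q s (inhom x) (2 * n) ?zs)"
    unfolding Xi_D_def pairing_def by (intro sum.cong refl) (simp add: psi_D_eq_B_product)
  also have "\<dots> = overlap q s b x n (set ?zs)"
    by (rule overlap_eq_B_product[symmetric, OF q s x \<open>distinct ?zs\<close>]) (simp_all only: set gen)
  finally show ?thesis by (simp only: set)
qed

text \<open>For \<open>y = x\<close> the rapidities \<open>x i\<close> and \<open>1/x i\<close>
  share the same \<open>eta\<close>, so \<open>overlap_eq_det\<close> does not apply directly. With
  \<open>y k = x k * t\<close> both of its sides are continuous at \<open>t = 1\<close>, and its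
  hypotheses hold for \<open>t\<close> near 1 and different from 1.\<close>

lemma Xi_D_limit:
  assumes q: "q \<noteq> 0" and s: "s^2 = br q * br (q^2)" and b: "b \<noteq> 0" and x: "\<And>i. i < n \<Longrightarrow> x i \<noteq> 0"
    and d: "\<And>i j. i < n \<Longrightarrow> j < n \<Longrightarrow> i \<noteq> j \<Longrightarrow> br (x i / x j) \<noteq> 0"
    and qd: "\<And>i j. i < n \<Longrightarrow> j < n \<Longrightarrow> br (q * x i / x j) \<noteq> 0"
    and m: "\<And>i j. i < n \<Longrightarrow> j < n \<Longrightarrow> br (x i * x j) \<noteq> 0"
    and qm: "\<And>i j. i < n \<Longrightarrow> j < n \<Longrightarrow> br (q * x i * x j) \<noteq> 0 \<and> br (q / (x i * x j)) \<noteq> 0"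
  shows "Xi_D q s n x b * vandermonde (nodes q x n) *
      (\<Prod>j<n. \<Prod>i<j. eta (x i) - eta (x j)) * (\<Prod>j<n. \<Prod>i<j. eta (x i) - eta (x j)) =
    norm_const q x n * (\<Prod>i<n. br (b * x i) * br (b / x i)) *
    (\<Prod>i<n. (-1)^i * ((eta (x i / q) - eta (q * x i)) * cofactor_poly q x n i (eta (x i)))) *
    (\<Prod>i<n. - 1 / br ((x i)^2)) * (\<Prod>k<n. shifted_prod q x n (eta (x k)) / br ((x k)^2)) *
    Determinant.det (mat n n (\<lambda>(i, k). entry q (x i) (x k)))"
    and "vandermonde (nodes q x n) \<noteq> 0"
    and "\<And>i j. i < j \<Longrightarrow> j < n \<Longrightarrow> eta (x i) \<noteq> eta (x j)"
proof -
  let ?I = "{..<n} \<times> (UNIV :: bool set)"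
  have pbne: "bracket4 q (x i) (x j) \<noteq> 0" if "i < n" "j < n" for i j
    using qd[of i j] qd[of j i] qm[of i j] that by (simp add: bracket4_def)
  show ne: "eta (x i) \<noteq> eta (x j)" if "i < j" "j < n" for i j
  proof -
    have "eta (x i) - eta (x j) \<noteq> 0" using d[of i j] m[of i j] x[of i] x[of j] that by (simp add: eta_diff)
    then show ?thesis by simp
  qed
  have ne': "eta (x i) \<noteq> eta (x j)" if "i < n" "j < n" "i \<noteq> j" for i j
    using ne[of i j] ne[of j i] that by (cases "i < j") auto
  have sq: "br ((x i)^2) \<noteq> 0" if "i < n" for i using m[of i i] that by (simp add: power2_eq_square)
  have yx: "eta (x k) \<noteq> eta (q * x i) \<and> eta (x k) \<noteq> eta (x i / q)" if "i < n" "k < n" for i k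
    using bracket4_eta[OF q x[OF that(1)] x[OF that(2)]] pbne[OF that] by auto
  have br1: "br q \<noteq> 0" if "i < n" for i using qd[of i i] x[of i] that by simp
  have da: "node_d q (x i) \<noteq> node_a q (x j)" if "i < n" "j < n" for i j
  proof -
    have "node_d q (x i) - node_a q (x j) = - (br (x i * x j) * br (q * x j / x i))"
      using q x[OF that(1)] x[OF that(2)] by (simp add: node_d_def node_a_def br_def field_simps power2_eq_square)
    then have "node_d q (x i) - node_a q (x j) \<noteq> 0" using m[OF that] qd[OF that(2,1)] by simp
    then show ?thesis by simp
  qed
  have node_d: "node_d q (x i) \<noteq> node_d q (x j)" and node_a: "node_a q (x i) \<noteq> node_a q (x j)" if "i < n" "j < n" "i \<noteq> j" for i j
  proof -
    have "node_d q (x i) - node_d q (x j) = - (br (q / (x i * x j)) * br (x i / x j))"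
      "node_a q (x i) - node_a q (x j) = br (q * x i * x j) * br (x i / x j)"
      using q x[OF that(1)] x[OF that(2)] by (simp_all add: node_d_def node_a_def br_def field_simps power2_eq_square)
    then have "node_d q (x i) - node_d q (x j) \<noteq> 0" "node_a q (x i) - node_a q (x j) \<noteq> 0"
      using d[OF that] qm[OF that(1,2)] by simp_all
    then show "node_d q (x i) \<noteq> node_d q (x j)" "node_a q (x i) \<noteq> node_a q (x j)" by simp_all
  qed
  have ix: "inj_on (node q x) ?I"
  proof (rule inj_onI)
    fix p p' assume p: "p \<in> ?I" "p' \<in> ?I" and e: "node q x p = node q x p'"
    obtain i s j s' where pp: "p = (i, s)" "p' = (j, s')" by (cases p; cases p')
    then have ij: "i < n" "j < n" using p by auto
    show "p = p'"
      using e da[OF ij] da[OF ij(2,1)] node_d[OF ij] node_a[OF ij] unfolding pp node_def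
      by (cases s; cases s'; cases "i = j") auto
  qed
  have "vandermonde (nodes q x n) = (\<Prod>i<n. node_d q (x i) - node_a q (x i)) *
    ((\<Prod>j<n. \<Prod>i<j. bracket4 q (x i) (x j)) * (\<Prod>j<n. \<Prod>i<j. (eta (x i) - eta (x j))^2))"
    by (rule vandermonde_nodes[OF q x])
  then show "vandermonde (nodes q x n) \<noteq> 0"
    using da pbne ne by auto
  \<comment> \<open>Only the half \<open>y\<close> of the rapidities moves; the rapidities
    \<open>1/x k\<close>, the inhomogeneities and the boundary state stay fixed.\<close>
  define f where "f = (\<lambda>t. pairing (2 * n) (chi q b n x) (B_product q s (inhom x) (2 * n) (map (rapidity x (\<lambda>k. x k * t)) (row_idx n))) *
    vandermonde (nodes q x n) * (\<Prod>j<n. \<Prod>i<j. eta (x i) - eta (x j)) * (\<Prod>j<n. \<Prod>i<j. eta (x i * t) - eta (x j * t)))"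
  define g where "g = (\<lambda>t. norm_const q x n * (\<Prod>i<n. br (b * x i) * br (b / (x i * t))) *
    (\<Prod>i<n. (-1)^i * ((eta (x i / q) - eta (q * x i)) * cofactor_poly q x n i (eta (x i)))) *
    (\<Prod>i<n. - 1 / br ((x i)^2)) * (\<Prod>k<n. shifted_prod q x n (eta (x k * t)) / br ((x k * t)^2)) *
    Determinant.det (mat n n (\<lambda>(i, k). entry q (x i) (x k * t))))"
  have ih: "inhom x i \<noteq> 0" if "i < 2 * n" for i using x[of "i div 2"] that by (auto simp: inhom_def)
  have "isCont f 1"
    unfolding f_def pairing_def
  proof (intro continuous_intros isCont_B_product q ih isCont_eta)
    fix k assume "k \<in> set (row_idx n)"
    then obtain i s where "k = (i, s)" "i < n" unfolding set_row_idx by (cases k) auto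
    then show "isCont (\<lambda>t. rapidity x (\<lambda>k. x k * t) k) 1 \<and> rapidity x (\<lambda>k. x k * 1) k \<noteq> 0"
      using x by (cases s) (auto simp: rapidity_def)
  qed (use x in auto)
  moreover have "isCont g 1"
  proof -
    have ent: "isCont (\<lambda>t. entry q (x i) (x k * t)) 1" if "i < n" "k < n" for i k
      unfolding entry_def using q x[OF that(1)] x[OF that(2)] qd[OF that] qd[OF that(2,1)] qm[OF that]
      by (intro continuous_intros isCont_br) auto
    show ?thesis
      unfolding g_def shifted_prod_def using b x sq ent
      by (intro continuous_intros isCont_br isCont_det isCont_eta) auto
  qed
  moreover have "eventually (\<lambda>t. f t = g t) (at 1)"
  proof -
    have "eventually (\<lambda>t. (\<forall>i\<in>{..<n}. \<forall>k\<in>{..<n}. eta (x k * t) \<noteq> eta (x i) \<and> eta (x k * t) \<noteq> eta (q * x i) \<and> eta (x k * t) \<noteq> eta (x i / q)) \<and>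
        (\<forall>i\<in>{..<n}. \<forall>k\<in>{..<n}. br (x i * x k * t^2) \<noteq> 0) \<and> t \<noteq> 0) (at 1)"
      by (intro eventually_conj eventually_ball_finite ballI finite_lessThan eventually_eta_ne eventually_br_sq_nz eventually_neq_at_within)
        (use q x in auto)
    then show ?thesis
    proof eventually_elim
      case (elim t)
      define y where "y = (\<lambda>k. x k * t)"
      have y0: "y i \<noteq> 0" if "i < n" for i using x[OF that] elim by (simp add: y_def)
      have yy: "eta (y i) \<noteq> eta (y k)" if "i < n" "k < n" "i \<noteq> k" for i k
      proof -
        have "eta (y i) - eta (y k) = br (x i / x k) * br (x i * x k * t^2)"
          using y0[OF that(1)] y0[OF that(2)] elim by (simp add: y_def eta_diff power2_eq_square mult_ac)
        then have "eta (y i) - eta (y k) \<noteq> 0" using d[OF that] elim that by auto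
        then show ?thesis by simp
      qed
      have iy: "inj_on (\<lambda>p. eta (rapidity x y p)) ?I"
      proof (rule inj_onI)
        fix p p' assume p: "p \<in> ?I" "p' \<in> ?I" and e: "eta (rapidity x y p) = eta (rapidity x y p')"
        obtain i s j s' where pp: "p = (i, s)" "p' = (j, s')" by (cases p; cases p')
        then have ij: "i < n" "j < n" using p by auto
        have xy: "eta (y k) \<noteq> eta (x l)" if "k < n" "l < n" for k l using elim that by (auto simp: y_def)
        show "p = p'"
          using e ne'[OF ij] yy[OF ij] xy[OF ij] xy[OF ij(2,1)] unfolding pp
          by (cases s; cases s'; cases "i = j") (auto simp: rapidity_def eta_inverse)
      qed
      let ?zs = "map (rapidity x y) (row_idx n)"
      have "inj_on (eta \<circ> rapidity x y) ?I" using iy by (simp add: comp_def)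
      then have injp: "inj_on (rapidity x y) ?I" and inje: "inj_on eta (rapidity x y ` ?I)"
        using inj_on_imageI2 inj_on_imageI by blast+
      have dz: "distinct ?zs" using injp by (simp add: distinct_map distinct_row_idx set_row_idx)
      have sz: "set ?zs = rapidity x y ` ?I" by (simp add: set_row_idx)
      have gz: "generic_set (set ?zs)"
        unfolding sz by (rule generic_set_eta[OF _ _ inje]) (use x y0 in \<open>auto simp: rapidity_def split: if_splits\<close>)
      have "pairing (2 * n) (chi q b n x) (B_product q s (inhom x) (2 * n) ?zs) = overlap q s b x n (rapidity x y ` ?I)"
        unfolding sz[symmetric] by (rule overlap_eq_B_product[symmetric, OF q s x dz gz])
      then have "f t = overlap q s b x n (rapidity x y ` ?I) * vandermonde (nodes q x n) *
        (\<Prod>j<n. \<Prod>i<j. eta (x i) - eta (x j)) * (\<Prod>j<n. \<Prod>i<j. eta (y i) - eta (y j))"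
        by (simp add: f_def y_def)
      also have "\<dots> = norm_const q x n * (\<Prod>i<n. br (b * x i) * br (b / y i)) *
        (\<Prod>i<n. (-1)^i * ((eta (x i / q) - eta (q * x i)) * cofactor_poly q x n i (eta (x i)))) *
        (\<Prod>i<n. - 1 / br ((x i)^2)) * (\<Prod>k<n. shifted_prod q x n (eta (y k)) / br ((y k)^2)) *
        Determinant.det (mat n n (\<lambda>(i, k). entry q (x i) (y k)))"
      proof (rule overlap_eq_det[OF q s b x y0 ix iy])
        show "br ((x i)^2) \<noteq> 0 \<and> br ((y i)^2) \<noteq> 0" if "i < n" for i
          using sq[OF that] elim that by (auto simp: y_def power2_eq_square mult_ac)
        show "eta (y k) \<noteq> eta (q * x i) \<and> eta (y k) \<noteq> eta (x i / q)" if "i < n" "k < n" for i k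
          using elim that by (auto simp: y_def)
        show "eta (x i) \<noteq> eta (q * x i)" if "i < n" for i using yx[OF that that] by simp
      qed
      also have "\<dots> = g t" by (simp add: g_def y_def)
      finally show ?case .
    qed
  qed
  ultimately have fg: "f 1 = g 1" by (rule isCont_eq_at_limit)
  note inj = inj_on_rapidity[OF x d m]
  have "pairing (2 * n) (chi q b n x) (B_product q s (inhom x) (2 * n) (map (rapidity x x) (row_idx n))) = overlap q s b x n (set (map (rapidity x x) (row_idx n)))"
    by (rule overlap_eq_B_product[symmetric, OF q s x]) (use inj in \<open>simp_all add: distinct_map distinct_row_idx set_row_idx\<close>)
  also have "\<dots> = Xi_D q s n x b"
    using Xi_D_eq_overlap[OF q s x inj] by (simp add: set_row_idx)
  finally show "Xi_D q s n x b * vandermonde (nodes q x n) *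
      (\<Prod>j<n. \<Prod>i<j. eta (x i) - eta (x j)) * (\<Prod>j<n. \<Prod>i<j. eta (x i) - eta (x j)) =
    norm_const q x n * (\<Prod>i<n. br (b * x i) * br (b / x i)) *
    (\<Prod>i<n. (-1)^i * ((eta (x i / q) - eta (q * x i)) * cofactor_poly q x n i (eta (x i)))) *
    (\<Prod>i<n. - 1 / br ((x i)^2)) * (\<Prod>k<n. shifted_prod q x n (eta (x k)) / br ((x k)^2)) *
    Determinant.det (mat n n (\<lambda>(i, k). entry q (x i) (x k)))"
    using fg by (simp add: f_def g_def)
qed

theorem proposition5p4:
  fixes q s b :: complex and n :: nat and x :: "nat \<Rightarrow> complex"
  assumes q: "q \<noteq> 0"
    and s: "s^2 = br q * br (q^2)"
    and b: "b \<noteq> 0"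
    and x: "\<And>i. i < n \<Longrightarrow> x i \<noteq> 0"
    and generic1: "\<And>i j. i < n \<Longrightarrow> j < n \<Longrightarrow> i \<noteq> j \<Longrightarrow>
                     br (x i / x j) \<noteq> 0 \<and> br (q * x i / x j) \<noteq> 0"
    and generic2: "\<And>i j. i < n \<Longrightarrow> j < n \<Longrightarrow>
                     br (x i * x j) \<noteq> 0 \<and> br (q * x i * x j) \<noteq> 0 \<and> br (q / (x i * x j)) \<noteq> 0"
  shows "Xi_D q s n x b =
           (br q ^ n * (\<Prod>i<n. br (b * x i)) *
            (\<Prod>j<2*n. \<Prod>i<j. br (q * inhom x i / inhom x j)))
           * ZU q n x x b"
proof (cases "br q = 0 \<and> n > 0")
  \<comment> \<open>\<open>generic1\<close> says nothing about \<open>i = j\<close>, so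
    \<open>[q] = 0\<close> is possible, and then the two nodes of each \<open>x i\<close> coincide.
    Both sides are zero: the overlap carries \<open>s^2\<close>, the prefactor \<open>[q]^n\<close>
    with \<open>n > 0\<close>.\<close>
  case True
  then obtain m where m: "n = Suc m" by (cases n) auto
  have gen: "inj_on (rapidity x x) ({..<n} \<times> UNIV)" "generic_set (rapidity x x ` ({..<n} \<times> UNIV))"
    by (rule inj_on_rapidity; use x generic1 generic2 in blast)+
  have "overlap q s b x (Suc m) (rapidity x x ` ({..<n} \<times> UNIV)) = 0"
    by (subst overlap_Suc[where x = x and n = m, OF q b _ gen(2)]) (use True s m x in simp_all)
  then have "Xi_D q s n x b = 0"
    using Xi_D_eq_overlap[OF q s x gen] m by simp
  then show ?thesis using True by simp
next
  case False
  have qd: "br (q * x i / x j) \<noteq> 0" if "i < n" "j < n" for i j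
    using generic1[OF that] False x[OF that(1)] that by (cases "i = j") auto
  \<comment> \<open>Tsuchiya's formula is regular at \<open>y = x\<close>, so \<open>ZU\<close> is
    the formula itself; the coincidence was singular only in the determinant for the
    overlap.\<close>
  have reg: "ZU_regular q n x x"
    unfolding ZU_regular_def
  proof (intro conjI allI impI)
    fix i j assume ij: "j < n" "i < j"
    show "br (x j / x i) \<noteq> 0" "br (x i / x j) \<noteq> 0" using generic1[of i j] generic1[of j i] ij by auto
  next
    fix i j assume ij: "j < n" "i \<le> j"
    have "br (1 / (x i * x j)) = - br (x i * x j)" using x[of i] x[of j] ij by (simp add: br_def field_simps)
    then show "br (1 / (x i * x j)) \<noteq> 0" "br (x i * x j) \<noteq> 0" using generic2[of i j] ij by auto
  next
    fix i j assume ij: "i < n" "j < n"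
    show "br (q * x i / x j) \<noteq> 0" "br (q * x j / x i) \<noteq> 0" "br (q * x i * x j) \<noteq> 0" "br (q / (x i * x j)) \<noteq> 0"
      using qd[OF ij] qd[OF ij(2,1)] generic2[OF ij] by auto
  qed
  let ?R = "br q ^ n * (\<Prod>i<n. br (b * x i)) * (\<Prod>j<2*n. \<Prod>i<j. br (q * inhom x i / inhom x j))"
  define V where "V = vandermonde (nodes q x n)"
  define P where "P = (\<Prod>j<n. \<Prod>i<j. eta (x i) - eta (x j))"
  define D where "D = Determinant.det (mat n n (\<lambda>(i, k). entry q (x i) (x k)))"
  define Z where "Z = (br (q^2) ^ n * (\<Prod>i<n. br (b / x i) * br (q^2 * (x i)^2)) *
      (\<Prod>i<n. \<Prod>j<n. br (q * x i / x j) * br (q * x j / x i) *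
                      br (q * x i * x j) * br (q / (x i * x j))))
     / ((\<Prod>j<n. \<Prod>i<j. br (x j / x i) * br (x i / x j)) *
        (\<Prod>j<n. \<Prod>i\<le>j. br (1 / (x i * x j)) * br (x i * x j)))"
  have ne: "eta (x i) \<noteq> eta (x j)" if "i < j" "j < n" for i j
    by (rule Xi_D_limit(3)[OF q s b x _ qd]) (use that generic1 generic2 in blast)+
  have V0: "V \<noteq> 0"
    unfolding V_def by (rule Xi_D_limit(2)[OF q s b x _ qd]) (use generic1 generic2 in blast)+
  have P0: "P \<noteq> 0" using ne by (auto simp: P_def)
  have sq: "br ((x i)^2) \<noteq> 0" if "i < n" for i
    using generic2[OF that that] by (simp add: power2_eq_square)
  have "Xi_D q s n x b * V * P * P =
    norm_const q x n * (\<Prod>i<n. br (b * x i) * br (b / x i)) *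
    (\<Prod>i<n. (-1)^i * ((eta (x i / q) - eta (q * x i)) * cofactor_poly q x n i (eta (x i)))) *
    (\<Prod>i<n. - 1 / br ((x i)^2)) * (\<Prod>k<n. shifted_prod q x n (eta (x k)) / br ((x k)^2)) * D"
    unfolding V_def P_def D_def
    by (rule Xi_D_limit(1)[OF q s b x _ qd]) (use generic1 generic2 in blast)+
  also have "norm_const q x n * (\<Prod>i<n. br (b * x i) * br (b / x i)) *
    (\<Prod>i<n. (-1)^i * ((eta (x i / q) - eta (q * x i)) * cofactor_poly q x n i (eta (x i)))) *
    (\<Prod>i<n. - 1 / br ((x i)^2)) * (\<Prod>k<n. shifted_prod q x n (eta (x k)) / br ((x k)^2)) = ?R * Z * V * P * P"
    unfolding Z_def V_def P_def by (rule prefactors_agree[OF q x ne sq])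
  also have "?R * Z * V * P * P * D = ?R * ZU q n x x b * V * P * P"
    by (simp add: ZU_def reg ZU_formula_def Z_def D_def entry_def)
  finally show ?thesis using V0 P0 by simp
qed

end
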